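(* Let $\mathbf M$ be a finite algebra. Assume that $\mathbf M$ is fully dualised by some standard alter ego. If an alter ego $\mathbb M$ fully dualises $\mathbf M$ at the finite level, then $\mathbb M$ is standard and fully dualises $\mathbf M$.
   Context: All algebras are non-empty (so "subalgebra" means non-empty subalgebra). $\mathbf M=\langle M;\Sigma\rangle$ is a finite algebra and $\mathcal A:=\mathsf{ISP}(\mathbf M)$ is the class of isomorphic copies of subalgebras of arbitrary (possibly zero) powers of $\mathbf M$. Compatibility: an $n$-ary relation $r\subseteq M^n$ ($n\ge 0$) is compatible with $\mathbf M$ if it is the underlying set of a subalgebra of $\mathbf M^n$; an $n$-ary partial operation $h$ on $M$ is compatible with $\mathbf M$ if $\mathrm{graph}(h)=\{(\vec a,h(\vec a))\mid \vec a\in\mathrm{dom}(h)\}$ is a compatible relation. An alter ego of $\mathbf M$ is $\mathbb M=\langle M;H,R,\mathcal T\rangle$ with $H$ a set of compatible partial operations (total and nullary operations allowed), $R$ a set of compatible relations and $\mathcal T$ the discrete topology. Dual categories: for an alter ego $\mathbb M$, $\mathcal Z$ is the category of Boolean structures of signature $(H,R)$: (possibly empty) compact Hausdorff totally disconnected spaces with continuous partial operations on closed domains and closed relations; morphisms are continuous maps preserving relations and the domains and graphs of partial operations. An induced substructure of $\mathbb Y$ is a subset closed under the partial operations (where defined), with subspace topology and restricted relations, domains and graphs. $\mathcal X:=\mathsf{IS_cP}^{+}(\mathbb M)$ consists of isomorphic copies of topologically closed induced substructures of powers $\mathbb M^S$, $S\neq\emptyset$ (the empty structure is included iff $H$ has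 no nullary operations). $D(\mathbf A)$ is the induced substructure of $\mathbb M^A$ on $\hom_{\mathcal A}(\mathbf A,\mathbf M)$, and $E(\mathbb Z)$ is the subalgebra of $\mathbf M^Z$ on $\hom_{\mathcal Z}(\mathbb Z,\mathbb M)$; $\eta_{\mathbf A}\colon\mathbf A\to ED(\mathbf A)$ and $\varepsilon_{\mathbb X}\colon\mathbb X\to DE(\mathbb X)$ are the evaluation maps $\eta_{\mathbf A}(a)(x)=x(a)$, $\varepsilon_{\mathbb X}(x)(u)=u(x)$. $\mathbb M$ fully dualises $\mathbf M$ [at the finite level] if $\eta_{\mathbf A}$ is an isomorphism for each [finite] $\mathbf A\in\mathcal A$ and $\varepsilon_{\mathbb X}$ is an isomorphism for each [finite] $\mathbb X\in\mathcal X$. Standardness: in the language of $(H,R)$ (all symbols of $H$ treated as partial operations), an atomic formula is $s=t$ (true iff both terms are defined and equal) or $\rho(t_1,\dots,t_n)$ with $\rho\in R$ (true iff all $t_i$ are defined and the tuple is in $\rho$). A uH-sentence is $\forall\vec v\,[(\bigwedge_{i=1}^\nu\alpha_i(\vec v))\to\gamma(\vec v)]$, $\nu\ge0$, with each $\alpha_i$ atomic and $\gamma$ atomic or $\bot$. $\mathrm{Th_{uH}}(\mathbb M)$ is the set of uH-sentences true in $\mathbb M$. $\mathbb M$ is standard if $\mathcal X=\{\mathbb Y\in\mathcal Z\mid\mathbb Y\models\mathrm{Th_{uH}}(\mathbb M)\}$. *)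

theory Defs
  imports "HOL-Analysis.Analysis"
begin

section \<open>Algebras\<close>

text \<open>
  An \<open>n\<close>-tuple over \<open>A\<close> is an extensional function on the index set \<open>{..<n}\<close>, so that \<open>A\<^sup>n\<close> is
  literally the power of \<open>A\<close> with index set \<open>{..<n}\<close>; \<open>A\<^sup>0\<close> has exactly one element.
  A symbol of any kind is a pair whose first component is its arity. For a map \<open>\<phi>\<close> and an
  \<open>n\<close>-tuple \<open>x\<close>, the tuple \<open>(\<phi> x\<^sub>0, \<dots>, \<phi> x\<^sub>n\<^sub>-\<^sub>1)\<close> is \<open>compose {..<n} \<phi> x\<close>.
\<close>

abbreviation arity :: "nat \<times> 's \<Rightarrow> nat" where
  "arity \<equiv> fst"

abbreviation tuples :: "nat \<Rightarrow> 'x set \<Rightarrow> (nat \<Rightarrow> 'x) set" where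
  "tuples n A \<equiv> {..<n} \<rightarrow>\<^sub>E A"

type_synonym 'f sig = "(nat \<times> 'f) set"

record ('f, 'x) algebra =
  carrier :: "'x set"
  opr :: "nat \<times> 'f \<Rightarrow> (nat \<Rightarrow> 'x) \<Rightarrow> 'x"

definition is_algebra :: "'f sig \<Rightarrow> ('f, 'x) algebra \<Rightarrow> bool" where
  "is_algebra \<Sigma> A \<longleftrightarrow>
     carrier A \<noteq> {} \<and>
     (\<forall>f\<in>\<Sigma>. \<forall>x\<in>tuples (arity f) (carrier A). opr A f x \<in> carrier A)"

definition alg_hom :: "'f sig \<Rightarrow> ('f, 'x) algebra \<Rightarrow> ('f, 'y) algebra \<Rightarrow> ('x \<Rightarrow> 'y) set" where
  "alg_hom \<Sigma> A B =
     {\<phi> \<in> carrier A \<rightarrow>\<^sub>E carrier B.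
        \<forall>f\<in>\<Sigma>. \<forall>x\<in>tuples (arity f) (carrier A).
          \<phi> (opr A f x) = opr B f (compose {..<arity f} \<phi> x)}"

definition alg_iso ::
    "'f sig \<Rightarrow> ('x \<Rightarrow> 'y) \<Rightarrow> ('f, 'x) algebra \<Rightarrow> ('f, 'y) algebra \<Rightarrow> bool" where
  "alg_iso \<Sigma> \<phi> A B \<longleftrightarrow> \<phi> \<in> alg_hom \<Sigma> A B \<and> bij_betw \<phi> (carrier A) (carrier B)"

definition subuniverse :: "'f sig \<Rightarrow> ('f, 'x) algebra \<Rightarrow> 'x set \<Rightarrow> bool" where
  "subuniverse \<Sigma> A B \<longleftrightarrow>
     B \<noteq> {} \<and> B \<subseteq> carrier A \<and>
     (\<forall>f\<in>\<Sigma>. \<forall>x\<in>tuples (arity f) B. opr A f x \<in> B)"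

definition subalgebra_on :: "('f, 'x) algebra \<Rightarrow> 'x set \<Rightarrow> ('f, 'x) algebra" where
  "subalgebra_on A B = A\<lparr>carrier := B\<rparr>"

definition alg_power :: "('f, 'x) algebra \<Rightarrow> 's set \<Rightarrow> ('f, 's \<Rightarrow> 'x) algebra" where
  "alg_power M S =
     \<lparr>carrier = S \<rightarrow>\<^sub>E carrier M,
      opr = \<lambda>f x. \<lambda>s\<in>S. opr M f (\<lambda>i\<in>{..<arity f}. x i s)\<rparr>"

text \<open>
  The class \<open>\<A> = ISP(M)\<close>, for algebras whose elements lie in the type \<open>'u\<close>. The index sets of the
  powers range over all sets of elements of \<open>'u \<Rightarrow> 'a\<close>. This loses nothing: if \<open>\<phi>\<close> embeds \<open>A\<close> in
  \<open>M\<^sup>S\<close> for a set \<open>S\<close> of any type, then \<open>S\<close> may be replaced by the set of homomorphisms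
  \<open>\<lambda>a\<in>carrier A. \<phi> a s\<close> with \<open>s \<in> S\<close>.
\<close>

definition ISP :: "'f sig \<Rightarrow> ('f, 'a) algebra \<Rightarrow> ('f, 'u) algebra set" where
  "ISP \<Sigma> M =
     {A. is_algebra \<Sigma> A \<and>
         (\<exists>(S :: ('u \<Rightarrow> 'a) set) B \<phi>.
            subuniverse \<Sigma> (alg_power M S) B \<and>
            alg_iso \<Sigma> \<phi> A (subalgebra_on (alg_power M S) B))}"


section \<open>Alter egos\<close>

text \<open>
  The partial operations and relations in an alter ego are also used as the symbols of its
  signature.
\<close>

type_synonym 'a popsym = "nat \<times> ((nat \<Rightarrow> 'a) \<rightharpoonup> 'a)"
type_synonym 'a relsym = "nat \<times> (nat \<Rightarrow> 'a) set"

record 'a alter_ego =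
  pops :: "'a popsym set"
  rels :: "'a relsym set"

definition compatible_rel :: "'f sig \<Rightarrow> ('f, 'a) algebra \<Rightarrow> 'a relsym \<Rightarrow> bool" where
  "compatible_rel \<Sigma> M \<rho> \<longleftrightarrow> subuniverse \<Sigma> (alg_power M {..<arity \<rho>}) (snd \<rho>)"

definition pop_graph :: "'a popsym \<Rightarrow> (nat \<Rightarrow> 'a) set" where
  "pop_graph h = {a(arity h := b) |a b. snd h a = Some b}"

definition compatible_pop :: "'f sig \<Rightarrow> ('f, 'a) algebra \<Rightarrow> 'a popsym \<Rightarrow> bool" where
  "compatible_pop \<Sigma> M h \<longleftrightarrow>
     dom (snd h) \<subseteq> tuples (arity h) (carrier M) \<and>
     compatible_rel \<Sigma> M (Suc (arity h), pop_graph h)"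

definition is_alter_ego :: "'f sig \<Rightarrow> ('f, 'a) algebra \<Rightarrow> 'a alter_ego \<Rightarrow> bool" where
  "is_alter_ego \<Sigma> M E \<longleftrightarrow>
     (\<forall>h\<in>pops E. compatible_pop \<Sigma> M h) \<and> (\<forall>\<rho>\<in>rels E. compatible_rel \<Sigma> M \<rho>)"


section \<open>Boolean structures\<close>

record ('a, 'x) tstruct =
  space :: "'x topology"
  pop :: "'a popsym \<Rightarrow> (nat \<Rightarrow> 'x) \<rightharpoonup> 'x"
  rel :: "'a relsym \<Rightarrow> (nat \<Rightarrow> 'x) set"

abbreviation points :: "('a, 'x) tstruct \<Rightarrow> 'x set" where
  "points Y \<equiv> topspace (space Y)"

abbreviation tuple_space :: "nat \<Rightarrow> 'x topology \<Rightarrow> (nat \<Rightarrow> 'x) topology" where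
  "tuple_space n T \<equiv> product_topology (\<lambda>_. T) {..<n}"

definition totally_disconnected :: "'x topology \<Rightarrow> bool" where
  "totally_disconnected T \<longleftrightarrow> (\<forall>C. connectedin T C \<longrightarrow> (\<exists>x. C \<subseteq> {x}))"

text \<open>
  The objects of \<open>\<Z>\<close>. Interpretations of symbols outside the signature of \<open>E\<close> are
  unconstrained, and are ignored by everything below.
\<close>

definition boolean_struct :: "'a alter_ego \<Rightarrow> ('a, 'x) tstruct \<Rightarrow> bool" where
  "boolean_struct E Y \<longleftrightarrow>
     compact_space (space Y) \<and> Hausdorff_space (space Y) \<and> totally_disconnected (space Y) \<and>
     (\<forall>h\<in>pops E.
        closedin (tuple_space (arity h) (space Y)) (dom (pop Y h)) \<and>
        continuous_map (subtopology (tuple_space (arity h) (space Y)) (dom (pop Y h))) (space Y)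
          (\<lambda>x. the (pop Y h x))) \<and>
     (\<forall>\<rho>\<in>rels E. closedin (tuple_space (arity \<rho>) (space Y)) (rel Y \<rho>))"

definition mor ::
    "'a alter_ego \<Rightarrow> ('a, 'x) tstruct \<Rightarrow> ('a, 'y) tstruct \<Rightarrow> ('x \<Rightarrow> 'y) set" where
  "mor E Y Z =
     {\<phi> \<in> points Y \<rightarrow>\<^sub>E points Z.
        continuous_map (space Y) (space Z) \<phi> \<and>
        (\<forall>h\<in>pops E. \<forall>x y. pop Y h x = Some y \<longrightarrow>
            pop Z h (compose {..<arity h} \<phi> x) = Some (\<phi> y)) \<and>
        (\<forall>\<rho>\<in>rels E. \<forall>x\<in>rel Y \<rho>. compose {..<arity \<rho>} \<phi> x \<in> rel Z \<rho>)}"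

text \<open>Isomorphism in the category \<open>\<Z>\<close>; a bijective morphism need not reflect relations and
  domains.\<close>

definition struct_iso ::
    "'a alter_ego \<Rightarrow> ('x \<Rightarrow> 'y) \<Rightarrow> ('a, 'x) tstruct \<Rightarrow> ('a, 'y) tstruct \<Rightarrow> bool" where
  "struct_iso E \<phi> Y Z \<longleftrightarrow>
     \<phi> \<in> mor E Y Z \<and>
     (\<exists>\<psi>\<in>mor E Z Y. (\<forall>y\<in>points Y. \<psi> (\<phi> y) = y) \<and> (\<forall>z\<in>points Z. \<phi> (\<psi> z) = z))"

definition closed_under_pops :: "'a alter_ego \<Rightarrow> ('a, 'x) tstruct \<Rightarrow> 'x set \<Rightarrow> bool" where
  "closed_under_pops E Y C \<longleftrightarrow>
     C \<subseteq> points Y \<and>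
     (\<forall>h\<in>pops E. \<forall>x\<in>tuples (arity h) C. \<forall>y. pop Y h x = Some y \<longrightarrow> y \<in> C)"

definition induced_on :: "('a, 'x) tstruct \<Rightarrow> 'x set \<Rightarrow> ('a, 'x) tstruct" where
  "induced_on Y C =
     \<lparr>space = subtopology (space Y) C,
      pop = \<lambda>h. pop Y h |` tuples (arity h) C,
      rel = \<lambda>\<rho>. rel Y \<rho> \<inter> tuples (arity \<rho>) C\<rparr>"

definition ego_struct :: "('f, 'a) algebra \<Rightarrow> ('a, 'a) tstruct" where
  "ego_struct M = \<lparr>space = discrete_topology (carrier M), pop = snd, rel = snd\<rparr>"

definition struct_power :: "('a, 'x) tstruct \<Rightarrow> 's set \<Rightarrow> ('a, 's \<Rightarrow> 'x) tstruct" where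
  "struct_power Y S =
     \<lparr>space = product_topology (\<lambda>_. space Y) S,
      pop = \<lambda>h x.
        if x \<in> tuples (arity h) (S \<rightarrow>\<^sub>E points Y) \<and>
           (\<forall>s\<in>S. (\<lambda>i\<in>{..<arity h}. x i s) \<in> dom (pop Y h))
        then Some (\<lambda>s\<in>S. the (pop Y h (\<lambda>i\<in>{..<arity h}. x i s)))
        else None,
      rel = \<lambda>\<rho>. {x \<in> tuples (arity \<rho>) (S \<rightarrow>\<^sub>E points Y).
                   \<forall>s\<in>S. (\<lambda>i\<in>{..<arity \<rho>}. x i s) \<in> rel Y \<rho>}\<rparr>"

text \<open>
  The class \<open>\<X> = IS\<^sub>cP\<^sup>+(\<bbbM>)\<close> for structures whose points lie in the type \<open>'u\<close>. As for \<^const>\<open>ISP\<close>,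
  index sets in \<open>'u \<Rightarrow> 'a\<close> suffice. The empty set is closed under the partial operations exactly
  if no nullary one is defined, and compatible nullary operations are always defined.
\<close>

definition IScP ::
    "('f, 'a) algebra \<Rightarrow> 'a alter_ego \<Rightarrow> ('a, 'u) tstruct set" where
  "IScP M E =
     {X. boolean_struct E X \<and>
         (\<exists>(S :: ('u \<Rightarrow> 'a) set) C \<phi>.
            S \<noteq> {} \<and>
            closedin (space (struct_power (ego_struct M) S)) C \<and>
            closed_under_pops E (struct_power (ego_struct M) S) C \<and>
            struct_iso E \<phi> X (induced_on (struct_power (ego_struct M) S) C))}"


section \<open>Full dualities\<close>

definition dual_D ::
    "'f sig \<Rightarrow> ('f, 'a) algebra \<Rightarrow> ('f, 'u) algebra \<Rightarrow> ('a, 'u \<Rightarrow> 'a) tstruct" where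
  "dual_D \<Sigma> M A = induced_on (struct_power (ego_struct M) (carrier A)) (alg_hom \<Sigma> A M)"

definition dual_E ::
    "('f, 'a) algebra \<Rightarrow> 'a alter_ego \<Rightarrow> ('a, 'u) tstruct \<Rightarrow> ('f, 'u \<Rightarrow> 'a) algebra" where
  "dual_E M E Z = subalgebra_on (alg_power M (points Z)) (mor E Z (ego_struct M))"

definition eval_alg ::
    "'f sig \<Rightarrow> ('f, 'a) algebra \<Rightarrow> ('f, 'u) algebra \<Rightarrow> 'u \<Rightarrow> ('u \<Rightarrow> 'a) \<Rightarrow> 'a" where
  "eval_alg \<Sigma> M A = (\<lambda>a\<in>carrier A. \<lambda>x\<in>alg_hom \<Sigma> A M. x a)"

definition eval_struct ::
    "('f, 'a) algebra \<Rightarrow> 'a alter_ego \<Rightarrow> ('a, 'u) tstruct \<Rightarrow> 'u \<Rightarrow> ('u \<Rightarrow> 'a) \<Rightarrow> 'a" where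
  "eval_struct M E X = (\<lambda>x\<in>points X. \<lambda>u\<in>mor E X (ego_struct M). u x)"

text \<open>
  HOL cannot quantify over all types inside a formula, so the notions that range over all members
  of \<open>\<A>\<close> or \<open>\<X>\<close> take as universe a type \<open>'u\<close> that contains the elements of these members.
  An infinite \<open>'u\<close> contains a copy of every finite algebra and every finite structure, and a
  statement proved for all infinite \<open>'u\<close> covers algebras and structures of every size.
\<close>

definition fully_dualises ::
    "'u itself \<Rightarrow> 'f sig \<Rightarrow> ('f, 'a) algebra \<Rightarrow> 'a alter_ego \<Rightarrow> bool" where
  "fully_dualises (_ :: 'u itself) \<Sigma> M E \<longleftrightarrow>
     (\<forall>A :: ('f, 'u) algebra. A \<in> ISP \<Sigma> M \<longrightarrow>
        alg_iso \<Sigma> (eval_alg \<Sigma> M A) A (dual_E M E (dual_D \<Sigma> M A))) \<and>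
     (\<forall>X :: ('a, 'u) tstruct. X \<in> IScP M E \<longrightarrow>
        struct_iso E (eval_struct M E X) X (dual_D \<Sigma> M (dual_E M E X)))"

definition fully_dualises_finite ::
    "'u itself \<Rightarrow> 'f sig \<Rightarrow> ('f, 'a) algebra \<Rightarrow> 'a alter_ego \<Rightarrow> bool" where
  "fully_dualises_finite (_ :: 'u itself) \<Sigma> M E \<longleftrightarrow>
     (\<forall>A :: ('f, 'u) algebra. A \<in> ISP \<Sigma> M \<and> finite (carrier A) \<longrightarrow>
        alg_iso \<Sigma> (eval_alg \<Sigma> M A) A (dual_E M E (dual_D \<Sigma> M A))) \<and>
     (\<forall>X :: ('a, 'u) tstruct. X \<in> IScP M E \<and> finite (points X) \<longrightarrow>
        struct_iso E (eval_struct M E X) X (dual_D \<Sigma> M (dual_E M E X)))"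


section \<open>Universal Horn sentences and standardness\<close>

datatype 'a trm = Var nat | App "'a popsym" "'a trm list"

datatype 'a atom = Eq "'a trm" "'a trm" | Rel "'a relsym" "'a trm list"

definition tuple_of :: "'x list \<Rightarrow> nat \<Rightarrow> 'x" where
  "tuple_of xs = (\<lambda>i\<in>{..<length xs}. xs ! i)"

primrec term_val :: "('a, 'x) tstruct \<Rightarrow> (nat \<Rightarrow> 'x) \<Rightarrow> 'a trm \<Rightarrow> 'x option" where
  "term_val Y v (Var i) = Some (v i)"
| "term_val Y v (App h ts) =
     Option.bind (those (map (term_val Y v) ts)) (\<lambda>xs. pop Y h (tuple_of xs))"

primrec atom_true :: "('a, 'x) tstruct \<Rightarrow> (nat \<Rightarrow> 'x) \<Rightarrow> 'a atom \<Rightarrow> bool" where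
  "atom_true Y v (Eq s t) \<longleftrightarrow> (\<exists>y. term_val Y v s = Some y \<and> term_val Y v t = Some y)"
| "atom_true Y v (Rel \<rho> ts) \<longleftrightarrow>
     (\<exists>xs. those (map (term_val Y v) ts) = Some xs \<and> tuple_of xs \<in> rel Y \<rho>)"

primrec wf_trm :: "'a alter_ego \<Rightarrow> nat \<Rightarrow> 'a trm \<Rightarrow> bool" where
  "wf_trm E k (Var i) \<longleftrightarrow> i < k"
| "wf_trm E k (App h ts) \<longleftrightarrow> h \<in> pops E \<and> length ts = arity h \<and> list_all (wf_trm E k) ts"

primrec wf_atom :: "'a alter_ego \<Rightarrow> nat \<Rightarrow> 'a atom \<Rightarrow> bool" where
  "wf_atom E k (Eq s t) \<longleftrightarrow> wf_trm E k s \<and> wf_trm E k t"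
| "wf_atom E k (Rel \<rho> ts) \<longleftrightarrow>
     \<rho> \<in> rels E \<and> length ts = arity \<rho> \<and> list_all (wf_trm E k) ts"

text \<open>
  The sentence \<open>\<forall>v\<^sub>0 \<dots> v\<^sub>k\<^sub>-\<^sub>1. (\<And>\<alpha>s) \<longrightarrow> \<gamma>\<close> is \<open>UH k \<alpha>s c\<close>, where \<open>c\<close> is \<open>None\<close> for \<open>\<gamma> = \<bottom>\<close> and
  \<open>Some \<gamma>\<close> otherwise. The number \<open>k\<close> of quantified variables is recorded because a sentence without
  variables is not vacuous in the empty structure.
\<close>

datatype 'a uh_sentence =
  UH (uh_vars: nat) (uh_premises: "'a atom list") (uh_conclusion: "'a atom option")

definition uh_sentences :: "'a alter_ego \<Rightarrow> 'a uh_sentence set" where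
  "uh_sentences E =
     {\<sigma>. (\<forall>\<alpha>\<in>set (uh_premises \<sigma>). wf_atom E (uh_vars \<sigma>) \<alpha>) \<and>
          (\<forall>\<gamma>. uh_conclusion \<sigma> = Some \<gamma> \<longrightarrow> wf_atom E (uh_vars \<sigma>) \<gamma>)}"

definition uh_true :: "('a, 'x) tstruct \<Rightarrow> 'a uh_sentence \<Rightarrow> bool" where
  "uh_true Y \<sigma> \<longleftrightarrow>
     (\<forall>v\<in>tuples (uh_vars \<sigma>) (points Y).
        (\<forall>\<alpha>\<in>set (uh_premises \<sigma>). atom_true Y v \<alpha>) \<longrightarrow>
        (case uh_conclusion \<sigma> of None \<Rightarrow> False | Some \<gamma> \<Rightarrow> atom_true Y v \<gamma>))"

definition Th_uH :: "('f, 'a) algebra \<Rightarrow> 'a alter_ego \<Rightarrow> 'a uh_sentence set" where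
  "Th_uH M E = {\<sigma> \<in> uh_sentences E. uh_true (ego_struct M) \<sigma>}"

definition standard :: "'u itself \<Rightarrow> ('f, 'a) algebra \<Rightarrow> 'a alter_ego \<Rightarrow> bool" where
  "standard (_ :: 'u itself) M E \<longleftrightarrow>
     (IScP M E :: ('a, 'u) tstruct set) =
       {Y. boolean_struct E Y \<and> (\<forall>\<sigma>\<in>Th_uH M E. uh_true Y \<sigma>)}"

end

theory Submission
  imports Defs
begin

text \<open>
  Let \<open>E'\<close> be the standard alter ego and \<open>E\<close> the one that fully dualises \<open>M\<close> at the finite level. A
  Boolean model \<open>Y\<close> of the universal Horn theory of \<open>E\<close> is a directed union of finite substructures
  \<open>X\<close>, each embedded in a finite power of \<open>M\<close>. By the finite-level duality \<open>X\<close> is \<open>D(E(X))\<close>, so every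
  relation \<open>r\<close> compatible with \<open>M\<close> lives on \<open>X\<close>: a tuple belongs to it iff all morphisms from \<open>X\<close> to \<open>M\<close>
  send it into \<open>r\<close>, and equivalently iff it is the image of the projections under a morphism from
  \<open>D(r)\<close>. The first description makes the union over all \<open>X\<close> a model of the theory of \<open>E'\<close>; the
  second one makes the relations closed, by compactness. As \<open>E'\<close> is standard and fully dualises \<open>M\<close>, the
  enriched \<open>Y\<close> is represented by its morphisms into \<open>M\<close>, and these are the same for \<open>E\<close> and \<open>E'\<close>.
  Finally, each compatible relation \<open>r\<close> is determined by finitely many facts in the language of \<open>E'\<close> about
  \<open>D(r)\<close>; these already hold in some \<open>X\<close>, so that the relations and domains of \<open>E\<close> on \<open>Y\<close> are
  detected by morphisms into \<open>M\<close> as well.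
\<close>

section \<open>Preliminaries: tuples, symbols treated as relations, and closed graphs\<close>

section \<open>Tuples\<close>

text \<open>The obstacle is that \<open>E\<close> is known to work for finite algebras and finite
  structures only, whereas \<open>Y\<close> may be infinite and is not known to have any continuous
  morphism into \<open>M\<close>. No translation between the symbols of \<open>E\<close> and
  \<open>E'\<close> is assumed either, so \<open>Y\<close> cannot simply be reread in the other
  language; its finite pieces can, because a finite separated \<open>X\<close> remembers every
  compatible relation through E(X). Standardness of \<open>E'\<close> is what then produces
  morphisms on all of \<open>Y\<close>.

  The way back is not formal: a morphism on a finite piece is not known to extend to
  \<open>Y\<close>, so knowledge about \<open>Y\<close> must be brought down to a piece in the form
  of finitely many facts. Their finiteness comes from D(r): it has finitely many maps into
  \<open>M\<close>, and one violated fact excludes each map that is not a morphism.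

  Domains of partial operations need an argument of their own, since a domain is not a symbol. An
  operation \<open>h\<close> is viewed as a homomorphism into \<open>M\<close> from the algebra on
  its domain, and representation turns its value at a tuple of points into a point.\<close>

lemma compose_tuples: "t \<in> tuples n A \<Longrightarrow> u \<in> A \<rightarrow> B \<Longrightarrow> compose {..<n} u t \<in> tuples n B"
  by (auto simp: compose_def PiE_iff Pi_iff)

lemma compose_tuples_assoc:
  "compose {..<n} u (compose {..<n} w t) = compose {..<n} (u \<circ> w) t"
  by (auto simp: compose_def fun_eq_iff)

lemma compose_tuples_cong:
  "t \<in> tuples n A \<Longrightarrow> (\<And>x. x \<in> A \<Longrightarrow> u x = w x) \<Longrightarrow> compose {..<n} u t = compose {..<n} w t"
  by (auto simp: compose_def fun_eq_iff PiE_iff)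

lemma compose_tuples_id:
  "t \<in> tuples n A \<Longrightarrow> (\<And>x. x \<in> A \<Longrightarrow> u x = x) \<Longrightarrow> compose {..<n} u t = t"
  by (auto simp: compose_def fun_eq_iff PiE_iff extensional_def)

lemma tuple_upd_in: "x \<in> tuples n A \<Longrightarrow> y \<in> A \<Longrightarrow> x(n := y) \<in> tuples (Suc n) A"
  unfolding lessThan_Suc by (rule PiE_fun_upd)

lemma tuple_Suc_cases:
  assumes "t \<in> tuples (Suc n) A"
  obtains x y where "x \<in> tuples n A" "y \<in> A" "t = x(n := y)"
proof (rule that)
  have *: "t i \<in> A" if "i < Suc n" for i using assms that by (rule PiE_mem[OF _ iffD2[OF lessThan_iff]])
  from * show "restrict t {..<n} \<in> tuples n A" by (simp add: restrict_PiE_iff)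
  from * show "t n \<in> A" by simp
  have "t i = undefined" if "\<not> i < Suc n" for i using PiE_arb[OF assms] that by simp
  then show "t = (restrict t {..<n})(n := t n)"
    by (simp add: fun_eq_iff less_Suc_eq)
qed

lemma restrict_tuple_upd: "x \<in> tuples n A \<Longrightarrow> restrict (x(n := y)) {..<n} = x"
  by (auto simp: fun_eq_iff PiE_iff extensional_def)

lemma tuple_upd_eq_iff:
  assumes "x \<in> tuples n A" "x' \<in> tuples n B"
  shows "x(n := y) = x'(n := y') \<longleftrightarrow> x = x' \<and> y = y'"
  by (metis assms fun_upd_same restrict_tuple_upd)

lemma compose_tuple_upd: "compose {..<Suc n} u (x(n := y)) = (compose {..<n} u x)(n := u y)"
  by (auto simp: compose_def fun_eq_iff)

lemma tuples_subset_in: "t \<in> tuples n B \<Longrightarrow> B \<subseteq> A \<Longrightarrow> t \<in> tuples n A"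
  by (auto simp: PiE_iff)

lemma tuples_finite_image: "t \<in> tuples n A \<Longrightarrow> t \<in> tuples n (t ` {..<n})"
  by (auto simp: PiE_iff)

lemma tuple_of_in: "set xs \<subseteq> A \<Longrightarrow> tuple_of xs \<in> tuples (length xs) A"
  by (auto simp: tuple_of_def)

lemma tuple_of_map: "tuple_of (map f xs) = compose {..<length xs} f (tuple_of xs)"
  by (auto simp: tuple_of_def compose_def fun_eq_iff)

lemma tuple_of_map_upt:
  "t \<in> tuples n A \<Longrightarrow> tuple_of (map t [0..<n]) = t"
  by (auto simp: tuple_of_def fun_eq_iff PiE_iff extensional_def)

section \<open>Symbols\<close>

text \<open>A partial operation enters morphisms and relations through its graph only, so that it can be
  treated together with the relations.\<close>

type_synonym 'a sym = "'a popsym + 'a relsym"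

definition syms :: "'a alter_ego \<Rightarrow> 'a sym set" where
  "syms E = pops E <+> rels E"

primrec sym_rel :: "'a sym \<Rightarrow> 'a relsym" where
  "sym_rel (Inl h) = (Suc (arity h), pop_graph h)"
| "sym_rel (Inr \<rho>) = \<rho>"

abbreviation sym_arity :: "'a sym \<Rightarrow> nat" where
  "sym_arity s \<equiv> arity (sym_rel s)"

primrec interp :: "('a, 'x) tstruct \<Rightarrow> 'a sym \<Rightarrow> (nat \<Rightarrow> 'x) set" where
  "interp Y (Inl h) = {x(arity h := y) |x y. pop Y h x = Some y}"
| "interp Y (Inr \<rho>) = rel Y \<rho>"

text \<open>The part of \<open>boolean_struct\<close> that concerns membership only. Powers and
  \<open>dual_D\<close> are shown to satisfy just this, which is enough to handle morphisms and
  graphs on them.\<close>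

definition wf_struct :: "'a alter_ego \<Rightarrow> ('a, 'x) tstruct \<Rightarrow> bool" where
  "wf_struct E Y \<longleftrightarrow>
     (\<forall>h\<in>pops E. dom (pop Y h) \<subseteq> tuples (arity h) (points Y) \<and> ran (pop Y h) \<subseteq> points Y) \<and>
     (\<forall>\<rho>\<in>rels E. rel Y \<rho> \<subseteq> tuples (arity \<rho>) (points Y))"

lemma wf_struct_popD:
  assumes "wf_struct E Y" "h \<in> pops E" "pop Y h x = Some y"
  shows "x \<in> tuples (arity h) (points Y)" "y \<in> points Y"
  using assms unfolding wf_struct_def by (blast intro: ranI domI)+

lemma interp_subset_tuples:
  "wf_struct E Y \<Longrightarrow> s \<in> syms E \<Longrightarrow> interp Y s \<subseteq> tuples (sym_arity s) (points Y)"
proof (cases s)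
  case (Inl h)
  assume Y: "wf_struct E Y" and s: "s \<in> syms E"
  have h: "h \<in> pops E" using s unfolding Inl syms_def by blast
  have "x(arity h := y) \<in> tuples (Suc (arity h)) (points Y)" if "pop Y h x = Some y" for x y
    by (intro tuple_upd_in wf_struct_popD[OF Y h that])
  then show ?thesis unfolding Inl sym_rel.simps interp.simps fst_conv by blast
next
  case (Inr \<rho>)
  assume "wf_struct E Y" "s \<in> syms E"
  moreover from this have "\<rho> \<in> rels E" unfolding Inr syms_def by blast
  ultimately show ?thesis unfolding Inr wf_struct_def by simp
qed

lemma interp_pop_iff:
  assumes "wf_struct E Y" "h \<in> pops E" "x \<in> tuples (arity h) A"
  shows "x(arity h := y) \<in> interp Y (Inl h) \<longleftrightarrow> pop Y h x = Some y"
proof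
  assume "x(arity h := y) \<in> interp Y (Inl h)"
  then obtain x' y' where "pop Y h x' = Some y'" "x(arity h := y) = x'(arity h := y')"
    by auto
  with tuple_upd_eq_iff[OF assms(3) wf_struct_popD(1)[OF assms(1,2)]] show "pop Y h x = Some y"
    by metis
qed auto

lemma boolean_struct_wf: "boolean_struct E Y \<Longrightarrow> wf_struct E Y"
proof -
  assume b: "boolean_struct E Y"
  have "ran (pop Y h) \<subseteq> points Y" if h: "h \<in> pops E" for h
  proof
    fix y assume "y \<in> ran (pop Y h)"
    then obtain x where x: "pop Y h x = Some y" by (auto simp: ran_def)
    let ?T = "tuple_space (arity h) (space Y)"
    have c: "closedin ?T (dom (pop Y h))"
      "continuous_map (subtopology ?T (dom (pop Y h))) (space Y) (\<lambda>x. the (pop Y h x))"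
      using b h unfolding boolean_struct_def by blast+
    have "x \<in> topspace (subtopology ?T (dom (pop Y h)))"
      using closedin_subset[OF c(1)] x by auto
    with c(2) have "the (pop Y h x) \<in> points Y" unfolding continuous_map_def by blast
    then show "y \<in> points Y" using x by simp
  qed
  moreover have "dom (pop Y h) \<subseteq> tuples (arity h) (points Y)" if "h \<in> pops E" for h
    using that b closedin_subset[of "tuple_space (arity h) (space Y)" "dom (pop Y h)"]
    unfolding boolean_struct_def by simp
  moreover have "rel Y \<rho> \<subseteq> tuples (arity \<rho>) (points Y)" if "\<rho> \<in> rels E" for \<rho>
    using that b closedin_subset[of "tuple_space (arity \<rho>) (space Y)" "rel Y \<rho>"]
    unfolding boolean_struct_def by simp
  ultimately show ?thesis unfolding wf_struct_def by blast
qed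

lemma mor_iff:
  assumes "wf_struct E Y" "wf_struct E Z"
  shows "\<phi> \<in> mor E Y Z \<longleftrightarrow>
    \<phi> \<in> points Y \<rightarrow>\<^sub>E points Z \<and> continuous_map (space Y) (space Z) \<phi> \<and>
    (\<forall>s\<in>syms E. \<forall>t\<in>interp Y s. compose {..<sym_arity s} \<phi> t \<in> interp Z s)"
proof (cases "\<phi> \<in> points Y \<rightarrow>\<^sub>E points Z")
  case True
  have *: "pop Z h (compose {..<arity h} \<phi> x) = Some (\<phi> y) \<longleftrightarrow>
      compose {..<Suc (arity h)} \<phi> (x(arity h := y)) \<in> interp Z (Inl h)"
    if "h \<in> pops E" "pop Y h x = Some y" for h x y
    unfolding compose_tuple_upd
    by (rule interp_pop_iff[OF assms(2) that(1), symmetric])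
       (rule compose_tuples[OF wf_struct_popD(1)[OF assms(1) that]], use True in blast)
  have "(\<forall>x y. pop Y h x = Some y \<longrightarrow> pop Z h (compose {..<arity h} \<phi> x) = Some (\<phi> y)) \<longleftrightarrow>
    (\<forall>t\<in>interp Y (Inl h). compose {..<Suc (arity h)} \<phi> t \<in> interp Z (Inl h))"
    if "h \<in> pops E" for h
    using *[OF that] unfolding interp.simps(1)[of Y] by blast
  then show ?thesis using True unfolding mor_def syms_def
    by (simp add: Plus_def ball_Un del: interp.simps(1))
next
  case False then show ?thesis by (simp add: mor_def)
qed

section \<open>Closed graphs\<close>

lemma continuous_map_restrict_tuple:
  assumes "m \<le> n"
  shows "continuous_map (tuple_space n T) (tuple_space m T) (\<lambda>t. restrict t {..<m})"
  unfolding continuous_map_componentwise using assms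
  by (auto intro: continuous_map_product_projection)

lemma continuous_map_compose_tuple:
  assumes "t \<in> {..<n} \<rightarrow> I"
  shows "continuous_map (product_topology (\<lambda>_. T) I) (tuple_space n T) (\<lambda>w. compose {..<n} w t)"
  unfolding continuous_map_componentwise compose_def using assms
  by (auto intro!: continuous_map_product_projection)

lemma compact_Hausdorff_tuple_space:
  assumes "compact_space T" "Hausdorff_space T"
  shows "compact_space (product_topology (\<lambda>_. T) I)" "Hausdorff_space (product_topology (\<lambda>_. T) I)"
  using assms by (auto simp: compact_space_product_topology Hausdorff_space_product_topology)

lemma closedin_image_compact_Hausdorff:
  assumes "compact_space T" "Hausdorff_space T'" "continuous_map T T' f" "closedin T C"
  shows "closedin T' (f ` C)"
  by (meson assms closedin_compact_space compactin_imp_closedin image_compactin)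

text \<open>On the closed set of tuples whose first \<open>n\<close> entries lie in
  \<open>D\<close>, both \<open>f\<close> of these entries and the last entry are continuous; in a
  Hausdorff space the set where they agree is closed.\<close>

lemma closed_graph:
  assumes "Hausdorff_space T" "closedin (tuple_space n T) D"
    "continuous_map (subtopology (tuple_space n T) D) T f"
  shows "closedin (tuple_space (Suc n) T) {x(n := f x) |x. x \<in> D}"
proof -
  let ?S = "tuple_space (Suc n) T" and ?r = "\<lambda>t. restrict t {..<n}"
  let ?D = "{t \<in> topspace ?S. ?r t \<in> D}"
  have cr: "continuous_map ?S (tuple_space n T) ?r"
    by (rule continuous_map_restrict_tuple) simp
  have D: "closedin ?S ?D"
    by (rule closedin_continuous_map_preimage[OF cr assms(2)])
  have Dn: "D \<subseteq> tuples n (topspace T)" using closedin_subset[OF assms(2)] by simp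
  have c1: "continuous_map (subtopology ?S ?D) T (f \<circ> ?r)"
  proof (rule continuous_map_compose[OF _ assms(3)])
    show "continuous_map (subtopology ?S ?D) (subtopology (tuple_space n T) D) ?r"
      using cr by (auto simp: continuous_map_in_subtopology intro: continuous_map_from_subtopology)
  qed
  have c2: "continuous_map (subtopology ?S ?D) T (\<lambda>t. t n)"
    by (intro continuous_map_from_subtopology continuous_map_product_projection) simp
  have "closedin (subtopology ?S ?D) {t \<in> topspace (subtopology ?S ?D). (f \<circ> ?r) t = t n}"
    by (rule closedin_continuous_maps_eq[OF assms(1) c1 c2])
  from closedin_trans_full[OF this D]
  have "closedin ?S {t \<in> topspace (subtopology ?S ?D). (f \<circ> ?r) t = t n}" .
  moreover have "{t \<in> topspace (subtopology ?S ?D). (f \<circ> ?r) t = t n} = {x(n := f x) |x. x \<in> D}"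
    (is "?L = ?R")
  proof (intro equalityI subsetI)
    fix t assume t: "t \<in> ?L"
    then have "t \<in> tuples (Suc n) (topspace T)" by simp
    then obtain x y where xy: "x \<in> tuples n (topspace T)" "t = x(n := y)" by (rule tuple_Suc_cases)
    with t show "t \<in> ?R" by (auto simp: restrict_tuple_upd simp del: restrict_fupd)
  next
    fix t assume "t \<in> ?R"
    then obtain x where x: "x \<in> D" "t = x(n := f x)" by blast
    then have xt: "x \<in> tuples n (topspace T)" using Dn by blast
    have "x \<in> topspace (subtopology (tuple_space n T) D)" using x xt by simp
    with assms(3) have "f x \<in> topspace T" by (auto simp: continuous_map_def Pi_iff)
    then show "t \<in> ?L" using x xt tuple_upd_in[OF xt, of "f x"]
      by (auto simp: restrict_tuple_upd simp del: restrict_fupd fun_upd_apply) simp_all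
  qed
  ultimately show ?thesis by simp
qed

text \<open>Compactness gives the converse: \<open>{x \<in> D. f x \<in> C}\<close> is the image,
  under dropping the last entry, of a closed and hence compact part of the graph. So a partial
  operation built from a closed graph has closed domain and is continuous.\<close>

lemma continuous_map_of_closed_graph:
  assumes "compact_space T" "Hausdorff_space T"
    and G: "closedin (tuple_space (Suc n) T) {x(n := f x) |x. x \<in> D}"
    and D: "D \<subseteq> tuples n (topspace T)"
  shows "closedin (tuple_space n T) D" "continuous_map (subtopology (tuple_space n T) D) T f"
proof -
  let ?S = "tuple_space (Suc n) T" and ?r = "\<lambda>t. restrict t {..<n}"
  let ?G = "{x(n := f x) |x. x \<in> D}"
  have cr: "continuous_map ?S (tuple_space n T) ?r"
    by (rule continuous_map_restrict_tuple) simp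
  have cn: "continuous_map ?S T (\<lambda>t. t n)"
    by (intro continuous_map_product_projection) simp
  have *: "closedin (tuple_space n T) {x \<in> D. f x \<in> C}" if C: "closedin T C" for C
  proof -
    have "closedin ?S (?G \<inter> {t \<in> topspace ?S. t n \<in> C})"
      by (intro closedin_Int G closedin_continuous_map_preimage[OF cn C])
    then have "closedin (tuple_space n T) (?r ` (?G \<inter> {t \<in> topspace ?S. t n \<in> C}))"
      using closedin_image_compact_Hausdorff cr compact_Hausdorff_tuple_space[OF assms(1,2)] by blast
    moreover have "?r ` (?G \<inter> {t \<in> topspace ?S. t n \<in> C}) = {x \<in> D. f x \<in> C}" (is "?L = ?R")
    proof (intro equalityI subsetI)
      fix t assume "t \<in> ?L"
      then show "t \<in> ?R" using D by (auto simp: restrict_tuple_upd simp del: restrict_fupd)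
    next
      fix x assume x: "x \<in> ?R"
      then have "x(n := f x) \<in> ?G" by blast
      moreover have "x(n := f x) \<in> topspace ?S"
        using closedin_subset[OF G] calculation by blast
      moreover have "x = ?r (x(n := f x))"
        using x D by (auto simp: restrict_tuple_upd simp del: restrict_fupd)
      ultimately show "x \<in> ?L" using x by (intro image_eqI[where x = "x(n := f x)"]) simp_all
    qed
    ultimately show ?thesis by simp
  qed
  have im: "f x \<in> topspace T" if "x \<in> D" for x
  proof -
    have "x(n := f x) \<in> topspace ?S" using closedin_subset[OF G] that by blast
    then show ?thesis by (force simp: PiE_iff dest: spec[of _ n])
  qed
  from *[OF closedin_topspace] im show cD: "closedin (tuple_space n T) D"
    by (metis (mono_tags, lifting) Collect_cong Collect_mem_eq)
  show "continuous_map (subtopology (tuple_space n T) D) T f"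
    unfolding continuous_map_closedin
  proof (intro conjI allI impI funcsetI)
    fix C assume "closedin T C"
    from *[OF this] have "closedin (subtopology (tuple_space n T) D) {x \<in> D. f x \<in> C}"
      using closedin_subset_topspace[of "tuple_space n T" "{x \<in> D. f x \<in> C}" D] by blast
    moreover have "{x \<in> topspace (subtopology (tuple_space n T) D). f x \<in> C} = {x \<in> D. f x \<in> C}"
      using D by auto
    ultimately show "closedin (subtopology (tuple_space n T) D)
        {x \<in> topspace (subtopology (tuple_space n T) D). f x \<in> C}" by simp
  qed (use im in auto)
qed

lemma closedin_interp:
  assumes "boolean_struct E Y" "s \<in> syms E"
  shows "closedin (tuple_space (sym_arity s) (space Y)) (interp Y s)"
proof (cases s)
  case (Inl h)
  then have h: "h \<in> pops E" using assms(2) by (auto simp: syms_def)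
  have "interp Y s = {x(arity h := the (pop Y h x)) |x. x \<in> dom (pop Y h)}"
    unfolding Inl by force
  moreover have "closedin (tuple_space (Suc (arity h)) (space Y)) \<dots>"
    using assms(1) h unfolding boolean_struct_def by (intro closed_graph) auto
  ultimately show ?thesis by (simp add: Inl)
next
  case (Inr \<rho>)
  then show ?thesis using assms by (auto simp: syms_def boolean_struct_def)
qed

section \<open>Both dual classes described internally, by maps into \<open>M\<close>\<close>

section \<open>Structures separated by their morphisms into the alter ego\<close>

lemma morD:
  assumes "\<phi> \<in> mor E Y Z"
  shows "\<phi> \<in> points Y \<rightarrow>\<^sub>E points Z" "\<phi> \<in> points Y \<rightarrow> points Z"
    "continuous_map (space Y) (space Z) \<phi>"
    "h \<in> pops E \<Longrightarrow> pop Y h x = Some y \<Longrightarrow> pop Z h (compose {..<arity h} \<phi> x) = Some (\<phi> y)"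
    "\<rho> \<in> rels E \<Longrightarrow> t \<in> rel Y \<rho> \<Longrightarrow> compose {..<arity \<rho>} \<phi> t \<in> rel Z \<rho>"
  using assms unfolding mor_def by blast+

lemma mor_interp:
  assumes "wf_struct E Y" "wf_struct E Z" "\<phi> \<in> mor E Y Z" "s \<in> syms E" "t \<in> interp Y s"
  shows "compose {..<sym_arity s} \<phi> t \<in> interp Z s"
  using assms mor_iff[OF assms(1,2)] by blast

lemma mor_egoD: "u \<in> mor E Y (ego_struct M) \<Longrightarrow> u \<in> points Y \<rightarrow>\<^sub>E carrier M"
  using morD(1)[of u E Y "ego_struct M"] by (simp add: ego_struct_def)

lemma wf_struct_ego:
  assumes "is_alter_ego \<Sigma> M E"
  shows "wf_struct E (ego_struct M)"
  unfolding wf_struct_def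
proof (intro conjI ballI)
  fix h assume "h \<in> pops E"
  then have h: "compatible_pop \<Sigma> M h" using assms by (simp add: is_alter_ego_def)
  then show "dom (pop (ego_struct M) h) \<subseteq> tuples (arity h) (points (ego_struct M))"
    by (simp add: compatible_pop_def ego_struct_def)
  show "ran (pop (ego_struct M) h) \<subseteq> points (ego_struct M)"
  proof
    fix b assume "b \<in> ran (pop (ego_struct M) h)"
    then obtain a where "snd h a = Some b" by (auto simp: ran_def ego_struct_def)
    then have "a(arity h := b) \<in> pop_graph h" by (auto simp: pop_graph_def)
    then have "a(arity h := b) \<in> tuples (Suc (arity h)) (carrier M)"
      using h unfolding compatible_pop_def compatible_rel_def subuniverse_def alg_power_def by auto
    from PiE_mem[OF this, of "arity h"] show "b \<in> points (ego_struct M)"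
      by (simp add: ego_struct_def)
  qed
next
  fix \<rho> assume "\<rho> \<in> rels E"
  then have "compatible_rel \<Sigma> M \<rho>" using assms by (simp add: is_alter_ego_def)
  then show "rel (ego_struct M) \<rho> \<subseteq> tuples (arity \<rho>) (points (ego_struct M))"
    by (simp add: compatible_rel_def subuniverse_def alg_power_def ego_struct_def)
qed

lemma compatible_sym_rel:
  assumes "is_alter_ego \<Sigma> M E" "s \<in> syms E"
  shows "compatible_rel \<Sigma> M (sym_rel s)"
proof (cases s)
  case (Inl h)
  then have "h \<in> pops E" using assms(2) unfolding syms_def by blast
  then show ?thesis using assms(1) by (simp add: Inl is_alter_ego_def compatible_pop_def)
next
  case (Inr \<rho>)
  then have "\<rho> \<in> rels E" using assms(2) unfolding syms_def by blast
  then show ?thesis using assms(1) by (simp add: Inr is_alter_ego_def)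
qed

lemma interp_ego: "interp (ego_struct M) s = snd (sym_rel s)"
  by (cases s) (auto simp: ego_struct_def pop_graph_def)

lemma points_ego [simp]: "points (ego_struct M) = carrier M"
  by (simp add: ego_struct_def)

lemma sym_rel_upd_iff:
  assumes "is_alter_ego \<Sigma> M E" "h \<in> pops E" "x \<in> tuples (arity h) A"
  shows "x(arity h := y) \<in> pop_graph h \<longleftrightarrow> snd h x = Some y"
  using interp_pop_iff[OF wf_struct_ego[OF assms(1)] assms(2,3)]
  unfolding interp_ego by (simp add: ego_struct_def)

lemma interp_power:
  assumes E: "is_alter_ego \<Sigma> M E" and s: "s \<in> syms E"
  shows "interp (struct_power (ego_struct M) S) s =
    {t \<in> tuples (sym_arity s) (S \<rightarrow>\<^sub>E carrier M).
       \<forall>\<sigma>\<in>S. compose {..<sym_arity s} (\<lambda>x. x \<sigma>) t \<in> snd (sym_rel s)}" (is "?L = ?R")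
proof (cases s)
  case (Inr \<rho>)
  then show ?thesis by (simp add: struct_power_def ego_struct_def compose_def)
next
  case (Inl h)
  let ?n = "arity h"
  have h: "h \<in> pops E" using s unfolding Inl syms_def by blast
  have "x(?n := y) \<in> ?R"
    if xy: "pop (struct_power (ego_struct M) S) h x = Some y" for x y
  proof -
    have x: "x \<in> tuples ?n (S \<rightarrow>\<^sub>E carrier M)" and xd: "\<forall>\<sigma>\<in>S. compose {..<?n} (\<lambda>x. x \<sigma>) x \<in> dom (snd h)"
      and y: "y = (\<lambda>\<sigma>\<in>S. the (snd h (compose {..<?n} (\<lambda>x. x \<sigma>) x)))"
      using xy by (simp_all add: struct_power_def ego_struct_def compose_def split: if_splits)
    have *: "snd h (compose {..<?n} (\<lambda>x. x \<sigma>) x) = Some (y \<sigma>)" if "\<sigma> \<in> S" for \<sigma>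
      using xd that unfolding y by fastforce
    then have g: "(compose {..<?n} (\<lambda>x. x \<sigma>) x)(?n := y \<sigma>) \<in> pop_graph h" if "\<sigma> \<in> S" for \<sigma>
      unfolding pop_graph_def using that by blast
    have "y \<in> S \<rightarrow>\<^sub>E carrier M"
    proof (rule PiE_I)
      fix \<sigma> assume \<sigma>: "\<sigma> \<in> S"
      then have "pop (ego_struct M) h (compose {..<?n} (\<lambda>x. x \<sigma>) x) = Some (y \<sigma>)"
        using * by (simp add: ego_struct_def)
      from wf_struct_popD(2)[OF wf_struct_ego[OF E] h this] show "y \<sigma> \<in> carrier M" by simp
    qed (simp add: y)
    from tuple_upd_in[OF x this] show ?thesis
      unfolding Inl using g by (simp only: sym_rel.simps fst_conv snd_conv mem_Collect_eq compose_tuple_upd) blast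
  qed
  moreover have "t \<in> ?L" if "t \<in> ?R" for t
  proof -
    have "t \<in> tuples (Suc ?n) (S \<rightarrow>\<^sub>E carrier M)" using that by (simp add: Inl)
    then obtain x y where x: "x \<in> tuples ?n (S \<rightarrow>\<^sub>E carrier M)" and y: "y \<in> S \<rightarrow>\<^sub>E carrier M"
      and t: "t = x(?n := y)" by (rule tuple_Suc_cases)
    have *: "snd h (compose {..<?n} (\<lambda>x. x \<sigma>) x) = Some (y \<sigma>)" if \<sigma>: "\<sigma> \<in> S" for \<sigma>
    proof (rule iffD1[OF sym_rel_upd_iff[OF E h]])
      show "compose {..<?n} (\<lambda>x. x \<sigma>) x \<in> tuples ?n (carrier M)"
        by (rule compose_tuples[OF x]) (use \<sigma> in auto)
      show "(compose {..<?n} (\<lambda>x. x \<sigma>) x)(?n := y \<sigma>) \<in> pop_graph h"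
        using \<open>t \<in> ?R\<close> \<sigma> unfolding Inl t by (simp add: compose_tuple_upd)
    qed
    have "y = (\<lambda>\<sigma>\<in>S. the (snd h (compose {..<?n} (\<lambda>x. x \<sigma>) x)))"
      by (rule extensionalityI[where A = S]) (use y * in \<open>simp_all add: PiE_def\<close>)
    then have "pop (struct_power (ego_struct M) S) h x = Some y"
      using x * by (auto simp: struct_power_def ego_struct_def compose_def)
    then show ?thesis unfolding t Inl interp.simps by blast
  qed
  ultimately show ?thesis unfolding Inl interp.simps by blast
qed

lemma space_power [simp]:
  "space (struct_power (ego_struct M) S) = product_topology (\<lambda>_. discrete_topology (carrier M)) S"
  by (simp add: struct_power_def ego_struct_def)

lemma wf_struct_power:
  assumes "is_alter_ego \<Sigma> M E"
  shows "wf_struct E (struct_power (ego_struct M) S)"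
proof -
  have "ran (pop (struct_power (ego_struct M) S) h) \<subseteq> S \<rightarrow>\<^sub>E carrier M" if h: "h \<in> pops E" for h
  proof
    fix y assume "y \<in> ran (pop (struct_power (ego_struct M) S) h)"
    then obtain x where "pop (struct_power (ego_struct M) S) h x = Some y" by (auto simp: ran_def)
    then have "x(arity h := y) \<in> interp (struct_power (ego_struct M) S) (Inl h)" by auto
    then have "x(arity h := y) \<in> tuples (Suc (arity h)) (S \<rightarrow>\<^sub>E carrier M)"
      using interp_power[OF assms, of "Inl h" S] h unfolding syms_def by auto
    from PiE_mem[OF this, of "arity h"] show "y \<in> S \<rightarrow>\<^sub>E carrier M" by simp
  qed
  moreover have "dom (pop (struct_power (ego_struct M) S) h) \<subseteq> tuples (arity h) (S \<rightarrow>\<^sub>E carrier M)" for h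
    unfolding dom_def by (rule subsetI, rule ccontr) (simp add: struct_power_def)
  moreover have "rel (struct_power (ego_struct M) S) \<rho> \<subseteq> tuples (arity \<rho>) (S \<rightarrow>\<^sub>E carrier M)" for \<rho>
    by (simp add: struct_power_def)
  ultimately show ?thesis unfolding wf_struct_def by simp
qed

lemma pop_induced:
  "pop (induced_on Y C) h x = Some y \<longleftrightarrow> x \<in> tuples (arity h) C \<and> pop Y h x = Some y"
  by (simp add: induced_on_def restrict_map_def)

text \<open>\<open>induced_on\<close> restricts a partial operation by its arguments only. Closure
  of \<open>C\<close> puts the value into \<open>C\<close> as well, so that graphs are restricted
  just like relations.\<close>

lemma interp_induced:
  assumes Y: "wf_struct E Y" and C: "closed_under_pops E Y C" and s: "s \<in> syms E"
  shows "interp (induced_on Y C) s = interp Y s \<inter> tuples (sym_arity s) C"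
proof (cases s)
  case (Inr \<rho>)
  then show ?thesis by (simp add: induced_on_def)
next
  case (Inl h)
  have h: "h \<in> pops E" using s unfolding Inl syms_def by blast
  have 1: "x(arity h := y) \<in> tuples (Suc (arity h)) C"
    if "x \<in> tuples (arity h) C" "pop Y h x = Some y" for x y
    using that C h unfolding closed_under_pops_def by (intro tuple_upd_in) blast+
  have 2: "x \<in> tuples (arity h) C"
    if xy: "x(arity h := y) \<in> tuples (Suc (arity h)) C" "pop Y h x = Some y" for x y
  proof -
    from xy(1) obtain x' y' where *: "x' \<in> tuples (arity h) C" "x(arity h := y) = x'(arity h := y')"
      by (rule tuple_Suc_cases)
    with tuple_upd_eq_iff[OF wf_struct_popD(1)[OF Y h xy(2)] *(1)] show ?thesis by metis
  qed
  show ?thesis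
  proof (intro set_eqI iffI)
    fix t assume "t \<in> interp (induced_on Y C) s"
    then obtain x y where "t = x(arity h := y)" "x \<in> tuples (arity h) C" "pop Y h x = Some y"
      unfolding Inl interp.simps pop_induced by blast
    with 1 show "t \<in> interp Y s \<inter> tuples (sym_arity s) C" unfolding Inl by auto
  next
    fix t assume t: "t \<in> interp Y s \<inter> tuples (sym_arity s) C"
    then obtain x y where xy: "t = x(arity h := y)" "pop Y h x = Some y"
      unfolding Inl interp.simps by blast
    have "x \<in> tuples (arity h) C" by (rule 2[of x y]) (use t xy in \<open>simp_all add: Inl\<close>)
    with xy show "t \<in> interp (induced_on Y C) s"
      unfolding Inl interp.simps mem_Collect_eq pop_induced by blast
  qed
qed

lemma space_induced [simp]: "space (induced_on Y C) = subtopology (space Y) C"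
  by (simp add: induced_on_def)

lemma points_induced: "C \<subseteq> points Y \<Longrightarrow> points (induced_on Y C) = C"
  by auto

lemma wf_struct_induced:
  assumes "wf_struct E Y" "closed_under_pops E Y C"
  shows "wf_struct E (induced_on Y C)"
proof -
  have C: "C \<subseteq> points Y" using assms(2) by (simp add: closed_under_pops_def)
  have "dom (pop (induced_on Y C) h) \<subseteq> tuples (arity h) C" for h
    by (simp add: induced_on_def)
  moreover have "ran (pop (induced_on Y C) h) \<subseteq> C" if "h \<in> pops E" for h
    using assms(2) that unfolding ran_def pop_induced closed_under_pops_def by blast
  moreover have "rel (induced_on Y C) \<rho> \<subseteq> tuples (arity \<rho>) C" for \<rho>
    by (simp add: induced_on_def)
  ultimately show ?thesis unfolding wf_struct_def points_induced[OF C] by blast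
qed

lemma mor_ego_iff:
  assumes "is_alter_ego \<Sigma> M E" "wf_struct E Y"
  shows "u \<in> mor E Y (ego_struct M) \<longleftrightarrow>
    u \<in> points Y \<rightarrow>\<^sub>E carrier M \<and> continuous_map (space Y) (discrete_topology (carrier M)) u \<and>
    (\<forall>s\<in>syms E. \<forall>t\<in>interp Y s. compose {..<sym_arity s} u t \<in> snd (sym_rel s))"
  unfolding mor_iff[OF assms(2) wf_struct_ego[OF assms(1)]] interp_ego
  by (simp add: ego_struct_def)

lemma mor_ego_interp:
  assumes "is_alter_ego \<Sigma> M E" "wf_struct E Y" "u \<in> mor E Y (ego_struct M)"
    and "s \<in> syms E" "t \<in> interp Y s"
  shows "compose {..<sym_arity s} u t \<in> snd (sym_rel s)"
  using mor_interp[OF assms(2) wf_struct_ego[OF assms(1)] assms(3-)] by (simp add: interp_ego)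

text \<open>Evaluation at the members of \<open>U\<close> embeds \<open>X\<close> as a substructure
  of a power of \<open>M\<close>: points are separated, domains and relations are reflected. The
  condition \<open>U \<noteq> {}\<close> mirrors the non-empty index sets of \<open>IScP\<close>; it
  matters for sentences with conclusion \<open>\<bottom>\<close>.\<close>

definition separated_by ::
    "('f, 'a) algebra \<Rightarrow> 'a alter_ego \<Rightarrow> ('a, 'x) tstruct \<Rightarrow> ('x \<Rightarrow> 'a) set \<Rightarrow> bool" where
  "separated_by M E X U \<longleftrightarrow>
     U \<noteq> {} \<and> U \<subseteq> mor E X (ego_struct M) \<and>
     (\<forall>x\<in>points X. \<forall>y\<in>points X. (\<forall>u\<in>U. u x = u y) \<longrightarrow> x = y) \<and>
     (\<forall>h\<in>pops E. \<forall>x\<in>tuples (arity h) (points X).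
        (\<forall>u\<in>U. compose {..<arity h} u x \<in> dom (snd h)) \<longrightarrow> x \<in> dom (pop X h)) \<and>
     (\<forall>\<rho>\<in>rels E. \<forall>x\<in>tuples (arity \<rho>) (points X).
        (\<forall>u\<in>U. compose {..<arity \<rho>} u x \<in> snd \<rho>) \<longrightarrow> x \<in> rel X \<rho>)"

definition separated :: "('f, 'a) algebra \<Rightarrow> 'a alter_ego \<Rightarrow> ('a, 'x) tstruct \<Rightarrow> bool" where
  "separated M E X \<longleftrightarrow> boolean_struct E X \<and> separated_by M E X (mor E X (ego_struct M))"

lemma separated_byD:
  assumes "separated_by M E X U"
  shows "U \<noteq> {}" and "u \<in> U \<Longrightarrow> u \<in> mor E X (ego_struct M)"
    and "x \<in> points X \<Longrightarrow> y \<in> points X \<Longrightarrow> (\<And>u. u \<in> U \<Longrightarrow> u x = u y) \<Longrightarrow> x = y"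
    and "h \<in> pops E \<Longrightarrow> t \<in> tuples (arity h) (points X) \<Longrightarrow>
      (\<And>u. u \<in> U \<Longrightarrow> compose {..<arity h} u t \<in> dom (snd h)) \<Longrightarrow> t \<in> dom (pop X h)"
    and "\<rho> \<in> rels E \<Longrightarrow> t \<in> tuples (arity \<rho>) (points X) \<Longrightarrow>
      (\<And>u. u \<in> U \<Longrightarrow> compose {..<arity \<rho>} u t \<in> snd \<rho>) \<Longrightarrow> t \<in> rel X \<rho>"
  using assms unfolding separated_by_def by (simp_all add: Ball_def subset_iff del: split_paired_All)

lemma separated_byI:
  assumes "U \<noteq> {}" and "\<And>u. u \<in> U \<Longrightarrow> u \<in> mor E X (ego_struct M)"
    and "\<And>x y. x \<in> points X \<Longrightarrow> y \<in> points X \<Longrightarrow> (\<And>u. u \<in> U \<Longrightarrow> u x = u y) \<Longrightarrow> x = y"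
    and "\<And>h t. h \<in> pops E \<Longrightarrow> t \<in> tuples (arity h) (points X) \<Longrightarrow>
      (\<And>u. u \<in> U \<Longrightarrow> compose {..<arity h} u t \<in> dom (snd h)) \<Longrightarrow> t \<in> dom (pop X h)"
    and "\<And>\<rho> t. \<rho> \<in> rels E \<Longrightarrow> t \<in> tuples (arity \<rho>) (points X) \<Longrightarrow>
      (\<And>u. u \<in> U \<Longrightarrow> compose {..<arity \<rho>} u t \<in> snd \<rho>) \<Longrightarrow> t \<in> rel X \<rho>"
  shows "separated_by M E X U"
  unfolding separated_by_def
  by (intro conjI ballI impI subsetI) (use assms in \<open>simp_all add: Ball_def del: split_paired_All\<close>)

lemma separatedI:
  assumes "boolean_struct E X" and U: "separated_by M E X U"
  shows "separated M E X"
  unfolding separated_def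
proof (intro conjI separated_byI)
  show "boolean_struct E X" by fact
  show "mor E X (ego_struct M) \<noteq> {}" using separated_byD(1,2)[OF U] by blast
qed (use separated_byD(2-)[OF U] in \<open>simp_all\<close>)

text \<open>For a relation this is part of the definition. For a graph, reflection of the domain
  yields some value of the operation, and separation of points identifies it with the last entry of
  \<open>t\<close>.\<close>

lemma separated_by_interp:
  assumes E: "is_alter_ego \<Sigma> M E" and X: "wf_struct E X" and U: "separated_by M E X U"
    and s: "s \<in> syms E" and t: "t \<in> tuples (sym_arity s) (points X)"
    and tu: "\<And>u. u \<in> U \<Longrightarrow> compose {..<sym_arity s} u t \<in> snd (sym_rel s)"
  shows "t \<in> interp X s"
proof (cases s)
  case (Inr \<rho>)
  then have "\<rho> \<in> rels E" using s unfolding syms_def by blast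
  from separated_byD(5)[OF U this] show ?thesis using t tu unfolding Inr interp.simps sym_rel.simps .
next
  case (Inl h)
  then have h: "h \<in> pops E" using s unfolding syms_def by blast
  have "t \<in> tuples (Suc (arity h)) (points X)" using t by (simp add: Inl)
  then obtain x y where x: "x \<in> tuples (arity h) (points X)" and y: "y \<in> points X"
    and t: "t = x(arity h := y)" by (rule tuple_Suc_cases)
  have uX: "u \<in> points X \<rightarrow> carrier M" if "u \<in> U" for u
    using mor_egoD[OF separated_byD(2)[OF U that]] by blast
  have *: "snd h (compose {..<arity h} u x) = Some (u y)" if u: "u \<in> U" for u
  proof (rule iffD1[OF sym_rel_upd_iff[OF E h compose_tuples[OF x uX[OF u]]]])
    show "(compose {..<arity h} u x)(arity h := u y) \<in> pop_graph h"
      using tu[OF u] unfolding t Inl by (simp add: compose_tuple_upd)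
  qed
  then have "x \<in> dom (pop X h)" by (intro separated_byD(4)[OF U h x]) blast
  then obtain y' where y': "pop X h x = Some y'" by blast
  have "u y = u y'" if u: "u \<in> U" for u
  proof -
    have "u \<in> mor E X (ego_struct M)" by (rule separated_byD(2)[OF U u])
    then have "snd h (compose {..<arity h} u x) = Some (u y')"
      using morD(4)[of u E X "ego_struct M", OF _ h y'] by (simp add: ego_struct_def)
    with *[OF u] show ?thesis by simp
  qed
  then have "y = y'" by (rule separated_byD(3)[OF U y wf_struct_popD(2)[OF X h y']])
  with y' show ?thesis unfolding Inl t interp.simps by blast
qed

text \<open>The coordinates of the embedding \<open>\<phi>\<close> form a separating set; the
  inverse morphism \<open>\<psi>\<close> carries domains and relations of the substructure back to
  \<open>X\<close>.\<close>

lemma IScP_imp_separated: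
  fixes X :: "('a, 'u) tstruct"
  assumes E: "is_alter_ego \<Sigma> M E" and X: "X \<in> IScP M E"
  shows "separated M E X"
proof -
  from X obtain S :: "('u \<Rightarrow> 'a) set" and C \<phi> where bX: "boolean_struct E X" and S: "S \<noteq> {}"
    and C: "closed_under_pops E (struct_power (ego_struct M) S) C"
    and iso: "struct_iso E \<phi> X (induced_on (struct_power (ego_struct M) S) C)"
    unfolding IScP_def by blast
  let ?P = "struct_power (ego_struct M) S"
  let ?I = "induced_on ?P C"
  let ?U = "(\<lambda>\<sigma>. \<lambda>x\<in>points X. \<phi> x \<sigma>) ` S"
  have wX: "wf_struct E X" by (rule boolean_struct_wf[OF bX])
  have wP: "wf_struct E ?P" by (rule wf_struct_power[OF E])
  have wI: "wf_struct E ?I" by (rule wf_struct_induced[OF wP C])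
  have CP: "C \<subseteq> S \<rightarrow>\<^sub>E carrier M" using C by (simp add: closed_under_pops_def)
  have pI: "points ?I = C" using CP by (intro points_induced) simp
  from iso obtain \<psi> where \<phi>: "\<phi> \<in> mor E X ?I" and \<psi>: "\<psi> \<in> mor E ?I X"
    and \<psi>\<phi>: "\<And>x. x \<in> points X \<Longrightarrow> \<psi> (\<phi> x) = x" unfolding struct_iso_def by blast
  have \<phi>C: "\<phi> \<in> points X \<rightarrow> C" using morD(2)[OF \<phi>] pI by simp
  have cmp: "compose {..<n} (\<lambda>x\<in>points X. \<phi> x \<sigma>) t = compose {..<n} (\<lambda>x. x \<sigma>) (compose {..<n} \<phi> t)"
    if "t \<in> tuples n (points X)" for n t \<sigma>
    unfolding compose_tuples_assoc by (rule compose_tuples_cong[OF that]) simp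
  have "separated_by M E X ?U"
  proof (rule separated_byI)
    show "?U \<noteq> {}" using S by simp
    show "u \<in> mor E X (ego_struct M)" if "u \<in> ?U" for u
    proof -
      from that
      obtain \<sigma> where \<sigma>: "\<sigma> \<in> S" and u: "u = (\<lambda>x\<in>points X. \<phi> x \<sigma>)" by blast
      have "u \<in> points X \<rightarrow>\<^sub>E carrier M" unfolding u using \<phi>C CP \<sigma> by fastforce
      moreover have "continuous_map (space X) (discrete_topology (carrier M)) u"
      proof -
        have "continuous_map (space X) (product_topology (\<lambda>_. discrete_topology (carrier M)) S) \<phi>"
          using morD(3)[OF \<phi>] by (simp add: continuous_map_in_subtopology)
        then have "continuous_map (space X) (discrete_topology (carrier M)) (\<lambda>x. \<phi> x \<sigma>)"
          using \<sigma> by (simp add: continuous_map_componentwise)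
        then show ?thesis unfolding u by (rule continuous_map_eq) simp
      qed
      moreover have "compose {..<sym_arity s} u t \<in> snd (sym_rel s)"
        if s: "s \<in> syms E" and t: "t \<in> interp X s" for s t
      proof -
        have "t \<in> tuples (sym_arity s) (points X)" using interp_subset_tuples[OF wX s] t by blast
        moreover have "compose {..<sym_arity s} \<phi> t \<in> interp ?P s"
          using mor_interp[OF wX wI \<phi> s t] unfolding interp_induced[OF wP C s] by blast
        ultimately show ?thesis using \<sigma> unfolding interp_power[OF E s] u by (simp add: cmp)
      qed
      ultimately show "u \<in> mor E X (ego_struct M)" unfolding mor_ego_iff[OF E wX] by blast
    qed
  next
    fix x y assume xy: "x \<in> points X" "y \<in> points X" and eq: "\<And>u. u \<in> ?U \<Longrightarrow> u x = u y"
    have "\<phi> x = \<phi> y"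
    proof (rule PiE_ext)
      show "\<phi> x \<in> S \<rightarrow>\<^sub>E carrier M" "\<phi> y \<in> S \<rightarrow>\<^sub>E carrier M" using \<phi>C CP xy by blast+
    next
      fix \<sigma> assume "\<sigma> \<in> S"
      with eq have "(\<lambda>x\<in>points X. \<phi> x \<sigma>) x = (\<lambda>x\<in>points X. \<phi> x \<sigma>) y" by blast
      with xy show "\<phi> x \<sigma> = \<phi> y \<sigma>" by simp
    qed
    then show "x = y" using \<psi>\<phi> xy by metis
  next
    fix h x assume h: "h \<in> pops E" and x: "x \<in> tuples (arity h) (points X)"
      and d: "\<And>u. u \<in> ?U \<Longrightarrow> compose {..<arity h} u x \<in> dom (snd h)"
    have \<phi>x: "compose {..<arity h} \<phi> x \<in> tuples (arity h) C" by (rule compose_tuples[OF x \<phi>C])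
    then have 1: "compose {..<arity h} \<phi> x \<in> tuples (arity h) (S \<rightarrow>\<^sub>E carrier M)"
      using CP by (rule tuples_subset_in)
    have 2: "compose {..<arity h} (\<lambda>x. x \<sigma>) (compose {..<arity h} \<phi> x) \<in> dom (snd h)" if "\<sigma> \<in> S" for \<sigma>
      using d[OF imageI[OF that]] unfolding cmp[OF x] .
    then obtain z where "pop ?P h (compose {..<arity h} \<phi> x) = Some z"
      using 1 by (simp add: struct_power_def ego_struct_def compose_def)
    with \<phi>x have "pop ?I h (compose {..<arity h} \<phi> x) = Some z" by (simp add: pop_induced)
    then have "pop X h (compose {..<arity h} \<psi> (compose {..<arity h} \<phi> x)) = Some (\<psi> z)"
      by (rule morD(4)[OF \<psi> h])
    moreover have "compose {..<arity h} \<psi> (compose {..<arity h} \<phi> x) = x"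
      unfolding compose_tuples_assoc by (rule compose_tuples_id[OF x]) (simp add: \<psi>\<phi>)
    ultimately show "x \<in> dom (pop X h)" by auto
  next
    fix \<rho> x assume \<rho>: "\<rho> \<in> rels E" and x: "x \<in> tuples (arity \<rho>) (points X)"
      and d: "\<And>u. u \<in> ?U \<Longrightarrow> compose {..<arity \<rho>} u x \<in> snd \<rho>"
    have \<phi>x: "compose {..<arity \<rho>} \<phi> x \<in> tuples (arity \<rho>) C" by (rule compose_tuples[OF x \<phi>C])
    then have 1: "compose {..<arity \<rho>} \<phi> x \<in> tuples (arity \<rho>) (S \<rightarrow>\<^sub>E carrier M)"
      using CP by (rule tuples_subset_in)
    have 2: "compose {..<arity \<rho>} (\<lambda>x. x \<sigma>) (compose {..<arity \<rho>} \<phi> x) \<in> snd \<rho>" if "\<sigma> \<in> S" for \<sigma>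
      using d[OF imageI[OF that]] unfolding cmp[OF x] .
    then have "compose {..<arity \<rho>} \<phi> x \<in> rel ?P \<rho>"
      using 1 by (simp add: struct_power_def ego_struct_def compose_def)
    with \<phi>x have "compose {..<arity \<rho>} \<phi> x \<in> rel ?I \<rho>" by (simp add: induced_on_def)
    then have "compose {..<arity \<rho>} \<psi> (compose {..<arity \<rho>} \<phi> x) \<in> rel X \<rho>"
      by (rule morD(5)[OF \<psi> \<rho>])
    moreover have "compose {..<arity \<rho>} \<psi> (compose {..<arity \<rho>} \<phi> x) = x"
      unfolding compose_tuples_assoc by (rule compose_tuples_id[OF x]) (simp add: \<psi>\<phi>)
    ultimately show "x \<in> rel X \<rho>" by simp
  qed
  with bX show ?thesis by (rule separatedI)
qed

text \<open>\<open>\<phi>\<close> maps a compact space continuously into a Hausdorff one, so it is a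
  closed map; this gives both the closed image and the continuous inverse. The image is closed under
  the partial operations because a tuple with defined value in the power lifts to a tuple in the
  domain on \<open>X\<close>.\<close>

lemma separated_eval_struct:
  assumes E: "is_alter_ego \<Sigma> M E" and sX: "separated M E X"
  defines "U \<equiv> mor E X (ego_struct M)" and "\<phi> \<equiv> eval_struct M E X"
  shows "closedin (space (struct_power (ego_struct M) U)) (\<phi> ` points X)"
    and "closed_under_pops E (struct_power (ego_struct M) U) (\<phi> ` points X)"
    and "struct_iso E \<phi> X (induced_on (struct_power (ego_struct M) U) (\<phi> ` points X))"
proof -
  let ?P = "struct_power (ego_struct M) U" and ?C = "\<phi> ` points X"
  let ?I = "induced_on ?P ?C"
  have bX: "boolean_struct E X" and U: "separated_by M E X U"
    using sX by (simp_all add: separated_def U_def)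
  have wX: "wf_struct E X" by (rule boolean_struct_wf[OF bX])
  have wP: "wf_struct E ?P" by (rule wf_struct_power[OF E])
  have \<phi>_app: "\<phi> x u = u x" if "x \<in> points X" "u \<in> U" for x u
    using that by (simp add: \<phi>_def eval_struct_def U_def)
  have uX: "u \<in> points X \<rightarrow>\<^sub>E carrier M" if "u \<in> U" for u
    using that unfolding U_def by (rule mor_egoD)
  have \<phi>P: "\<phi> \<in> points X \<rightarrow>\<^sub>E (U \<rightarrow>\<^sub>E carrier M)"
    unfolding \<phi>_def eval_struct_def U_def[symmetric]
    by (rule restrict_PiE_iff[THEN iffD2], intro ballI, rule restrict_PiE_iff[THEN iffD2])
       (use uX in blast)
  have cont: "continuous_map (space X) (space ?P) \<phi>"
    unfolding space_power continuous_map_componentwise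
  proof (intro conjI ballI)
    show "\<phi> ` points X \<subseteq> extensional U" using \<phi>P by (auto simp: PiE_def)
    fix u assume u: "u \<in> U"
    then have "continuous_map (space X) (discrete_topology (carrier M)) u"
      using mor_ego_iff[OF E wX] U_def by blast
    then show "continuous_map (space X) (discrete_topology (carrier M)) (\<lambda>x. \<phi> x u)"
      by (rule continuous_map_eq) (simp add: \<phi>_app u)
  qed
  have cX: "compact_space (space X)" using bX by (simp add: boolean_struct_def)
  have hP: "Hausdorff_space (space ?P)" by (simp add: Hausdorff_space_product_topology)
  have closed_image: "closedin (space ?P) (\<phi> ` K)" if "closedin (space X) K" for K
    by (rule closedin_image_compact_Hausdorff[OF cX hP cont that])
  show clC: "closedin (space ?P) ?C" by (rule closed_image) simp
  have cmp: "compose {..<n} (\<lambda>x. x u) (compose {..<n} \<phi> t) = compose {..<n} u t"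
    if "t \<in> tuples n (points X)" "u \<in> U" for n t u
    unfolding compose_tuples_assoc by (rule compose_tuples_cong[OF that(1)]) (simp add: \<phi>_app that)
  have \<phi>_interp: "compose {..<sym_arity s} \<phi> t \<in> interp ?P s" if s: "s \<in> syms E" and t: "t \<in> interp X s" for s t
  proof -
    have tX: "t \<in> tuples (sym_arity s) (points X)" using interp_subset_tuples[OF wX s] t by blast
    have "compose {..<sym_arity s} u t \<in> snd (sym_rel s)" if "u \<in> U" for u
      using that unfolding U_def by (rule mor_ego_interp[OF E wX _ s t])
    moreover have "compose {..<sym_arity s} \<phi> t \<in> tuples (sym_arity s) (U \<rightarrow>\<^sub>E carrier M)"
      by (rule compose_tuples[OF tX]) (use \<phi>P in blast)
    ultimately show ?thesis unfolding interp_power[OF E s] by (simp add: cmp[OF tX])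
  qed
  have \<phi>_mor: "\<phi> \<in> mor E X ?P"
    unfolding mor_iff[OF wX wP] using \<phi>P cont \<phi>_interp by simp
  have inj: "inj_on \<phi> (points X)"
  proof (rule inj_onI)
    fix x y assume xy: "x \<in> points X" "y \<in> points X" "\<phi> x = \<phi> y"
    show "x = y" by (rule separated_byD(3)[OF U xy(1,2)]) (metis \<phi>_app xy)
  qed
  let ?\<psi> = "\<lambda>z\<in>?C. inv_into (points X) \<phi> z"
  have \<psi>\<phi>: "?\<psi> (\<phi> x) = x" if "x \<in> points X" for x using that inj by simp
  have \<phi>\<psi>: "\<phi> (?\<psi> z) = z" if "z \<in> ?C" for z using that by (simp add: f_inv_into_f)
  have \<psi>X: "?\<psi> \<in> ?C \<rightarrow>\<^sub>E points X"
    by (rule restrict_PiE_iff[THEN iffD2], intro ballI, rule inv_into_into)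
  have lift: "compose {..<n} ?\<psi> t \<in> tuples n (points X)"
      "compose {..<n} \<phi> (compose {..<n} ?\<psi> t) = t" if t: "t \<in> tuples n ?C" for n t
  proof -
    show "compose {..<n} ?\<psi> t \<in> tuples n (points X)" using \<psi>X by (intro compose_tuples[OF t]) (simp only: PiE_def Int_iff)
    show "compose {..<n} \<phi> (compose {..<n} ?\<psi> t) = t"
      unfolding compose_tuples_assoc by (rule compose_tuples_id[OF t]) (use \<phi>\<psi> in simp)
  qed
  show cuC: "closed_under_pops E ?P ?C"
    unfolding closed_under_pops_def
  proof (intro conjI ballI allI impI)
    show "?C \<subseteq> points ?P" using closedin_subset[OF clC] by simp
    fix h x y assume h: "h \<in> pops E" and x: "x \<in> tuples (arity h) ?C" and y: "pop ?P h x = Some y"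
    let ?x = "compose {..<arity h} ?\<psi> x"
    have "compose {..<arity h} u ?x \<in> dom (snd h)" if u: "u \<in> U" for u
    proof -
      have "compose {..<arity h} u ?x = compose {..<arity h} (\<lambda>x. x u) x"
        using cmp[OF lift(1)[OF x] u] lift(2)[OF x] by simp
      then show ?thesis using y u
        by (simp add: struct_power_def ego_struct_def compose_def split: if_splits)
    qed
    then have "?x \<in> dom (pop X h)" by (rule separated_byD(4)[OF U h lift(1)[OF x]])
    then obtain y' where y': "pop X h ?x = Some y'" by blast
    then have "pop ?P h (compose {..<arity h} \<phi> ?x) = Some (\<phi> y')"
      by (rule morD(4)[OF \<phi>_mor h])
    then have "y = \<phi> y'" using y lift(2)[OF x] by simp
    then show "y \<in> ?C" using wf_struct_popD(2)[OF wX h y'] by blast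
  qed
  have wI: "wf_struct E ?I" by (rule wf_struct_induced[OF wP cuC])
  have pI: "points ?I = ?C" using closedin_subset[OF clC] by (intro points_induced)
  show "struct_iso E \<phi> X ?I"
    unfolding struct_iso_def
  proof (intro conjI bexI ballI)
    show "\<phi> \<in> mor E X ?I"
      unfolding mor_iff[OF wX wI] pI
    proof (intro conjI ballI)
      show "\<phi> \<in> points X \<rightarrow>\<^sub>E ?C" using \<phi>P by (auto simp: PiE_def)
      show "continuous_map (space X) (space ?I) \<phi>"
        using cont by (simp add: continuous_map_in_subtopology)
      fix s t assume s: "s \<in> syms E" and t: "t \<in> interp X s"
      have "compose {..<sym_arity s} \<phi> t \<in> tuples (sym_arity s) ?C"
        by (rule compose_tuples[OF subsetD[OF interp_subset_tuples[OF wX s] t]]) simp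
      then show "compose {..<sym_arity s} \<phi> t \<in> interp ?I s"
        using \<phi>_interp[OF s t] unfolding interp_induced[OF wP cuC s] by blast
    qed
    show "?\<psi> \<in> mor E ?I X"
      unfolding mor_iff[OF wI wX] pI
    proof (intro conjI ballI)
      show "?\<psi> \<in> ?C \<rightarrow>\<^sub>E points X" by (rule \<psi>X)
      show "continuous_map (space ?I) (space X) ?\<psi>"
        unfolding continuous_map_closedin pI
      proof (intro conjI allI impI)
        show "?\<psi> \<in> ?C \<rightarrow> points X" using \<psi>X by (simp only: PiE_def Int_iff)
        fix K assume K: "closedin (space X) K"
        have "{z \<in> ?C. ?\<psi> z \<in> K} = \<phi> ` K"
        proof (intro set_eqI iffI)
          fix z assume "z \<in> \<phi> ` K"
          then obtain x where x: "x \<in> K" "x \<in> points X" "z = \<phi> x" using closedin_subset[OF K] by blast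
          then show "z \<in> {z \<in> ?C. ?\<psi> z \<in> K}" using \<psi>\<phi>[OF x(2)] by simp
        next
          fix z assume "z \<in> {z \<in> ?C. ?\<psi> z \<in> K}"
          then have z: "z \<in> ?C" "?\<psi> z \<in> K" by blast+
          show "z \<in> \<phi> ` K" using imageI[OF z(2), of \<phi>] unfolding \<phi>\<psi>[OF z(1)] .
        qed
        then show "closedin (space ?I) {z \<in> ?C. ?\<psi> z \<in> K}"
          using closed_image[OF K] closedin_subset[OF K]
          by (simp add: closedin_subset_topspace image_mono)
      qed
      fix s t assume s: "s \<in> syms E" and "t \<in> interp ?I s"
      then have tP: "t \<in> interp ?P s" and tC: "t \<in> tuples (sym_arity s) ?C"
        unfolding interp_induced[OF wP cuC s] by blast+
      show "compose {..<sym_arity s} ?\<psi> t \<in> interp X s"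
      proof (rule separated_by_interp[OF E wX U s lift(1)[OF tC]])
        fix u assume u: "u \<in> U"
        have "compose {..<sym_arity s} u (compose {..<sym_arity s} ?\<psi> t) = compose {..<sym_arity s} (\<lambda>x. x u) t"
          using cmp[OF lift(1)[OF tC] u] lift(2)[OF tC] by simp
        then show "compose {..<sym_arity s} u (compose {..<sym_arity s} ?\<psi> t) \<in> snd (sym_rel s)"
          using tP u unfolding interp_power[OF E s] by simp
      qed
    qed
    show "?\<psi> (\<phi> x) = x" if "x \<in> points X" for x using that by (rule \<psi>\<phi>)
    show "\<phi> (?\<psi> z) = z" if "z \<in> points ?I" for z using that unfolding pI by (rule \<phi>\<psi>)
  qed
qed

text \<open>The set of all morphisms into \<open>ego_struct M\<close> has the very type that
  \<open>IScP\<close> prescribes for index sets, so evaluation is an admissible witness for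
  membership.\<close>

lemma IScP_iff_separated:
  assumes "is_alter_ego \<Sigma> M E"
  shows "X \<in> IScP M E \<longleftrightarrow> separated M E X"
proof
  assume X: "separated M E X"
  then have "boolean_struct E X" "mor E X (ego_struct M) \<noteq> {}"
    by (simp_all add: separated_def separated_by_def)
  with separated_eval_struct[OF assms X] show "X \<in> IScP M E" unfolding IScP_def by blast
qed (rule IScP_imp_separated[OF assms])

section \<open>Evaluation maps\<close>

lemma product_topology_discrete:
  assumes "finite I"
  shows "product_topology (\<lambda>_. discrete_topology A) I = discrete_topology (I \<rightarrow>\<^sub>E A)"
proof (rule sym, subst discrete_topology_unique, intro conjI ballI)
  fix t assume t: "t \<in> I \<rightarrow>\<^sub>E A"
  have "{t} = (\<Pi>\<^sub>E i\<in>I. {t i})" using t by (auto simp: PiE_iff extensional_def fun_eq_iff) metis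
  moreover have "openin (product_topology (\<lambda>_. discrete_topology A) I) (\<Pi>\<^sub>E i\<in>I. {t i})"
    using assms t by (subst openin_PiE) (auto simp: PiE_iff)
  ultimately show "openin (product_topology (\<lambda>_. discrete_topology A) I) {t}" by simp
qed simp

text \<open>Each symbol denotes a subalgebra of a finite power of \<open>M\<close>, so applying
  \<open>opr M f\<close> to morphisms pointwise preserves it. Continuity holds because a finite
  power of a discrete space is discrete, which makes every operation continuous.\<close>

lemma mor_opr_closed:
  assumes M: "is_algebra \<Sigma> M" and E: "is_alter_ego \<Sigma> M E" and X: "wf_struct E X"
    and f: "f \<in> \<Sigma>" and us: "us \<in> tuples (arity f) (mor E X (ego_struct M))"
  shows "(\<lambda>x\<in>points X. opr M f (\<lambda>i\<in>{..<arity f}. us i x)) \<in> mor E X (ego_struct M)"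
    (is "?w \<in> _")
  unfolding mor_ego_iff[OF E X]
proof (intro conjI ballI)
  have u: "us i \<in> mor E X (ego_struct M)" if "i < arity f" for i
    using PiE_mem[OF us] that by simp
  have uM: "us i x \<in> carrier M" if "i < arity f" "x \<in> points X" for i x
    using PiE_mem[OF mor_egoD[OF u[OF that(1)]] that(2)] .
  have cl: "opr M f t \<in> carrier M" if "t \<in> tuples (arity f) (carrier M)" for t
    using M f that unfolding is_algebra_def by blast
  have tM: "(\<lambda>i\<in>{..<arity f}. us i x) \<in> tuples (arity f) (carrier M)" if "x \<in> points X" for x
    using uM that by (simp add: restrict_PiE_iff)
  show "?w \<in> points X \<rightarrow>\<^sub>E carrier M"
    using cl[OF tM] by (simp add: restrict_PiE_iff)
  show "continuous_map (space X) (discrete_topology (carrier M)) ?w"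
  proof -
    have "continuous_map (space X) (tuple_space (arity f) (discrete_topology (carrier M)))
        (\<lambda>x. \<lambda>i\<in>{..<arity f}. us i x)"
      unfolding continuous_map_componentwise
    proof (intro conjI ballI)
      fix i assume i: "i \<in> {..<arity f}"
      have "continuous_map (space X) (discrete_topology (carrier M)) (us i)"
        using u[of i] i mor_ego_iff[OF E X] by blast
      then show "continuous_map (space X) (discrete_topology (carrier M)) (\<lambda>x. (\<lambda>i\<in>{..<arity f}. us i x) i)"
        by (rule continuous_map_eq) (use i in simp)
    qed (simp add: image_subset_iff)
    then have "continuous_map (space X) (discrete_topology (tuples (arity f) (carrier M)))
        (\<lambda>x. \<lambda>i\<in>{..<arity f}. us i x)" by (simp add: product_topology_discrete)
    then have "continuous_map (space X) (discrete_topology (carrier M))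
        (opr M f \<circ> (\<lambda>x. \<lambda>i\<in>{..<arity f}. us i x))"
      by (rule continuous_map_compose) (use cl in \<open>simp add: Pi_iff\<close>)
    then show ?thesis by (rule continuous_map_eq) simp
  qed
  fix s t assume s: "s \<in> syms E" and t: "t \<in> interp X s"
  let ?m = "sym_arity s" and ?ts = "\<lambda>i\<in>{..<arity f}. compose {..<sym_arity s} (us i) t"
  have tX: "t \<in> tuples ?m (points X)" using interp_subset_tuples[OF X s] t by blast
  have "?ts \<in> tuples (arity f) (snd (sym_rel s))"
    using mor_ego_interp[OF E X u s t] by (simp add: restrict_PiE_iff)
  then have "opr (alg_power M {..<?m}) f ?ts \<in> snd (sym_rel s)"
    using compatible_sym_rel[OF E s] f unfolding compatible_rel_def subuniverse_def by blast
  moreover have "opr (alg_power M {..<?m}) f ?ts = compose {..<?m} ?w t"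
  proof
    fix j
    show "opr (alg_power M {..<?m}) f ?ts j = compose {..<?m} ?w t j"
    proof (cases "j < ?m")
      case True
      then have "(\<lambda>i\<in>{..<arity f}. ?ts i j) = (\<lambda>i\<in>{..<arity f}. us i (t j))"
        by (auto simp: compose_def)
      then show ?thesis using True PiE_mem[OF tX, of j] by (simp add: alg_power_def compose_def)
    qed (simp add: alg_power_def compose_def)
  qed
  ultimately show "compose {..<?m} ?w t \<in> snd (sym_rel s)" by simp
qed

lemma carrier_dual_E [simp]: "carrier (dual_E M E X) = mor E X (ego_struct M)"
  by (simp add: dual_E_def subalgebra_on_def)

lemma opr_dual_E:
  "opr (dual_E M E X) f us = (\<lambda>x\<in>points X. opr M f (\<lambda>i\<in>{..<arity f}. us i x))"
  by (simp add: dual_E_def subalgebra_on_def alg_power_def)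

text \<open>Surjectivity of \<open>eval_struct\<close> onto D(E(X)), in a form that involves the
  alter ego only through the set of morphisms and can therefore be moved from one alter ego to
  another.\<close>

definition represented ::
    "'f sig \<Rightarrow> ('f, 'a) algebra \<Rightarrow> 'a alter_ego \<Rightarrow> ('a, 'x) tstruct \<Rightarrow> bool" where
  "represented \<Sigma> M E X \<longleftrightarrow>
     (\<forall>z\<in>alg_hom \<Sigma> (dual_E M E X) M. \<exists>x\<in>points X. \<forall>u\<in>mor E X (ego_struct M). z u = u x)"

lemma eval_struct_hom:
  assumes M: "is_algebra \<Sigma> M" and E: "is_alter_ego \<Sigma> M E" and X: "wf_struct E X"
    and x: "x \<in> points X"
  shows "eval_struct M E X x \<in> alg_hom \<Sigma> (dual_E M E X) M"
  unfolding alg_hom_def mem_Collect_eq carrier_dual_E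
proof (intro conjI ballI)
  let ?U = "mor E X (ego_struct M)"
  have ev: "eval_struct M E X x = (\<lambda>u\<in>?U. u x)" using x by (simp add: eval_struct_def)
  show "eval_struct M E X x \<in> ?U \<rightarrow>\<^sub>E carrier M"
    unfolding ev using x by (simp add: restrict_PiE_iff PiE_mem[OF mor_egoD])
  fix f us assume f: "f \<in> \<Sigma>" and us: "us \<in> tuples (arity f) ?U"
  have "compose {..<arity f} (eval_struct M E X x) us = (\<lambda>i\<in>{..<arity f}. us i x)"
    unfolding ev compose_def using PiE_mem[OF us] by (auto simp: fun_eq_iff)
  then show "eval_struct M E X x (opr (dual_E M E X) f us) =
      opr M f (compose {..<arity f} (eval_struct M E X x) us)"
    unfolding opr_dual_E using mor_opr_closed[OF M E X f us] x unfolding ev by simp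
qed

text \<open>Separation already makes evaluation an isomorphism onto its image in the power;
  representation says that this image consists of all homomorphisms from E(X) to \<open>M\<close>,
  the points of D(E(X)).\<close>

lemma represented_imp_iso:
  assumes M: "is_algebra \<Sigma> M" and E: "is_alter_ego \<Sigma> M E" and sX: "separated M E X"
    and rX: "represented \<Sigma> M E X"
  shows "struct_iso E (eval_struct M E X) X (dual_D \<Sigma> M (dual_E M E X))"
proof -
  have X: "wf_struct E X" using sX boolean_struct_wf unfolding separated_def by blast
  have "alg_hom \<Sigma> (dual_E M E X) M = eval_struct M E X ` points X"
  proof (intro set_eqI iffI)
    fix z assume z: "z \<in> alg_hom \<Sigma> (dual_E M E X) M"
    then obtain x where x: "x \<in> points X" and zx: "\<forall>u\<in>mor E X (ego_struct M). z u = u x"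
      using rX unfolding represented_def by blast
    have "z \<in> extensional (mor E X (ego_struct M))" using z by (simp add: alg_hom_def PiE_def)
    then have "z = eval_struct M E X x"
      by (rule extensionalityI) (use x zx in \<open>simp_all add: eval_struct_def\<close>)
    with x show "z \<in> eval_struct M E X ` points X" by blast
  next
    fix z assume "z \<in> eval_struct M E X ` points X"
    then show "z \<in> alg_hom \<Sigma> (dual_E M E X) M" using eval_struct_hom[OF M E X] by blast
  qed
  then show ?thesis using separated_eval_struct(3)[OF E sX] by (simp add: dual_D_def)
qed

lemma iso_imp_represented:
  assumes "struct_iso E (eval_struct M E X) X (dual_D \<Sigma> M (dual_E M E X))"
  shows "represented \<Sigma> M E X"
  unfolding represented_def
proof
  let ?D = "dual_D \<Sigma> M (dual_E M E X)"
  fix z assume z: "z \<in> alg_hom \<Sigma> (dual_E M E X) M"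
  have pD: "z \<in> points ?D"
    using z by (simp add: dual_D_def alg_hom_def)
  from assms obtain \<psi> where \<psi>: "\<psi> \<in> mor E ?D X" and inv: "eval_struct M E X (\<psi> z) = z"
    using pD unfolding struct_iso_def by blast
  have x: "\<psi> z \<in> points X" by (rule PiE_mem[OF morD(1)[OF \<psi>] pD])
  have "z u = u (\<psi> z)" if "u \<in> mor E X (ego_struct M)" for u
    using fun_cong[OF inv, of u] x that by (simp add: eval_struct_def)
  with x show "\<exists>x\<in>points X. \<forall>u\<in>mor E X (ego_struct M). z u = u x" by blast
qed

section \<open>Soundness of the universal Horn theory and local finiteness of its Boolean
  models\<close>

section \<open>Universal Horn sentences\<close>

lemma those_map_eq_Some_iff:
  "those (map f ts) = Some xs \<longleftrightarrow> list_all2 (\<lambda>t x. f t = Some x) ts xs"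
proof (induction ts arbitrary: xs)
  case (Cons t ts)
  then show ?case by (cases xs) (auto split: option.splits)
qed auto

lemma those_map_Some:
  "(\<And>t. t \<in> set ts \<Longrightarrow> f t = Some (g t)) \<Longrightarrow> those (map f ts) = Some (map g ts)"
  by (induction ts) auto

lemma term_val_in:
  assumes X: "wf_struct E X" and v: "v \<in> tuples k (points X)"
    and t: "wf_trm E k t" "term_val X v t = Some y"
  shows "y \<in> points X"
proof (cases t)
  case (Var i)
  then show ?thesis using t PiE_mem[OF v, of i] by simp
next
  case (App h ts)
  then have h: "h \<in> pops E" using t(1) by simp
  from t(2) obtain xs where "pop X h (tuple_of xs) = Some y"
    unfolding App term_val.simps by (auto simp: bind_eq_Some_conv)
  with X h show ?thesis by (rule wf_struct_popD(2))
qed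

lemma term_val_mor:
  assumes u: "u \<in> mor E X Z" and v': "\<And>i. i < k \<Longrightarrow> v' i = u (v i)"
  shows "wf_trm E k t \<Longrightarrow> term_val X v t = Some y \<Longrightarrow> term_val Z v' t = Some (u y)"
proof (induction t arbitrary: y)
  case (Var i)
  then show ?case by (simp add: v')
next
  case (App h ts)
  then have h: "h \<in> pops E" and len: "length ts = arity h" and wf: "\<And>t. t \<in> set ts \<Longrightarrow> wf_trm E k t"
    by (simp_all add: list_all_iff)
  from App.prems(2) obtain xs where xs: "those (map (term_val X v) ts) = Some xs"
    and y: "pop X h (tuple_of xs) = Some y" by (auto simp: bind_eq_Some_conv)
  have all: "list_all2 (\<lambda>t x. term_val X v t = Some x) ts xs" using xs by (simp add: those_map_eq_Some_iff)
  then have "list_all2 (\<lambda>t x. term_val Z v' t = Some (u x)) ts xs"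
    using App.IH wf unfolding list_all2_conv_all_nth by (metis nth_mem)
  then have "those (map (term_val Z v') ts) = Some (map u xs)"
    by (simp add: those_map_eq_Some_iff list_all2_map2)
  moreover have "tuple_of (map u xs) = compose {..<arity h} u (tuple_of xs)"
    using list_all2_lengthD[OF all] len by (simp add: tuple_of_map)
  ultimately show ?case using morD(4)[OF u h y] by simp
qed

lemma those_mor:
  assumes u: "u \<in> mor E X Z" and v': "\<And>i. i < k \<Longrightarrow> v' i = u (v i)"
    and wf: "list_all (wf_trm E k) ts" and xs: "those (map (term_val X v) ts) = Some xs"
  shows "those (map (term_val Z v') ts) = Some (map u xs)"
proof -
  from xs have "list_all2 (\<lambda>t x. term_val X v t = Some x) ts xs" by (simp add: those_map_eq_Some_iff)
  with wf have "list_all2 (\<lambda>t x. term_val Z v' t = Some (u x)) ts xs"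
    by (simp add: list_all2_conv_all_nth list_all_length term_val_mor[OF u v'])
  then show ?thesis by (simp add: those_map_eq_Some_iff list_all2_map2)
qed

lemma those_length: "those (map f ts) = Some xs \<Longrightarrow> length xs = length ts"
  using list_all2_lengthD by (fastforce simp: those_map_eq_Some_iff)

lemma atom_true_mor:
  assumes u: "u \<in> mor E X Z" and v': "\<And>i. i < k \<Longrightarrow> v' i = u (v i)"
    and wf: "wf_atom E k \<alpha>" and tr: "atom_true X v \<alpha>"
  shows "atom_true Z v' \<alpha>"
proof (cases \<alpha>)
  case (Eq s t)
  then show ?thesis using wf tr term_val_mor[OF u v'] by fastforce
next
  case (Rel \<rho> ts)
  from tr obtain xs where xs: "those (map (term_val X v) ts) = Some xs" "tuple_of xs \<in> rel X \<rho>"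
    unfolding Rel by auto
  have wf': "\<rho> \<in> rels E" "length ts = arity \<rho>" "list_all (wf_trm E k) ts" using wf unfolding Rel by simp_all
  have "tuple_of (map u xs) = compose {..<arity \<rho>} u (tuple_of xs)"
    using those_length[OF xs(1)] wf'(2) by (simp add: tuple_of_map)
  with morD(5)[OF u wf'(1) xs(2)] those_mor[OF u v' wf'(3) xs(1)] show ?thesis
    unfolding Rel by simp
qed

text \<open>The step shared by application terms and relational atoms: once the arguments are
  defined, their values form a tuple of points, and each \<open>u\<close> sends it to the tuple of
  values computed in \<open>M\<close>.\<close>

lemma those_separated:
  assumes X: "wf_struct E X" and U: "separated_by M E X U" and v: "v \<in> tuples k (points X)"
    and wf: "list_all (wf_trm E k) ts"
    and val: "\<And>t. t \<in> set ts \<Longrightarrow> \<exists>y. term_val X v t = Some y"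
  obtains xs where "those (map (term_val X v) ts) = Some xs"
    and "tuple_of xs \<in> tuples (length ts) (points X)"
    and "\<And>u. u \<in> U \<Longrightarrow>
      those (map (term_val (ego_struct M) (compose {..<k} u v)) ts) = Some (map u xs)"
    and "\<And>u. u \<in> U \<Longrightarrow> tuple_of (map u xs) = compose {..<length ts} u (tuple_of xs)"
proof -
  let ?xs = "map (\<lambda>t. the (term_val X v t)) ts"
  have xs: "those (map (term_val X v) ts) = Some ?xs"
    using val by (intro those_map_Some) force
  have "set ?xs \<subseteq> points X"
  proof
    fix x assume "x \<in> set ?xs"
    then obtain t where t: "t \<in> set ts" "x = the (term_val X v t)" by auto
    with val have "term_val X v t = Some x" by fastforce
    with wf t(1) show "x \<in> points X" by (intro term_val_in[OF X v]) (auto simp: list_all_iff)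
  qed
  then have "tuple_of ?xs \<in> tuples (length ts) (points X)" using tuple_of_in[of ?xs] by simp
  moreover have "those (map (term_val (ego_struct M) (compose {..<k} u v)) ts) = Some (map u ?xs)"
    if "u \<in> U" for u
    by (rule those_mor[OF separated_byD(2)[OF U that] _ wf xs]) (simp add: compose_def)
  moreover have "tuple_of (map u ?xs) = compose {..<length ts} u (tuple_of ?xs)"
    if "u \<in> U" for u
    using tuple_of_map[of u ?xs] by simp
  ultimately show thesis using xs by (intro that)
qed

text \<open>Definedness is reflected by induction: the arguments are defined, and the tuple of their
  values is in the domain of \<open>h\<close> because all its images in \<open>M\<close> are in the
  domain.\<close>

lemma term_val_separated:
  assumes X: "wf_struct E X" and U: "separated_by M E X U" and v: "v \<in> tuples k (points X)"
  shows "wf_trm E k t \<Longrightarrow> (\<And>u. u \<in> U \<Longrightarrow> \<exists>b. term_val (ego_struct M) (compose {..<k} u v) t = Some b)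
    \<Longrightarrow> \<exists>y. term_val X v t = Some y"
proof (induction t)
  case (App h ts)
  then have h: "h \<in> pops E" and len: "length ts = arity h" and wf: "list_all (wf_trm E k) ts"
    by simp_all
  have "\<exists>y. term_val X v t = Some y" if t: "t \<in> set ts" for t
  proof (rule App.IH[OF t])
    show "wf_trm E k t" using wf t by (simp add: list_all_iff)
    fix u assume "u \<in> U"
    from App.prems(2)[OF this] obtain xs
      where "those (map (term_val (ego_struct M) (compose {..<k} u v)) ts) = Some xs"
      by (auto simp: bind_eq_Some_conv)
    then show "\<exists>b. term_val (ego_struct M) (compose {..<k} u v) t = Some b"
      using t by (auto simp: those_map_eq_Some_iff list_all2_conv_all_nth in_set_conv_nth)
  qed
  then obtain xs where xs: "those (map (term_val X v) ts) = Some xs"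
    and xsX: "tuple_of xs \<in> tuples (length ts) (points X)"
    and u_xs: "\<And>u. u \<in> U \<Longrightarrow>
      those (map (term_val (ego_struct M) (compose {..<k} u v)) ts) = Some (map u xs)"
    and u_tuple: "\<And>u. u \<in> U \<Longrightarrow> tuple_of (map u xs) = compose {..<length ts} u (tuple_of xs)"
    by (rule those_separated[OF X U v wf]) (assumption, rule that)
  have "tuple_of xs \<in> dom (pop X h)"
  proof (rule separated_byD(4)[OF U h])
    show "tuple_of xs \<in> tuples (arity h) (points X)" using xsX len by simp
    show "compose {..<arity h} u (tuple_of xs) \<in> dom (snd h)" if u: "u \<in> U" for u
      using App.prems(2)[OF u] u_xs[OF u] u_tuple[OF u] len by (auto simp: ego_struct_def)
  qed
  then show ?case using xs by auto
qed simp

lemma atom_true_separated: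
  assumes X: "wf_struct E X" and U: "separated_by M E X U" and v: "v \<in> tuples k (points X)"
    and wf: "wf_atom E k \<alpha>"
    and tr: "\<And>u. u \<in> U \<Longrightarrow> atom_true (ego_struct M) (compose {..<k} u v) \<alpha>"
  shows "atom_true X v \<alpha>"
proof (cases \<alpha>)
  case (Eq s t)
  have v': "compose {..<k} u v i = u (v i)" if "i < k" for u i
    using that by (simp add: compose_def)
  have w: "wf_trm E k s" "wf_trm E k t" using wf unfolding Eq by simp_all
  have e: "\<exists>b. term_val (ego_struct M) (compose {..<k} u v) s = Some b \<and>
      term_val (ego_struct M) (compose {..<k} u v) t = Some b" if "u \<in> U" for u
    using tr[OF that] unfolding Eq by simp
  obtain x where x: "term_val X v s = Some x" using term_val_separated[OF X U v w(1)] e by blast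
  obtain y where y: "term_val X v t = Some y" using term_val_separated[OF X U v w(2)] e by blast
  have "x = y"
  proof (rule separated_byD(3)[OF U term_val_in[OF X v w(1) x] term_val_in[OF X v w(2) y]])
    fix u assume u: "u \<in> U"
    note um = separated_byD(2)[OF U u]
    show "u x = u y"
      using e[OF u] term_val_mor[OF um v'[of _ u] w(1) x] term_val_mor[OF um v'[of _ u] w(2) y] by simp
  qed
  with x y show ?thesis unfolding Eq by simp
next
  case (Rel \<rho> ts)
  have w: "\<rho> \<in> rels E" "length ts = arity \<rho>" "list_all (wf_trm E k) ts"
    using wf unfolding Rel by simp_all
  have "\<exists>y. term_val X v t = Some y" if t: "t \<in> set ts" for t
  proof (rule term_val_separated[OF X U v])
    show "wf_trm E k t" using w(3) t by (simp add: list_all_iff)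
    fix u assume "u \<in> U"
    from tr[OF this] obtain xs
      where "those (map (term_val (ego_struct M) (compose {..<k} u v)) ts) = Some xs"
      unfolding Rel by auto
    then show "\<exists>b. term_val (ego_struct M) (compose {..<k} u v) t = Some b"
      using t by (auto simp: those_map_eq_Some_iff list_all2_conv_all_nth in_set_conv_nth)
  qed
  then obtain xs where xs: "those (map (term_val X v) ts) = Some xs"
    and xsX: "tuple_of xs \<in> tuples (length ts) (points X)"
    and u_xs: "\<And>u. u \<in> U \<Longrightarrow>
      those (map (term_val (ego_struct M) (compose {..<k} u v)) ts) = Some (map u xs)"
    and u_tuple: "\<And>u. u \<in> U \<Longrightarrow> tuple_of (map u xs) = compose {..<length ts} u (tuple_of xs)"
    by (rule those_separated[OF X U v w(3)]) (assumption, rule that)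
  have "tuple_of xs \<in> rel X \<rho>"
  proof (rule separated_byD(5)[OF U w(1)])
    show "tuple_of xs \<in> tuples (arity \<rho>) (points X)" using xsX w(2) by simp
    show "compose {..<arity \<rho>} u (tuple_of xs) \<in> snd \<rho>" if u: "u \<in> U" for u
      using tr[OF u] u_xs[OF u] u_tuple[OF u] w(2) unfolding Rel by (auto simp: ego_struct_def)
  qed
  with xs show ?thesis unfolding Rel by simp
qed

text \<open>The premises are pushed forward along every morphism, the sentence is applied in
  \<open>M\<close>, and separation pulls the conclusion back. For the conclusion
  \<open>\<bottom>\<close> the existence of a single morphism gives the contradiction.\<close>

lemma separated_uh_true:
  assumes E: "is_alter_ego \<Sigma> M E" and sX: "separated M E X" and \<sigma>: "\<sigma> \<in> Th_uH M E"
  shows "uh_true X \<sigma>"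
  unfolding uh_true_def
proof (intro ballI impI)
  let ?k = "uh_vars \<sigma>" and ?U = "mor E X (ego_struct M)"
  have X: "wf_struct E X" and U: "separated_by M E X ?U"
    using sX boolean_struct_wf unfolding separated_def by blast+
  have wf: "\<forall>\<alpha>\<in>set (uh_premises \<sigma>). wf_atom E ?k \<alpha>"
      "\<forall>\<gamma>. uh_conclusion \<sigma> = Some \<gamma> \<longrightarrow> wf_atom E ?k \<gamma>" and tr: "uh_true (ego_struct M) \<sigma>"
    using \<sigma> by (simp_all add: Th_uH_def uh_sentences_def)
  fix v assume v: "v \<in> tuples ?k (points X)" and pr: "\<forall>\<alpha>\<in>set (uh_premises \<sigma>). atom_true X v \<alpha>"
  have *: "case uh_conclusion \<sigma> of None \<Rightarrow> False | Some \<gamma> \<Rightarrow> atom_true (ego_struct M) (compose {..<?k} u v) \<gamma>"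
    if u: "u \<in> ?U" for u
  proof -
    have "atom_true (ego_struct M) (compose {..<?k} u v) \<alpha>" if \<alpha>: "\<alpha> \<in> set (uh_premises \<sigma>)" for \<alpha>
      by (rule atom_true_mor[where k = ?k and v = v, OF u]) (use wf(1) pr \<alpha> in \<open>simp_all add: compose_def\<close>)
    moreover have "compose {..<?k} u v \<in> tuples ?k (points (ego_struct M))"
      by (rule compose_tuples[OF v morD(2)[OF u]])
    ultimately show ?thesis using tr unfolding uh_true_def by blast
  qed
  show "case uh_conclusion \<sigma> of None \<Rightarrow> False | Some \<gamma> \<Rightarrow> atom_true X v \<gamma>"
  proof (cases "uh_conclusion \<sigma>")
    case None
    with * separated_byD(1)[OF U] show ?thesis by auto
  next
    case (Some \<gamma>)
    then have "atom_true X v \<gamma>"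
      using wf(2) * by (intro atom_true_separated[OF X U v]) auto
    with Some show ?thesis by simp
  qed
qed

section \<open>Finite substructures of models of the universal Horn theory\<close>

lemma boolean_struct_discrete:
  assumes X: "wf_struct E X" and fin: "finite A" and T: "space X = discrete_topology A"
  shows "boolean_struct E X"
proof -
  have T': "tuple_space n (space X) = discrete_topology (tuples n A)" for n
    unfolding T by (rule product_topology_discrete) simp
  have "totally_disconnected (space X)"
    unfolding totally_disconnected_def T connectedin_discrete_topology by blast
  moreover have "closedin (tuple_space (arity h) (space X)) (dom (pop X h))"
      "continuous_map (subtopology (tuple_space (arity h) (space X)) (dom (pop X h))) (space X)
        (\<lambda>x. the (pop X h x))" if h: "h \<in> pops E" for h
  proof -
    have sub: "dom (pop X h) \<subseteq> tuples (arity h) A"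
      using X h T unfolding wf_struct_def by simp
    then show "closedin (tuple_space (arity h) (space X)) (dom (pop X h))" unfolding T' by simp
    have "the (pop X h x) \<in> A" if "x \<in> dom (pop X h)" for x
      using that wf_struct_popD(2)[OF X h] T by auto
    then show "continuous_map (subtopology (tuple_space (arity h) (space X)) (dom (pop X h))) (space X)
        (\<lambda>x. the (pop X h x))"
      unfolding T' subtopology_discrete_topology using T by (simp add: Pi_iff)
  qed
  moreover have "closedin (tuple_space (arity \<rho>) (space X)) (rel X \<rho>)" if "\<rho> \<in> rels E" for \<rho>
    using X that T unfolding T' wf_struct_def by simp
  ultimately show ?thesis unfolding boolean_struct_def
    using fin T by (simp add: compact_space_discrete_topology)
qed

lemma space_induced_finite:
  assumes Y: "boolean_struct E Y" and C: "finite C" "C \<subseteq> points Y"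
  shows "space (induced_on Y C) = discrete_topology C"
proof -
  have "t1_space (space Y)" using Y by (simp add: boolean_struct_def Hausdorff_imp_t1_space)
  then show ?thesis
    using C by (simp add: subtopology_eq_discrete_topology_gen_finite Int_absorb1)
qed

lemma boolean_struct_induced_finite:
  assumes Y: "boolean_struct E Y" and C: "finite C" "closed_under_pops E Y C"
  shows "boolean_struct E (induced_on Y C)"
proof (rule boolean_struct_discrete)
  show "wf_struct E (induced_on Y C)" by (rule wf_struct_induced[OF boolean_struct_wf[OF Y] C(2)])
  show "space (induced_on Y C) = discrete_topology C"
    using C by (intro space_induced_finite[OF Y]) (simp_all add: closed_under_pops_def)
qed (rule C(1))

text \<open>The atomic type of finitely many points of a model is cut out, among the tuples over \<open>M\<close>, by
  finitely many atoms; the set \<open>T\<close> of solutions makes the generated substructure embed into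
  \<open>M\<^sup>T\<close>.\<close>

lemma uh_model_locally_separated:
  fixes Y :: "('a, 'x) tstruct"
  assumes E: "is_alter_ego \<Sigma> M E" and finM: "finite (carrier M)" and bY: "boolean_struct E Y"
    and mod: "\<forall>\<sigma>\<in>Th_uH M E. uh_true Y \<sigma>" and F: "finite F" "F \<subseteq> points Y"
  obtains C where "finite C" "F \<subseteq> C" "closed_under_pops E Y C" "separated M E (induced_on Y C)"
proof -
  let ?e = "ego_struct M"
  have Y: "wf_struct E Y" by (rule boolean_struct_wf[OF bY])
  define k where "k = card F"
  obtain v0 where v0: "bij_betw v0 {0..<k} F"
    using ex_bij_betw_nat_finite[OF F(1)] unfolding k_def by blast
  define v where "v = restrict v0 {..<k}"
  have vF: "v ` {..<k} = F" using v0 unfolding v_def by (simp add: bij_betw_def atLeast0LessThan)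
  have v: "v \<in> tuples k (points Y)" unfolding v_def
    using vF F(2) by (auto simp: restrict_PiE_iff v_def)
  define T where "T = {a \<in> tuples k (carrier M).
    \<forall>\<alpha>. wf_atom E k \<alpha> \<longrightarrow> atom_true Y v \<alpha> \<longrightarrow> atom_true ?e a \<alpha>}"
  have fT: "finite (tuples k (carrier M))" by (rule finite_PiE) (simp_all add: finM)
  \<comment> \<open>One failing atom is chosen for each excluded tuple. There are only finitely many
    tuples, so a finite list \<open>\<alpha>s\<close> defines \<open>T\<close> even if the signature
    is infinite.\<close>
  define bad where "bad = tuples k (carrier M) - T"
  have "\<exists>\<alpha>. wf_atom E k \<alpha> \<and> atom_true Y v \<alpha> \<and> \<not> atom_true ?e a \<alpha>" if "a \<in> bad" for a
    using that unfolding bad_def T_def by blast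
  then obtain wit where wit: "\<And>a. a \<in> bad \<Longrightarrow>
      wf_atom E k (wit a) \<and> atom_true Y v (wit a) \<and> \<not> atom_true ?e a (wit a)" by metis
  have "finite (wit ` bad)" using fT unfolding bad_def by simp
  then obtain \<alpha>s where \<alpha>s: "set \<alpha>s = wit ` bad" using finite_list by blast
  have inT: "a \<in> T" if "a \<in> tuples k (carrier M)" "\<forall>\<alpha>\<in>set \<alpha>s. atom_true ?e a \<alpha>" for a
    using that wit unfolding \<alpha>s bad_def by blast
  have pr: "\<forall>\<alpha>\<in>set \<alpha>s. wf_atom E k \<alpha>" "\<forall>\<alpha>\<in>set \<alpha>s. atom_true Y v \<alpha>"
    unfolding \<alpha>s using wit by blast+
  \<comment> \<open>If \<open>T\<close> were empty, \<open>\<alpha>s\<close> would be unsatisfiable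
    in \<open>M\<close>; the sentence with premises \<open>\<alpha>s\<close> and conclusion
    \<open>\<bottom>\<close> would belong to the theory but fail in \<open>Y\<close> at
    \<open>v\<close>.\<close>
  have T1: "T \<noteq> {}"
  proof
    assume e: "T = {}"
    have "\<exists>\<alpha>\<in>set \<alpha>s. \<not> atom_true ?e a \<alpha>" if "a \<in> tuples k (carrier M)" for a
      using inT[OF that] e by blast
    then have "UH k \<alpha>s None \<in> Th_uH M E"
      unfolding Th_uH_def uh_sentences_def uh_true_def using pr(1) by simp
    with mod v pr(2) show False unfolding uh_true_def by fastforce
  qed
  have T2: "atom_true Y v \<gamma>" if wf: "wf_atom E k \<gamma>" and tr: "\<And>a. a \<in> T \<Longrightarrow> atom_true ?e a \<gamma>" for \<gamma>
  proof -
    have "UH k \<alpha>s (Some \<gamma>) \<in> Th_uH M E"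
      unfolding Th_uH_def uh_sentences_def uh_true_def using pr(1) wf tr[OF inT] by simp
    with mod have "uh_true Y (UH k \<alpha>s (Some \<gamma>))" by blast
    with v pr(2) show ?thesis unfolding uh_true_def by simp
  qed
  have T3: "atom_true ?e a \<gamma>" if "wf_atom E k \<gamma>" "atom_true Y v \<gamma>" "a \<in> T" for \<gamma> a
    using that unfolding T_def by blast
  define C where "C = {y. \<exists>t. wf_trm E k t \<and> term_val Y v t = Some y}"
  have "\<exists>t. wf_trm E k t \<and> term_val Y v t = Some y" if "y \<in> C" for y
    using that unfolding C_def by blast
  then obtain pick where pick: "\<And>y. y \<in> C \<Longrightarrow> wf_trm E k (pick y)"
      "\<And>y. y \<in> C \<Longrightarrow> term_val Y v (pick y) = Some y" by metis
  \<comment> \<open>\<open>u a\<close> is to be the morphism that sends \<open>v\<close> to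
    \<open>a\<close>. The choice of the term \<open>pick y\<close> is irrelevant: an equation
    between two terms with the same value at \<open>v\<close> is an atom true at \<open>v\<close>,
    hence true at \<open>a\<close>. This is \<open>val\<close>.\<close>
  define u where "u a = (\<lambda>y\<in>C. the (term_val ?e a (pick y)))" for a
  have val: "term_val ?e a t = Some (u a y)"
    if t: "wf_trm E k t" "term_val Y v t = Some y" and a: "a \<in> T" for t y a
  proof -
    have y: "y \<in> C" using t unfolding C_def by blast
    have "atom_true ?e a (Eq t (pick y))"
      by (rule T3[OF _ _ a]) (use t pick[OF y] in simp_all)
    then show ?thesis using y unfolding u_def by auto
  qed
  have CY: "C \<subseteq> points Y"
    unfolding C_def using term_val_in[OF Y v] by blast
  have FC: "F \<subseteq> C"
  proof
    fix y assume "y \<in> F"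
    then obtain i where "i < k" "y = v i" using vF by blast
    then have "wf_trm E k (Var i) \<and> term_val Y v (Var i) = Some y" by simp
    then show "y \<in> C" unfolding C_def by blast
  qed
  have sep: "y = y'" if y: "y \<in> C" "y' \<in> C" and eq: "\<And>a. a \<in> T \<Longrightarrow> u a y = u a y'" for y y'
  proof -
    have "atom_true Y v (Eq (pick y) (pick y'))"
    proof (rule T2)
      fix a assume a: "a \<in> T"
      show "atom_true ?e a (Eq (pick y) (pick y'))"
        using val[OF pick[OF y(1)] a] val[OF pick[OF y(2)] a] eq[OF a] by simp
    qed (use pick y in simp)
    then show ?thesis using pick(2)[OF y(1)] pick(2)[OF y(2)] by simp
  qed
  have uM: "u a y \<in> carrier M" if y: "y \<in> C" and a: "a \<in> T" for a y
  proof -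
    have "a \<in> tuples k (points ?e)" using a unfolding T_def by simp
    from term_val_in[OF wf_struct_ego[OF E] this pick(1)[OF y] val[OF pick[OF y] a]]
    show ?thesis by simp
  qed
  define ts where "ts x n = map (\<lambda>i. pick (x i)) [0..<n]" for x :: "nat \<Rightarrow> 'x" and n :: nat
  have ts_len: "length (ts x n) = n" for x n by (simp add: ts_def)
  have ts_wf: "list_all (wf_trm E k) (ts x n)" if x: "x \<in> tuples n C" for x n
    using pick(1)[OF PiE_mem[OF x]] by (simp add: ts_def list_all_iff)
  have ts_Y: "those (map (term_val Y v) (ts x n)) = Some (map x [0..<n])" if x: "x \<in> tuples n C" for x n
    unfolding ts_def map_map using pick(2)[OF PiE_mem[OF x]] by (intro those_map_Some) simp
  have ts_e: "those (map (term_val ?e a) (ts x n)) = Some (map (\<lambda>i. u a (x i)) [0..<n])"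
    if x: "x \<in> tuples n C" and a: "a \<in> T" for x n a
    unfolding ts_def map_map using val[OF pick[OF PiE_mem[OF x]] a] by (intro those_map_Some) simp
  have ut: "tuple_of (map (\<lambda>i. u a (x i)) [0..<n]) = compose {..<n} (u a) x" for a x n
    by (simp add: tuple_of_def compose_def fun_eq_iff)
  have app_Y: "term_val Y v (App h (ts x (arity h))) = pop Y h x" if x: "x \<in> tuples (arity h) C" for h x
    using ts_Y[OF x] tuple_of_map_upt[OF x] by simp
  have app_e: "term_val ?e a (App h (ts x (arity h))) = snd h (compose {..<arity h} (u a) x)"
    if x: "x \<in> tuples (arity h) C" and a: "a \<in> T" for h x a
    using ts_e[OF x a] by (simp add: ut ego_struct_def)
  have app_wf: "wf_trm E k (App h (ts x (arity h)))" if "h \<in> pops E" "x \<in> tuples (arity h) C" for h x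
    using that ts_wf ts_len by simp
  have rel_Y: "atom_true Y v (Rel \<rho> (ts x (arity \<rho>))) \<longleftrightarrow> x \<in> rel Y \<rho>" if x: "x \<in> tuples (arity \<rho>) C" for \<rho> x
    using ts_Y[OF x] tuple_of_map_upt[OF x] by simp
  have rel_e: "atom_true ?e a (Rel \<rho> (ts x (arity \<rho>))) \<longleftrightarrow> compose {..<arity \<rho>} (u a) x \<in> snd \<rho>"
    if x: "x \<in> tuples (arity \<rho>) C" and a: "a \<in> T" for \<rho> x a
    using ts_e[OF x a] by (simp add: ut ego_struct_def)
  have rel_wf: "wf_atom E k (Rel \<rho> (ts x (arity \<rho>)))" if "\<rho> \<in> rels E" "x \<in> tuples (arity \<rho>) C" for \<rho> x
    using that ts_wf ts_len by simp
  have cl: "closed_under_pops E Y C"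
    unfolding closed_under_pops_def
  proof (intro conjI ballI allI impI CY)
    fix h x y assume h: "h \<in> pops E" and x: "x \<in> tuples (arity h) C" and y: "pop Y h x = Some y"
    have "wf_trm E k (App h (ts x (arity h))) \<and> term_val Y v (App h (ts x (arity h))) = Some y"
      using app_wf[OF h x] unfolding app_Y[OF x] y by blast
    then show "y \<in> C" unfolding C_def by blast
  qed
  \<comment> \<open>The generated substructure is finite although there may be infinitely many
    terms: by \<open>sep\<close> a point is determined by its images under the maps
    \<open>u a\<close>, and both \<open>T\<close> and \<open>M\<close> are finite.\<close>
  have finC: "finite C"
  proof (rule inj_on_finite)
    show "inj_on (\<lambda>y. \<lambda>a\<in>T. u a y) C"
    proof (rule inj_onI)
      fix y y' assume y: "y \<in> C" "y' \<in> C" and eq: "(\<lambda>a\<in>T. u a y) = (\<lambda>a\<in>T. u a y')"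
      show "y = y'"
      proof (rule sep[OF y])
        fix a assume "a \<in> T"
        with fun_cong[OF eq, of a] show "u a y = u a y'" by simp
      qed
    qed
    show "(\<lambda>y. \<lambda>a\<in>T. u a y) ` C \<subseteq> T \<rightarrow>\<^sub>E carrier M"
      using uM by (auto simp: restrict_PiE_iff)
    have "finite T" using fT unfolding T_def by simp
    then show "finite (T \<rightarrow>\<^sub>E carrier M)" by (rule finite_PiE) (simp add: finM)
  qed
  let ?I = "induced_on Y C"
  have pI: "points ?I = C" by (rule points_induced[OF CY])
  have bI: "boolean_struct E ?I" by (rule boolean_struct_induced_finite[OF bY finC cl])
  have umor: "u a \<in> mor E ?I ?e" if a: "a \<in> T" for a
    unfolding mor_def mem_Collect_eq pI
  proof (intro conjI ballI allI impI)
    show "u a \<in> C \<rightarrow>\<^sub>E points ?e" using uM a unfolding u_def by (simp add: restrict_PiE_iff)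
    show "continuous_map (space ?I) (space ?e) (u a)"
      unfolding space_induced_finite[OF bY finC CY] using uM a by (simp add: ego_struct_def Pi_iff)
    fix h x y assume h: "h \<in> pops E" and "pop ?I h x = Some y"
    then have x: "x \<in> tuples (arity h) C" and y: "pop Y h x = Some y" by (simp_all add: pop_induced)
    have "term_val ?e a (App h (ts x (arity h))) = Some (u a y)"
      by (rule val[OF app_wf[OF h x] _ a]) (use app_Y[OF x] y in simp)
    then show "pop ?e h (compose {..<arity h} (u a) x) = Some (u a y)"
      using app_e[OF x a] by (simp add: ego_struct_def)
  next
    fix \<rho> x assume \<rho>: "\<rho> \<in> rels E" and "x \<in> rel ?I \<rho>"
    then have x: "x \<in> tuples (arity \<rho>) C" and xr: "x \<in> rel Y \<rho>" by (simp_all add: induced_on_def)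
    have "atom_true ?e a (Rel \<rho> (ts x (arity \<rho>)))"
      by (rule T3[OF rel_wf[OF \<rho> x] _ a]) (use rel_Y[OF x] xr in blast)
    then show "compose {..<arity \<rho>} (u a) x \<in> rel ?e \<rho>"
      using rel_e[OF x a] by (simp add: ego_struct_def)
  qed
  have "separated_by M E ?I (u ` T)"
  proof (rule separated_byI)
    show "u ` T \<noteq> {}" using T1 by simp
    show "w \<in> mor E ?I ?e" if "w \<in> u ` T" for w using that umor by blast
    show "y = y'" if "y \<in> points ?I" "y' \<in> points ?I" "\<And>w. w \<in> u ` T \<Longrightarrow> w y = w y'" for y y'
      by (rule sep) (use that pI in blast)+
  next
    fix h x assume h: "h \<in> pops E" and "x \<in> tuples (arity h) (points ?I)"
      and d: "\<And>w. w \<in> u ` T \<Longrightarrow> compose {..<arity h} w x \<in> dom (snd h)"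
    then have x: "x \<in> tuples (arity h) C" unfolding pI by blast
    let ?t = "App h (ts x (arity h))"
    \<comment> \<open>The equation of \<open>?t\<close> with itself is the atom expressing that
      \<open>?t\<close> is defined.\<close>
    have "atom_true Y v (Eq ?t ?t)"
    proof (rule T2)
      fix a assume a: "a \<in> T"
      show "atom_true ?e a (Eq ?t ?t)"
        using d[OF imageI[OF a]] app_e[OF x a] by (auto simp del: term_val.simps)
    qed (use app_wf[OF h x] in \<open>simp del: wf_trm.simps\<close>)
    then obtain y where "pop Y h x = Some y" using app_Y[OF x] by (auto simp del: term_val.simps)
    with x have "pop ?I h x = Some y" by (simp add: pop_induced)
    then show "x \<in> dom (pop ?I h)" by blast
  next
    fix \<rho> x assume \<rho>: "\<rho> \<in> rels E" and "x \<in> tuples (arity \<rho>) (points ?I)"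
      and d: "\<And>w. w \<in> u ` T \<Longrightarrow> compose {..<arity \<rho>} w x \<in> snd \<rho>"
    then have x: "x \<in> tuples (arity \<rho>) C" unfolding pI by blast
    have "atom_true Y v (Rel \<rho> (ts x (arity \<rho>)))"
      using rel_e[OF x] d by (intro T2[OF rel_wf[OF \<rho> x]]) blast
    then show "x \<in> rel ?I \<rho>" using rel_Y[OF x] x by (simp add: induced_on_def)
  qed
  with bI have "separated M E ?I" by (rule separatedI)
  with finC FC cl show thesis by (rule that)
qed

section \<open>Duals of finite algebras, in particular of compatible relations regarded as
  algebras\<close>

section \<open>Dual structures of algebras\<close>

lemma alg_homD:
  assumes "z \<in> alg_hom \<Sigma> A B"
  shows "z \<in> carrier A \<rightarrow>\<^sub>E carrier B"
    and "f \<in> \<Sigma> \<Longrightarrow> x \<in> tuples (arity f) (carrier A) \<Longrightarrow> z (opr A f x) = opr B f (compose {..<arity f} z x)"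
  using assms unfolding alg_hom_def by blast+

lemma is_algebraD:
  "is_algebra \<Sigma> A \<Longrightarrow> f \<in> \<Sigma> \<Longrightarrow> x \<in> tuples (arity f) (carrier A) \<Longrightarrow> opr A f x \<in> carrier A"
  unfolding is_algebra_def by blast

lemma compatible_rel_opr:
  assumes "compatible_rel \<Sigma> M \<rho>" "f \<in> \<Sigma>" "\<And>j. j < arity f \<Longrightarrow> g j \<in> snd \<rho>"
  shows "(\<lambda>i\<in>{..<arity \<rho>}. opr M f (\<lambda>j\<in>{..<arity f}. g j i)) \<in> snd \<rho>"
proof -
  have "(\<lambda>j\<in>{..<arity f}. g j) \<in> tuples (arity f) (snd \<rho>)"
    using assms(3) by (simp add: restrict_PiE_iff)
  then have "opr (alg_power M {..<arity \<rho>}) f (\<lambda>j\<in>{..<arity f}. g j) \<in> snd \<rho>"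
    using assms(1,2) unfolding compatible_rel_def subuniverse_def by blast
  then show ?thesis by (simp add: alg_power_def cong: restrict_cong)
qed

text \<open>The value \<open>y\<close> is computed pointwise, so each element of \<open>A\<close>
  yields a tuple in the graph of \<open>h\<close>. Applying an operation \<open>f\<close> to such
  tuples stays in the graph by compatibility. The graph is single-valued, so the last entry of the
  result is the value of \<open>y\<close> at \<open>opr A f as\<close>.\<close>

lemma closed_under_pops_alg_hom:
  assumes E: "is_alter_ego \<Sigma> M E" and A: "is_algebra \<Sigma> A"
  shows "closed_under_pops E (struct_power (ego_struct M) (carrier A)) (alg_hom \<Sigma> A M)"
  unfolding closed_under_pops_def
proof (intro conjI ballI allI impI)
  let ?P = "struct_power (ego_struct M) (carrier A)"
  show "alg_hom \<Sigma> A M \<subseteq> points ?P" using alg_homD(1) by fastforce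
  fix h x y assume h: "h \<in> pops E" and x: "x \<in> tuples (arity h) (alg_hom \<Sigma> A M)" and y: "pop ?P h x = Some y"
  let ?n = "arity h"
  have s: "Inl h \<in> syms E" using h unfolding syms_def by blast
  have "x(?n := y) \<in> interp ?P (Inl h)" using y by auto
  then have g: "(compose {..<?n} (\<lambda>z. z a) x)(?n := y a) \<in> pop_graph h" if "a \<in> carrier A" for a
    unfolding interp_power[OF E s] using that by (simp add: compose_tuple_upd)
  have yM: "y \<in> carrier A \<rightarrow>\<^sub>E carrier M"
    using wf_struct_popD(2)[OF wf_struct_power[OF E] h y] by simp
  show "y \<in> alg_hom \<Sigma> A M"
    unfolding alg_hom_def mem_Collect_eq
  proof (intro conjI ballI yM)
    fix f as assume f: "f \<in> \<Sigma>" and as: "as \<in> tuples (arity f) (carrier A)"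
    let ?g = "\<lambda>j. (compose {..<?n} (\<lambda>z. z (as j)) x)(?n := y (as j))"
    have "(\<lambda>i\<in>{..<Suc ?n}. opr M f (\<lambda>j\<in>{..<arity f}. ?g j i)) \<in> pop_graph h"
      using compatible_rel_opr[of \<Sigma> M "(Suc ?n, pop_graph h)" f ?g]
        compatible_sym_rel[OF E s] f g[OF PiE_mem[OF as]] by simp
    moreover have "(\<lambda>i\<in>{..<Suc ?n}. opr M f (\<lambda>j\<in>{..<arity f}. ?g j i)) =
      (compose {..<?n} (\<lambda>z. z (opr A f as)) x)(?n := opr M f (compose {..<arity f} y as))" (is "?l = ?r")
    proof
      fix i
      consider "i < ?n" | "i = ?n" | "i > ?n" by linarith
      then show "?l i = ?r i"
      proof cases
        case 1
        then have "x i \<in> alg_hom \<Sigma> A M" using PiE_mem[OF x] by simp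
        from alg_homD(2)[OF this f as] 1 show ?thesis by (simp add: compose_def)
      qed (simp_all add: compose_def)
    qed
    ultimately have "(compose {..<?n} (\<lambda>z. z (opr A f as)) x)(?n := opr M f (compose {..<arity f} y as))
        \<in> pop_graph h" by simp
    moreover note g[OF is_algebraD[OF A f as]]
    moreover have "compose {..<?n} (\<lambda>z. z (opr A f as)) x \<in> tuples ?n UNIV"
      by (simp add: compose_def)
    ultimately show "y (opr A f as) = opr M f (compose {..<arity f} y as)"
      using sym_rel_upd_iff[OF E h] by fastforce
  qed
qed

lemma points_dual_D: "points (dual_D \<Sigma> M A) = alg_hom \<Sigma> A M"
  unfolding dual_D_def by (rule points_induced) (use alg_homD(1) in fastforce)

lemma wf_struct_dual_D:
  "is_alter_ego \<Sigma> M E \<Longrightarrow> is_algebra \<Sigma> A \<Longrightarrow> wf_struct E (dual_D \<Sigma> M A)"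
  unfolding dual_D_def by (intro wf_struct_induced wf_struct_power closed_under_pops_alg_hom)

lemma interp_dual_D:
  assumes E: "is_alter_ego \<Sigma> M E" and A: "is_algebra \<Sigma> A" and s: "s \<in> syms E"
  shows "interp (dual_D \<Sigma> M A) s = {t \<in> tuples (sym_arity s) (alg_hom \<Sigma> A M).
    \<forall>a\<in>carrier A. compose {..<sym_arity s} (\<lambda>z. z a) t \<in> snd (sym_rel s)}"
proof -
  have "t \<in> tuples (sym_arity s) (carrier A \<rightarrow>\<^sub>E carrier M)"
    if "t \<in> tuples (sym_arity s) (alg_hom \<Sigma> A M)" for t
    using that by (rule tuples_subset_in) (use alg_homD(1) in fast)
  then show ?thesis
    unfolding dual_D_def
      interp_induced[OF wf_struct_power[OF E] closed_under_pops_alg_hom[OF E A] s] interp_power[OF E s]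
    by blast
qed

lemma space_dual_D_finite:
  assumes "finite (carrier A)"
  shows "space (dual_D \<Sigma> M A) = discrete_topology (alg_hom \<Sigma> A M)"
proof -
  have "(carrier A \<rightarrow>\<^sub>E carrier M) \<inter> alg_hom \<Sigma> A M = alg_hom \<Sigma> A M" using alg_homD(1) by fast
  then show ?thesis by (simp add: dual_D_def product_topology_discrete[OF assms])
qed

lemma mor_dual_D_finite_iff:
  assumes E: "is_alter_ego \<Sigma> M E" and A: "is_algebra \<Sigma> A" and fin: "finite (carrier A)"
  shows "w \<in> mor E (dual_D \<Sigma> M A) (ego_struct M) \<longleftrightarrow>
    w \<in> alg_hom \<Sigma> A M \<rightarrow>\<^sub>E carrier M \<and>
    (\<forall>s\<in>syms E. \<forall>t\<in>interp (dual_D \<Sigma> M A) s. compose {..<sym_arity s} w t \<in> snd (sym_rel s))"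
  unfolding mor_ego_iff[OF E wf_struct_dual_D[OF E A]] points_dual_D
  by (auto simp: space_dual_D_finite[OF fin])

lemma eval_mor:
  assumes E: "is_alter_ego \<Sigma> M E" and A: "is_algebra \<Sigma> A" and a: "a \<in> carrier A"
  shows "(\<lambda>z\<in>alg_hom \<Sigma> A M. z a) \<in> mor E (dual_D \<Sigma> M A) (ego_struct M)"
  unfolding mor_ego_iff[OF E wf_struct_dual_D[OF E A]] points_dual_D
proof (intro conjI ballI)
  let ?H = "alg_hom \<Sigma> A M"
  show "(\<lambda>z\<in>?H. z a) \<in> ?H \<rightarrow>\<^sub>E carrier M"
    using PiE_mem[OF alg_homD(1)[of _ \<Sigma> A M] a] by (simp add: Pi_iff)
  have "continuous_map (space (dual_D \<Sigma> M A)) (discrete_topology (carrier M)) (\<lambda>z. z a)"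
    unfolding dual_D_def space_induced space_power
    by (intro continuous_map_from_subtopology continuous_map_product_projection a)
  then show "continuous_map (space (dual_D \<Sigma> M A)) (discrete_topology (carrier M)) (\<lambda>z\<in>?H. z a)"
    by (rule continuous_map_eq) (simp add: points_dual_D)
  fix s t assume s: "s \<in> syms E" and t: "t \<in> interp (dual_D \<Sigma> M A) s"
  then have tH: "t \<in> tuples (sym_arity s) ?H" and ta: "compose {..<sym_arity s} (\<lambda>z. z a) t \<in> snd (sym_rel s)"
    using a unfolding interp_dual_D[OF E A s] by blast+
  have "compose {..<sym_arity s} (\<lambda>z\<in>?H. z a) t = compose {..<sym_arity s} (\<lambda>z. z a) t"
    by (rule compose_tuples_cong[OF tH]) simp
  with ta show "compose {..<sym_arity s} (\<lambda>z\<in>?H. z a) t \<in> snd (sym_rel s)" by simp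
qed

text \<open>Surjectivity of \<open>eval_alg\<close>; injectivity is the separate condition
  \<open>hom_separated\<close>. Both make sense for algebras over any type, while
  \<open>fully_dualises_finite\<close> speaks of one universe.\<close>

definition dualised_at ::
    "'f sig \<Rightarrow> ('f, 'a) algebra \<Rightarrow> 'a alter_ego \<Rightarrow> ('f, 'x) algebra \<Rightarrow> bool" where
  "dualised_at \<Sigma> M E A \<longleftrightarrow>
     (\<forall>w\<in>mor E (dual_D \<Sigma> M A) (ego_struct M). \<exists>a\<in>carrier A. \<forall>z\<in>alg_hom \<Sigma> A M. w z = z a)"

lemma iso_imp_dualised_at:
  assumes "alg_iso \<Sigma> (eval_alg \<Sigma> M A) A (dual_E M E (dual_D \<Sigma> M A))"
  shows "dualised_at \<Sigma> M E A"
  unfolding dualised_at_def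
proof
  fix w assume "w \<in> mor E (dual_D \<Sigma> M A) (ego_struct M)"
  then obtain a where a: "a \<in> carrier A" "w = eval_alg \<Sigma> M A a"
    using assms unfolding alg_iso_def bij_betw_def by auto
  then have "\<forall>z\<in>alg_hom \<Sigma> A M. w z = z a" by (simp add: eval_alg_def)
  with a(1) show "\<exists>a\<in>carrier A. \<forall>z\<in>alg_hom \<Sigma> A M. w z = z a" by blast
qed

lemma subalgebra_on_simps [simp]:
  "carrier (subalgebra_on A B) = B" "opr (subalgebra_on A B) = opr A"
  by (simp_all add: subalgebra_on_def)

definition hom_separated :: "'f sig \<Rightarrow> ('f, 'a) algebra \<Rightarrow> ('f, 'x) algebra \<Rightarrow> bool" where
  "hom_separated \<Sigma> M A \<longleftrightarrow>
     (\<forall>a\<in>carrier A. \<forall>b\<in>carrier A. (\<forall>z\<in>alg_hom \<Sigma> A M. z a = z b) \<longrightarrow> a = b)"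

text \<open>Evaluation embeds \<open>A\<close> in the power of \<open>M\<close> indexed by the
  homomorphisms from \<open>A\<close> to \<open>M\<close>, an index set of the type that
  \<open>ISP\<close> allows.\<close>

lemma hom_separated_imp_ISP:
  fixes A :: "('f, 'u) algebra"
  assumes A: "is_algebra \<Sigma> A" and sep: "hom_separated \<Sigma> M A"
  shows "A \<in> ISP \<Sigma> M"
proof -
  let ?H = "alg_hom \<Sigma> A M"
  let ?P = "alg_power M ?H" and ?\<phi> = "\<lambda>a\<in>carrier A. \<lambda>z\<in>?H. z a"
  let ?B = "?\<phi> ` carrier A"
  have hom: "?\<phi> (opr A f as) = opr ?P f (compose {..<arity f} ?\<phi> as)"
    if f: "f \<in> \<Sigma>" and as: "as \<in> tuples (arity f) (carrier A)" for f as
  proof -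
    have "z (opr A f as) = opr M f (\<lambda>i\<in>{..<arity f}. compose {..<arity f} ?\<phi> as i z)" if z: "z \<in> ?H" for z
    proof -
      have "(\<lambda>i\<in>{..<arity f}. compose {..<arity f} ?\<phi> as i z) = compose {..<arity f} z as"
        using PiE_mem[OF as] z by (simp add: compose_def fun_eq_iff)
      then show ?thesis using alg_homD(2)[OF z f as] by simp
    qed
    then show ?thesis using is_algebraD[OF A f as] by (simp add: alg_power_def fun_eq_iff)
  qed
  have sub: "subuniverse \<Sigma> ?P ?B"
    unfolding subuniverse_def
  proof (intro conjI ballI)
    show "?B \<noteq> {}" using A by (simp add: is_algebra_def)
    show "?B \<subseteq> carrier ?P"
      using PiE_mem[OF alg_homD(1)] by (auto simp: alg_power_def restrict_PiE_iff)
    fix f x assume f: "f \<in> \<Sigma>" and x: "x \<in> tuples (arity f) ?B"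
    let ?x = "compose {..<arity f} (inv_into (carrier A) ?\<phi>) x"
    have 1: "?x \<in> tuples (arity f) (carrier A)"
      by (rule compose_tuples[OF x]) (use inv_into_into[of _ ?\<phi> "carrier A"] in blast)
    have 2: "compose {..<arity f} ?\<phi> ?x = x"
      unfolding compose_tuples_assoc
      by (rule compose_tuples_id[OF x]) (simp only: comp_apply f_inv_into_f)
    have 3: "opr ?P f x = ?\<phi> (opr A f ?x)" using hom[OF f 1, symmetric] unfolding 2 .
    show "opr ?P f x \<in> ?B" unfolding 3 by (rule imageI) (rule is_algebraD[OF A f 1])
  qed
  have "inj_on ?\<phi> (carrier A)"
  proof (rule inj_onI)
    fix a b assume ab: "a \<in> carrier A" "b \<in> carrier A" "?\<phi> a = ?\<phi> b"
    then have eq: "(\<lambda>z\<in>?H. z a) = (\<lambda>z\<in>?H. z b)" by simp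
    have "\<forall>z\<in>?H. z a = z b" using fun_cong[OF eq] by (simp add: restrict_def) meson
    with ab show "a = b" using sep unfolding hom_separated_def by blast
  qed
  then have "bij_betw ?\<phi> (carrier A) (carrier (subalgebra_on ?P ?B))"
    by (simp add: bij_betw_def subalgebra_on_def)
  moreover have "?\<phi> \<in> alg_hom \<Sigma> A (subalgebra_on ?P ?B)"
    unfolding alg_hom_def[of \<Sigma> A "subalgebra_on ?P ?B"] mem_Collect_eq
  proof (intro conjI ballI)
    show "?\<phi> \<in> carrier A \<rightarrow>\<^sub>E carrier (subalgebra_on ?P ?B)" by (auto simp: subalgebra_on_def)
    show "?\<phi> (opr A f x) = opr (subalgebra_on ?P ?B) f (compose {..<arity f} ?\<phi> x)"
      if "f \<in> \<Sigma>" "x \<in> tuples (arity f) (carrier A)" for f x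
      using hom[OF that] unfolding subalgebra_on_simps .
  qed
  ultimately have "alg_iso \<Sigma> ?\<phi> A (subalgebra_on ?P ?B)"
    unfolding alg_iso_def by blast
  with sub A show ?thesis unfolding ISP_def by blast
qed

text \<open>The hypothesis speaks of algebras over the infinite type \<open>'u\<close> only; \<open>A\<close> is copied into \<open>'u\<close>.\<close>

lemma finite_dualised_at:
  fixes M :: "('f, 'b) algebra" and A :: "('f, 'x) algebra"
  assumes inf: "infinite (UNIV :: 'u set)" and full: "fully_dualises_finite TYPE('u) \<Sigma> M E"
    and E: "is_alter_ego \<Sigma> M E" and A: "is_algebra \<Sigma> A" and fin: "finite (carrier A)"
    and sep: "hom_separated \<Sigma> M A"
  shows "dualised_at \<Sigma> M E A"
proof -
  obtain V :: "'u set" where "finite V" "card V = card (carrier A)"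
    using infinite_arbitrarily_large[OF inf] by blast
  then obtain f where "bij_betw f (carrier A) V"
    using finite_same_card_bij[OF fin] by metis
  then have inj: "inj_on f (carrier A)" by (simp add: bij_betw_def)
  define g where "g = inv_into (carrier A) f"
  define B where "B = \<lparr>carrier = f ` carrier A, opr = \<lambda>h x. f (opr A h (compose {..<arity h} g x))\<rparr>"
  have gf: "g (f a) = a" if "a \<in> carrier A" for a using that inj by (simp add: g_def)
  have fg: "f (g b) = b" if "b \<in> carrier B" for b using that gf by (auto simp: B_def)
  have gA: "g b \<in> carrier A" if "b \<in> carrier B" for b using that gf by (auto simp: B_def)
  have fB: "f a \<in> carrier B" if "a \<in> carrier A" for a using that by (simp add: B_def)
  have gt: "compose {..<n} g x \<in> tuples n (carrier A)" if "x \<in> tuples n (carrier B)" for n x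
    by (rule compose_tuples[OF that]) (use gA in blast)
  have ft: "compose {..<n} f x \<in> tuples n (carrier B)" if "x \<in> tuples n (carrier A)" for n x
    by (rule compose_tuples[OF that]) (use fB in blast)
  have oB: "opr B h x = f (opr A h (compose {..<arity h} g x))" for h x by (simp add: B_def)
  have B: "is_algebra \<Sigma> B"
    unfolding is_algebra_def
  proof (intro conjI ballI)
    show "carrier B \<noteq> {}" using A by (simp add: B_def is_algebra_def)
    show "opr B h x \<in> carrier B" if "h \<in> \<Sigma>" "x \<in> tuples (arity h) (carrier B)" for h x
      unfolding oB by (intro fB is_algebraD[OF A that(1)] gt that(2))
  qed
  define P where "P z = (\<lambda>a\<in>carrier A. z (f a))" for z :: "'u \<Rightarrow> 'b"
  define Q where "Q y = (\<lambda>b\<in>carrier B. y (g b))" for y :: "'x \<Rightarrow> 'b"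
  have P: "P z \<in> alg_hom \<Sigma> A M" if z: "z \<in> alg_hom \<Sigma> B M" for z
    unfolding alg_hom_def mem_Collect_eq
  proof (intro conjI ballI)
    show "P z \<in> carrier A \<rightarrow>\<^sub>E carrier M"
      unfolding P_def using PiE_mem[OF alg_homD(1)[OF z] fB] by (simp add: restrict_PiE_iff)
    fix h x assume h: "h \<in> \<Sigma>" and x: "x \<in> tuples (arity h) (carrier A)"
    have "compose {..<arity h} g (compose {..<arity h} f x) = x"
      unfolding compose_tuples_assoc by (rule compose_tuples_id[OF x]) (simp add: gf)
    then have "z (f (opr A h x)) = opr M h (compose {..<arity h} z (compose {..<arity h} f x))"
      using alg_homD(2)[OF z h ft[OF x]] unfolding oB by simp
    also have "compose {..<arity h} z (compose {..<arity h} f x) = compose {..<arity h} (P z) x"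
      unfolding compose_tuples_assoc by (rule compose_tuples_cong[OF x]) (simp add: P_def)
    finally show "P z (opr A h x) = opr M h (compose {..<arity h} (P z) x)"
      using is_algebraD[OF A h x] by (simp add: P_def)
  qed
  have Q: "Q y \<in> alg_hom \<Sigma> B M" if y: "y \<in> alg_hom \<Sigma> A M" for y
    unfolding alg_hom_def mem_Collect_eq
  proof (intro conjI ballI)
    show "Q y \<in> carrier B \<rightarrow>\<^sub>E carrier M"
      unfolding Q_def using PiE_mem[OF alg_homD(1)[OF y] gA] by (simp add: restrict_PiE_iff)
    fix h x assume h: "h \<in> \<Sigma>" and x: "x \<in> tuples (arity h) (carrier B)"
    have "Q y (opr B h x) = y (opr A h (compose {..<arity h} g x))"
      using is_algebraD[OF B h x] gf[OF is_algebraD[OF A h gt[OF x]]] by (simp add: Q_def oB)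
    also have "\<dots> = opr M h (compose {..<arity h} y (compose {..<arity h} g x))"
      by (rule alg_homD(2)[OF y h gt[OF x]])
    also have "compose {..<arity h} y (compose {..<arity h} g x) = compose {..<arity h} (Q y) x"
      unfolding compose_tuples_assoc by (rule compose_tuples_cong[OF x]) (simp add: Q_def)
    finally show "Q y (opr B h x) = opr M h (compose {..<arity h} (Q y) x)" .
  qed
  have PQ: "P (Q y) = y" if y: "y \<in> alg_hom \<Sigma> A M" for y
  proof (rule extensionalityI)
    show "y \<in> extensional (carrier A)" using alg_homD(1)[OF y] by (simp add: PiE_def)
  qed (simp_all add: P_def Q_def fB gf)
  have "hom_separated \<Sigma> M B"
    unfolding hom_separated_def
  proof (intro ballI impI)
    fix a b assume ab: "a \<in> carrier B" "b \<in> carrier B" "\<forall>z\<in>alg_hom \<Sigma> B M. z a = z b"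
    have "y (g a) = y (g b)" if "y \<in> alg_hom \<Sigma> A M" for y
      using bspec[OF ab(3) Q[OF that]] ab(1,2) by (simp add: Q_def)
    then have "g a = g b" using sep gA ab(1,2) unfolding hom_separated_def by blast
    then show "a = b" using fg ab(1,2) by metis
  qed
  then have "B \<in> ISP \<Sigma> M" by (rule hom_separated_imp_ISP[OF B])
  moreover have finB: "finite (carrier B)" using fin by (simp add: B_def)
  ultimately have dB: "dualised_at \<Sigma> M E B"
    using full iso_imp_dualised_at unfolding fully_dualises_finite_def by blast
  show ?thesis
    unfolding dualised_at_def
  proof
    fix w assume w: "w \<in> mor E (dual_D \<Sigma> M A) (ego_struct M)"
    let ?w = "\<lambda>z\<in>alg_hom \<Sigma> B M. w (P z)"
    note w' = w[unfolded mor_dual_D_finite_iff[OF E A fin]]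
    have "?w \<in> mor E (dual_D \<Sigma> M B) (ego_struct M)"
      unfolding mor_dual_D_finite_iff[OF E B finB]
    proof (intro conjI ballI)
      show "?w \<in> alg_hom \<Sigma> B M \<rightarrow>\<^sub>E carrier M"
        using PiE_mem[OF conjunct1[OF w'] P] by (simp add: restrict_PiE_iff)
      fix s t assume s: "s \<in> syms E" and "t \<in> interp (dual_D \<Sigma> M B) s"
      then have t: "t \<in> tuples (sym_arity s) (alg_hom \<Sigma> B M)"
        and tb: "\<And>b. b \<in> carrier B \<Longrightarrow> compose {..<sym_arity s} (\<lambda>z. z b) t \<in> snd (sym_rel s)"
        unfolding interp_dual_D[OF E B s] by blast+
      have Pt: "compose {..<sym_arity s} P t \<in> tuples (sym_arity s) (alg_hom \<Sigma> A M)"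
        by (rule compose_tuples[OF t]) (use P in blast)
      have "compose {..<sym_arity s} (\<lambda>z. z a) (compose {..<sym_arity s} P t) \<in> snd (sym_rel s)"
        if a: "a \<in> carrier A" for a
      proof -
        have "compose {..<sym_arity s} (\<lambda>z. z a) (compose {..<sym_arity s} P t) =
            compose {..<sym_arity s} (\<lambda>z. z (f a)) t"
          unfolding compose_tuples_assoc by (rule compose_tuples_cong[OF t]) (simp add: P_def a)
        then show ?thesis using tb[OF fB[OF a]] by simp
      qed
      with Pt have "compose {..<sym_arity s} P t \<in> interp (dual_D \<Sigma> M A) s"
        unfolding interp_dual_D[OF E A s] by blast
      then have "compose {..<sym_arity s} w (compose {..<sym_arity s} P t) \<in> snd (sym_rel s)"
        using w' s by blast
      moreover have "compose {..<sym_arity s} w (compose {..<sym_arity s} P t) = compose {..<sym_arity s} ?w t"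
        unfolding compose_tuples_assoc by (rule compose_tuples_cong[OF t]) simp
      ultimately show "compose {..<sym_arity s} ?w t \<in> snd (sym_rel s)" by simp
    qed
    then obtain b where b: "b \<in> carrier B" and wb: "\<And>z. z \<in> alg_hom \<Sigma> B M \<Longrightarrow> ?w z = z b"
      using dB unfolding dualised_at_def by blast
    have "w y = y (g b)" if y: "y \<in> alg_hom \<Sigma> A M" for y
      using wb[OF Q[OF y]] Q[OF y] PQ[OF y] b by (simp add: Q_def)
    with gA[OF b] show "\<exists>a\<in>carrier A. \<forall>z\<in>alg_hom \<Sigma> A M. w z = z a" by blast
  qed
qed

section \<open>Relations as algebras\<close>

definition rel_alg :: "('f, 'a) algebra \<Rightarrow> 'a relsym \<Rightarrow> ('f, nat \<Rightarrow> 'a) algebra" where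
  "rel_alg M r = subalgebra_on (alg_power M {..<arity r}) (snd r)"

text \<open>The coordinate homomorphisms, taken as one tuple of points of D(r). It is generic:
  evaluation at \<open>t\<close> sends it to \<open>t\<close> (\<open>compose_projections\<close>),
  so a suitable map from D(r) to a structure stands for a tuple of that structure in the relation
  \<open>r\<close>.\<close>

definition projections :: "'a relsym \<Rightarrow> nat \<Rightarrow> (nat \<Rightarrow> 'a) \<Rightarrow> 'a" where
  "projections r = (\<lambda>i\<in>{..<arity r}. \<lambda>t\<in>snd r. t i)"

lemma carrier_rel_alg [simp]: "carrier (rel_alg M r) = snd r"
  by (simp add: rel_alg_def)

lemma opr_rel_alg:
  "opr (rel_alg M r) f g = (\<lambda>i\<in>{..<arity r}. opr M f (\<lambda>j\<in>{..<arity f}. g j i))"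
  by (simp add: rel_alg_def alg_power_def)

lemma compatible_rel_subset:
  "compatible_rel \<Sigma> M r \<Longrightarrow> snd r \<subseteq> tuples (arity r) (carrier M)"
  by (simp add: compatible_rel_def subuniverse_def alg_power_def)

lemma rel_alg_algebra:
  assumes "compatible_rel \<Sigma> M r"
  shows "is_algebra \<Sigma> (rel_alg M r)"
  using assms unfolding compatible_rel_def subuniverse_def is_algebra_def rel_alg_def by simp

lemma finite_rel_alg:
  assumes "finite (carrier M)" "compatible_rel \<Sigma> M r"
  shows "finite (carrier (rel_alg M r))"
proof -
  have "finite (tuples (arity r) (carrier M))" by (rule finite_PiE) (simp_all add: assms(1))
  then show ?thesis using compatible_rel_subset[OF assms(2)] by (simp add: finite_subset)
qed

lemma projections_hom:
  assumes r: "compatible_rel \<Sigma> M r"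
  shows "projections r \<in> tuples (arity r) (alg_hom \<Sigma> (rel_alg M r) M)"
  unfolding projections_def
proof (rule restrict_PiE_iff[THEN iffD2], rule ballI)
  fix i assume i: "i \<in> {..<arity r}"
  show "(\<lambda>t\<in>snd r. t i) \<in> alg_hom \<Sigma> (rel_alg M r) M"
    unfolding alg_hom_def mem_Collect_eq carrier_rel_alg
  proof (intro conjI ballI)
    show "(\<lambda>t\<in>snd r. t i) \<in> snd r \<rightarrow>\<^sub>E carrier M"
      using PiE_mem[OF subsetD[OF compatible_rel_subset[OF r]] i] by (simp add: Pi_iff)
    fix f g assume f: "f \<in> \<Sigma>" and g: "g \<in> tuples (arity f) (snd r)"
    have "opr (rel_alg M r) f g \<in> snd r"
      using is_algebraD[OF rel_alg_algebra[OF r] f] g by simp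
    moreover have "(\<lambda>j\<in>{..<arity f}. g j i) = compose {..<arity f} (\<lambda>t\<in>snd r. t i) g"
      using PiE_mem[OF g] by (simp add: compose_def fun_eq_iff)
    ultimately show "(\<lambda>t\<in>snd r. t i) (opr (rel_alg M r) f g) =
        opr M f (compose {..<arity f} (\<lambda>t\<in>snd r. t i) g)"
      using i by (simp add: opr_rel_alg)
  qed
qed

lemma compose_projections:
  assumes r: "compatible_rel \<Sigma> M r" and t: "t \<in> snd r"
  shows "compose {..<arity r} (\<lambda>z. z t) (projections r) = t"
  using subsetD[OF compatible_rel_subset[OF r] t] t
  by (auto simp: compose_def projections_def fun_eq_iff PiE_def extensional_def)

lemma rel_alg_hom_separated:
  assumes r: "compatible_rel \<Sigma> M r"
  shows "hom_separated \<Sigma> M (rel_alg M r)"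
  unfolding hom_separated_def carrier_rel_alg
proof (intro ballI impI)
  fix s t assume st: "s \<in> snd r" "t \<in> snd r" and eq: "\<forall>z\<in>alg_hom \<Sigma> (rel_alg M r) M. z s = z t"
  have "compose {..<arity r} (\<lambda>z. z s) (projections r) = compose {..<arity r} (\<lambda>z. z t) (projections r)"
    by (rule compose_tuples_cong[OF projections_hom[OF r]]) (use eq in blast)
  then show "s = t" unfolding compose_projections[OF r st(1)] compose_projections[OF r st(2)] .
qed

lemma finite_alg_hom:
  assumes "finite (carrier A)" "finite (carrier M)"
  shows "finite (alg_hom \<Sigma> A M)"
proof (rule finite_subset)
  show "alg_hom \<Sigma> A M \<subseteq> carrier A \<rightarrow>\<^sub>E carrier M" using alg_homD(1) by fast
  show "finite (carrier A \<rightarrow>\<^sub>E carrier M)" using assms by (intro finite_PiE) simp_all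
qed

text \<open>Although the signature may be infinite, finitely many facts about \<open>D(r)\<close> force a map on its
  points to be evaluation at an element of \<open>r\<close>.\<close>

lemma finite_presentation:
  assumes E: "is_alter_ego \<Sigma> M E" and finM: "finite (carrier M)" and r: "compatible_rel \<Sigma> M r"
    and dual: "dualised_at \<Sigma> M E (rel_alg M r)"
  obtains I where "finite I"
    and "\<And>s q. (s, q) \<in> I \<Longrightarrow> s \<in> syms E \<and> q \<in> interp (dual_D \<Sigma> M (rel_alg M r)) s"
    and "\<And>w. w \<in> alg_hom \<Sigma> (rel_alg M r) M \<rightarrow> carrier M \<Longrightarrow>
      (\<And>s q. (s, q) \<in> I \<Longrightarrow> compose {..<sym_arity s} w q \<in> snd (sym_rel s)) \<Longrightarrow>
      compose {..<arity r} w (projections r) \<in> snd r"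
proof -
  let ?A = "rel_alg M r" and ?H = "alg_hom \<Sigma> (rel_alg M r) M"
  let ?D = "dual_D \<Sigma> M ?A"
  note A = rel_alg_algebra[OF r] and finA = finite_rel_alg[OF finM r]
  \<comment> \<open>\<open>r\<close> and \<open>M\<close> are finite, so only finitely many maps
    from D(r) to \<open>M\<close> fail to be morphisms; one violated fact is recorded for
    each.\<close>
  define bad where "bad = (?H \<rightarrow>\<^sub>E carrier M) - mor E ?D (ego_struct M)"
  have "finite bad" unfolding bad_def
    using finite_alg_hom[OF finA finM] finM by (intro finite_Diff finite_PiE) simp_all
  have "\<exists>p. fst p \<in> syms E \<and> snd p \<in> interp ?D (fst p) \<and>
      compose {..<sym_arity (fst p)} w (snd p) \<notin> snd (sym_rel (fst p))" if "w \<in> bad" for w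
  proof -
    from that obtain s q where "s \<in> syms E" "q \<in> interp ?D s" "compose {..<sym_arity s} w q \<notin> snd (sym_rel s)"
      unfolding bad_def Diff_iff mor_dual_D_finite_iff[OF E A finA] by blast
    then show ?thesis by (intro exI[of _ "(s, q)"]) simp
  qed
  then obtain wit where wit: "\<And>w. w \<in> bad \<Longrightarrow> fst (wit w) \<in> syms E \<and>
      snd (wit w) \<in> interp ?D (fst (wit w)) \<and>
      compose {..<sym_arity (fst (wit w))} w (snd (wit w)) \<notin> snd (sym_rel (fst (wit w)))" by metis
  show thesis
  proof (rule that[of "wit ` bad"])
    show "finite (wit ` bad)" using \<open>finite bad\<close> by simp
    show I: "s \<in> syms E \<and> q \<in> interp ?D s" if "(s, q) \<in> wit ` bad" for s q
    proof -
      from that obtain w where w: "w \<in> bad" and eq: "(s, q) = wit w" by blast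
      from wit[OF w] show ?thesis unfolding eq[symmetric] by simp
    qed
    fix w assume w: "w \<in> ?H \<rightarrow> carrier M"
      and pres: "\<And>s q. (s, q) \<in> wit ` bad \<Longrightarrow> compose {..<sym_arity s} w q \<in> snd (sym_rel s)"
    let ?w = "restrict w ?H"
    have ww: "compose {..<n} ?w q = compose {..<n} w q" if "q \<in> tuples n ?H" for n q
      by (rule compose_tuples_cong[OF that]) simp
    have "?w \<notin> bad"
    proof
      assume b: "?w \<in> bad"
      let ?s = "fst (wit ?w)" and ?q = "snd (wit ?w)"
      have "(?s, ?q) \<in> wit ` bad" using b by simp
      moreover from I[OF this] have "?q \<in> tuples (sym_arity ?s) ?H"
        using interp_dual_D[OF E A] by blast
      ultimately show False using pres wit[OF b] ww by metis
    qed
    moreover have "?w \<in> ?H \<rightarrow>\<^sub>E carrier M" using w by simp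
    ultimately have "?w \<in> mor E ?D (ego_struct M)" unfolding bad_def by blast
    \<comment> \<open>Not being bad, the map is a morphism and so, by duality, evaluation at an
      element \<open>a\<close> of \<open>r\<close>; the projections are then sent to
      \<open>a\<close>.\<close>
    then obtain a where a: "a \<in> snd r" and wa: "\<And>z. z \<in> ?H \<Longrightarrow> ?w z = z a"
      using dual unfolding dualised_at_def by auto
    have "compose {..<arity r} w (projections r) = compose {..<arity r} (\<lambda>z. z a) (projections r)"
      by (rule compose_tuples_cong[OF projections_hom[OF r]]) (use wa in simp)
    then show "compose {..<arity r} w (projections r) \<in> snd r"
      using a compose_projections[OF r a] by simp
  qed
qed

section \<open>Compatible relations outside the signature, carried by a represented
  structure\<close>

section \<open>Relations induced on a structure by its morphisms\<close>

text \<open>The largest relation on \<open>X\<close> that all morphisms map into \<open>r\<close>.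
  Here \<open>r\<close> need not be a symbol of \<open>E\<close>, so a structure for
  \<open>E\<close> can interpret the symbols of another alter ego.\<close>

definition ext_rel ::
    "('f, 'a) algebra \<Rightarrow> 'a alter_ego \<Rightarrow> ('a, 'x) tstruct \<Rightarrow> 'a relsym \<Rightarrow> (nat \<Rightarrow> 'x) set" where
  "ext_rel M E X r = {t \<in> tuples (arity r) (points X).
     \<forall>u\<in>mor E X (ego_struct M). compose {..<arity r} u t \<in> snd r}"

text \<open>Sending \<open>u\<close> to the image of \<open>t\<close> under \<open>u\<close> is a
  homomorphism from E(X) to the algebra of \<open>r\<close>, because E(X) has pointwise operations;
  \<open>z\<close> is composed with it.\<close>

lemma ext_rel_hom:
  assumes M: "is_algebra \<Sigma> M" and E: "is_alter_ego \<Sigma> M E" and X: "wf_struct E X"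
    and r: "compatible_rel \<Sigma> M r" and t: "t \<in> ext_rel M E X r" and z: "z \<in> alg_hom \<Sigma> (rel_alg M r) M"
  shows "(\<lambda>u\<in>mor E X (ego_struct M). z (compose {..<arity r} u t)) \<in> alg_hom \<Sigma> (dual_E M E X) M"
  unfolding alg_hom_def[of \<Sigma> "dual_E M E X" M] mem_Collect_eq carrier_dual_E
proof (intro conjI ballI)
  let ?U = "mor E X (ego_struct M)"
  have tr: "compose {..<arity r} u t \<in> snd r" if "u \<in> ?U" for u
    using t that unfolding ext_rel_def by blast
  have tX: "t \<in> tuples (arity r) (points X)" using t unfolding ext_rel_def by blast
  show "(\<lambda>u\<in>?U. z (compose {..<arity r} u t)) \<in> ?U \<rightarrow>\<^sub>E carrier M"
    using PiE_mem[OF alg_homD(1)[OF z]] tr by (simp add: Pi_iff)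
  fix f us assume f: "f \<in> \<Sigma>" and us: "us \<in> tuples (arity f) ?U"
  let ?w = "opr (dual_E M E X) f us"
  let ?g = "\<lambda>j\<in>{..<arity f}. compose {..<arity r} (us j) t"
  have w: "?w \<in> ?U" unfolding opr_dual_E by (rule mor_opr_closed[OF M E X f us])
  have g: "?g \<in> tuples (arity f) (carrier (rel_alg M r))"
    using tr PiE_mem[OF us] by (simp add: restrict_PiE_iff)
  have "compose {..<arity r} ?w t = opr (rel_alg M r) f ?g"
  proof
    fix i
    show "compose {..<arity r} ?w t i = opr (rel_alg M r) f ?g i"
      using PiE_mem[OF tX, of i]
      by (simp add: opr_rel_alg opr_dual_E compose_def cong: restrict_cong)
  qed
  moreover have "compose {..<arity f} z ?g =
      compose {..<arity f} (\<lambda>u\<in>?U. z (compose {..<arity r} u t)) us"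
    using PiE_mem[OF us] by (simp add: compose_def fun_eq_iff)
  ultimately show "(\<lambda>u\<in>?U. z (compose {..<arity r} u t)) ?w =
      opr M f (compose {..<arity f} (\<lambda>u\<in>?U. z (compose {..<arity r} u t)) us)"
    using alg_homD(2)[OF z f g] w by simp
qed

text \<open>The point obtained plays the role of \<open>z\<close> applied to \<open>t\<close>:
  homomorphisms from \<open>r\<close> to \<open>M\<close> act as operations on the tuples in
  \<open>ext_rel\<close>.\<close>

lemma represented_point:
  assumes M: "is_algebra \<Sigma> M" and E: "is_alter_ego \<Sigma> M E" and X: "wf_struct E X"
    and rep: "represented \<Sigma> M E X" and r: "compatible_rel \<Sigma> M r" and t: "t \<in> ext_rel M E X r"
    and z: "z \<in> alg_hom \<Sigma> (rel_alg M r) M"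
  obtains x where "x \<in> points X"
    "\<And>u. u \<in> mor E X (ego_struct M) \<Longrightarrow> u x = z (compose {..<arity r} u t)"
proof -
  obtain x where x: "x \<in> points X" and ux: "\<And>u. u \<in> mor E X (ego_struct M) \<Longrightarrow>
      (\<lambda>u\<in>mor E X (ego_struct M). z (compose {..<arity r} u t)) u = u x"
    using bspec[OF rep[unfolded represented_def] ext_rel_hom[OF M E X r t z]] by blast
  show thesis
  proof (rule that[OF x])
    show "u x = z (compose {..<arity r} u t)" if "u \<in> mor E X (ego_struct M)" for u
      using ux[OF that] that by simp
  qed
qed

text \<open>On \<open>M\<close> the domain of \<open>h\<close> is a compatible relation and
  \<open>h\<close> is a homomorphism from it to \<open>M\<close>. \<open>represented_point\<close>,
  applied to this homomorphism and \<open>x\<close>, gives the value that \<open>h\<close> should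
  take at \<open>x\<close>. Separation alone would not provide it, since \<open>h\<close> need not
  be a symbol of \<open>E\<close>.\<close>

lemma represented_pop_value:
  assumes M: "is_algebra \<Sigma> M" and E: "is_alter_ego \<Sigma> M E" and X: "wf_struct E X"
    and rep: "represented \<Sigma> M E X" and E': "is_alter_ego \<Sigma> M E'" and h: "h \<in> pops E'"
    and x: "x \<in> tuples (arity h) (points X)" and U: "mor E X (ego_struct M) \<noteq> {}"
    and d: "\<And>u. u \<in> mor E X (ego_struct M) \<Longrightarrow> compose {..<arity h} u x \<in> dom (snd h)"
  obtains y where "y \<in> points X" "x(arity h := y) \<in> ext_rel M E X (Suc (arity h), pop_graph h)"
proof -
  let ?n = "arity h" and ?U = "mor E X (ego_struct M)"
  define r where "r = (?n, dom (snd h))"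
  have s: "Inl h \<in> syms E'" using h unfolding syms_def by blast
  note g = compatible_sym_rel[OF E' s]
  have dsub: "dom (snd h) \<subseteq> tuples ?n (carrier M)"
    using E' h unfolding is_alter_ego_def compatible_pop_def by blast
  \<comment> \<open>Closure of the graph under \<open>f\<close> says two things at once: the domain
    is closed under \<open>f\<close>, and \<open>h\<close> commutes with \<open>f\<close> on
    it.\<close>
  have op: "opr (alg_power M {..<?n}) f ts \<in> dom (snd h) \<and>
      snd h (opr (alg_power M {..<?n}) f ts) = Some (opr M f (compose {..<arity f} (\<lambda>t. the (snd h t)) ts))"
    if f: "f \<in> \<Sigma>" and ts: "ts \<in> tuples (arity f) (dom (snd h))" for f ts
  proof -
    let ?g = "\<lambda>j. (ts j)(?n := the (snd h (ts j)))"
    have "?g j \<in> pop_graph h" if "j < arity f" for j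
    proof -
      from PiE_mem[OF ts, of j] that obtain b where "snd h (ts j) = Some b" by auto
      then show ?thesis unfolding pop_graph_def by fastforce
    qed
    then have "(\<lambda>i\<in>{..<Suc ?n}. opr M f (\<lambda>j\<in>{..<arity f}. ?g j i)) \<in> pop_graph h"
      using compatible_rel_opr[OF g f, of ?g] by simp
    also have "(\<lambda>i\<in>{..<Suc ?n}. opr M f (\<lambda>j\<in>{..<arity f}. ?g j i)) =
      (opr (alg_power M {..<?n}) f ts)(?n := opr M f (compose {..<arity f} (\<lambda>t. the (snd h t)) ts))"
    proof
      fix i
      consider "i < ?n" | "i = ?n" | "i > ?n" by linarith
      then show "(\<lambda>i\<in>{..<Suc ?n}. opr M f (\<lambda>j\<in>{..<arity f}. ?g j i)) i =
        ((opr (alg_power M {..<?n}) f ts)(?n := opr M f (compose {..<arity f} (\<lambda>t. the (snd h t)) ts))) i"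
        by cases (simp_all add: alg_power_def compose_def)
    qed
    finally have "snd h (opr (alg_power M {..<?n}) f ts) =
        Some (opr M f (compose {..<arity f} (\<lambda>t. the (snd h t)) ts))"
      by (subst (asm) sym_rel_upd_iff[OF E' h, where A = UNIV]) (simp_all add: alg_power_def)
    then show ?thesis by blast
  qed
  \<comment> \<open>Compatible relations are non-empty by definition; the image of \<open>x\<close>
    under one morphism supplies an element of the domain.\<close>
  obtain u0 where "u0 \<in> ?U" using U by blast
  with d have "dom (snd h) \<noteq> {}" by blast
  with dsub op have r: "compatible_rel \<Sigma> M r"
    unfolding compatible_rel_def subuniverse_def r_def fst_conv snd_conv by (simp add: alg_power_def)
  have z: "(\<lambda>t\<in>dom (snd h). the (snd h t)) \<in> alg_hom \<Sigma> (rel_alg M r) M"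
    unfolding alg_hom_def mem_Collect_eq carrier_rel_alg
  proof (intro conjI ballI)
    have "the (snd h t) \<in> carrier M" if "t \<in> dom (snd h)" for t
    proof -
      from that obtain b where b: "snd h t = Some b" by blast
      then show ?thesis using wf_struct_popD(2)[OF wf_struct_ego[OF E'] h, of t b]
        by (simp add: ego_struct_def)
    qed
    then show "(\<lambda>t\<in>dom (snd h). the (snd h t)) \<in> snd r \<rightarrow>\<^sub>E carrier M"
      unfolding r_def by (simp add: Pi_iff)
    fix f ts assume f: "f \<in> \<Sigma>" and "ts \<in> tuples (arity f) (snd r)"
    then have ts: "ts \<in> tuples (arity f) (dom (snd h))" by (simp add: r_def)
    have "compose {..<arity f} (\<lambda>t\<in>dom (snd h). the (snd h t)) ts = compose {..<arity f} (\<lambda>t. the (snd h t)) ts"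
      by (rule compose_tuples_cong[OF ts]) simp
    moreover have "opr (rel_alg M r) f ts = opr (alg_power M {..<?n}) f ts"
      by (simp add: rel_alg_def r_def)
    ultimately show "(\<lambda>t\<in>dom (snd h). the (snd h t)) (opr (rel_alg M r) f ts) =
        opr M f (compose {..<arity f} (\<lambda>t\<in>dom (snd h). the (snd h t)) ts)"
      using op[OF f ts] by simp
  qed
  have "x \<in> ext_rel M E X r" using x d unfolding ext_rel_def r_def by simp
  then obtain y where y: "y \<in> points X"
    and uy: "\<And>u. u \<in> ?U \<Longrightarrow> u y = (\<lambda>t\<in>dom (snd h). the (snd h t)) (compose {..<arity r} u x)"
    using represented_point[OF M E X rep r _ z] by blast
  have "compose {..<Suc ?n} u (x(?n := y)) \<in> pop_graph h" if u: "u \<in> ?U" for u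
  proof -
    have "snd h (compose {..<?n} u x) = Some (u y)"
      using uy[OF u] d[OF u] by (auto simp: r_def)
    then show ?thesis unfolding compose_tuple_upd pop_graph_def by blast
  qed
  then have "x(?n := y) \<in> ext_rel M E X (Suc ?n, pop_graph h)"
    using tuple_upd_in[OF x y] unfolding ext_rel_def by simp
  with y show thesis by (rule that)
qed

text \<open>\<open>g z\<close> is the point that represents \<open>z\<close> applied to
  \<open>t\<close>. For each morphism \<open>u\<close>, following \<open>g\<close> by
  \<open>u\<close> is evaluation at the image of \<open>t\<close>, an element of \<open>r\<close>.
  Evaluations preserve all symbols and send the projections to that image; separation lifts both
  statements from \<open>M\<close> to \<open>X\<close>.\<close>

lemma point_map:
  assumes M: "is_algebra \<Sigma> M" and E: "is_alter_ego \<Sigma> M E" and sX: "separated M E X"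
    and rep: "represented \<Sigma> M E X" and r: "compatible_rel \<Sigma> M r" and t: "t \<in> ext_rel M E X r"
  obtains g where "g \<in> alg_hom \<Sigma> (rel_alg M r) M \<rightarrow> points X"
    and "\<And>s q. s \<in> syms E \<Longrightarrow> q \<in> interp (dual_D \<Sigma> M (rel_alg M r)) s \<Longrightarrow>
      compose {..<sym_arity s} g q \<in> interp X s"
    and "compose {..<arity r} g (projections r) = t"
proof -
  let ?H = "alg_hom \<Sigma> (rel_alg M r) M" and ?U = "mor E X (ego_struct M)"
  have X: "wf_struct E X" and U: "separated_by M E X ?U"
    using sX boolean_struct_wf unfolding separated_def by blast+
  have tX: "t \<in> tuples (arity r) (points X)" and tr: "\<And>u. u \<in> ?U \<Longrightarrow> compose {..<arity r} u t \<in> snd r"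
    using t unfolding ext_rel_def by blast+
  have "\<exists>x. x \<in> points X \<and> (\<forall>u\<in>?U. u x = z (compose {..<arity r} u t))" if "z \<in> ?H" for z
    by (rule represented_point[OF M E X rep r t that]) blast
  then obtain g where g: "\<And>z. z \<in> ?H \<Longrightarrow> g z \<in> points X"
      "\<And>z u. z \<in> ?H \<Longrightarrow> u \<in> ?U \<Longrightarrow> u (g z) = z (compose {..<arity r} u t)" by metis
  have gX: "g \<in> ?H \<rightarrow> points X" using g(1) by blast
  have ug: "compose {..<n} u (compose {..<n} g q) = compose {..<n} (\<lambda>z. z (compose {..<arity r} u t)) q"
    if "q \<in> tuples n ?H" "u \<in> ?U" for n q u
    unfolding compose_tuples_assoc by (rule compose_tuples_cong[OF that(1)]) (simp add: g(2) that(2))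
  have "compose {..<sym_arity s} g q \<in> interp X s"
    if s: "s \<in> syms E" and "q \<in> interp (dual_D \<Sigma> M (rel_alg M r)) s" for s q
  proof -
    have q: "q \<in> tuples (sym_arity s) ?H"
      and qa: "\<And>a. a \<in> snd r \<Longrightarrow> compose {..<sym_arity s} (\<lambda>z. z a) q \<in> snd (sym_rel s)"
      using that(2) unfolding interp_dual_D[OF E rel_alg_algebra[OF r] s] carrier_rel_alg by blast+
    show ?thesis
      by (rule separated_by_interp[OF E X U s compose_tuples[OF q gX]]) (simp add: ug[OF q] qa tr)
  qed
  moreover have "compose {..<arity r} g (projections r) = t"
  proof (rule PiE_ext[OF compose_tuples[OF projections_hom[OF r] gX] tX])
    fix i assume i: "i \<in> {..<arity r}"
    show "compose {..<arity r} g (projections r) i = t i"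
    proof (rule separated_byD(3)[OF U])
      show "compose {..<arity r} g (projections r) i \<in> points X"
        by (rule PiE_mem[OF compose_tuples[OF projections_hom[OF r] gX] i])
      show "t i \<in> points X" by (rule PiE_mem[OF tX i])
      fix u assume u: "u \<in> ?U"
      have "compose {..<arity r} u (compose {..<arity r} g (projections r)) = compose {..<arity r} u t"
        unfolding ug[OF projections_hom[OF r] u] by (rule compose_projections[OF r tr[OF u]])
      from fun_cong[OF this, of i] i show "u (compose {..<arity r} g (projections r) i) = u (t i)"
        by (simp add: compose_def)
    qed
  qed
  ultimately show thesis using gX that by blast
qed

section \<open>Structures given by relations\<close>

text \<open>All symbols are given by relations, the graph of \<open>h\<close> under the key
  \<open>(Suc (arity h), pop_graph h)\<close>. Under \<open>functional_rels\<close> the choice by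
  \<open>SOME\<close> is the only possible value.\<close>

definition rel_struct :: "'x topology \<Rightarrow> ('a relsym \<Rightarrow> (nat \<Rightarrow> 'x) set) \<Rightarrow> ('a, 'x) tstruct" where
  "rel_struct T R =
     \<lparr>space = T,
      pop = \<lambda>h x.
        if x \<in> tuples (arity h) (topspace T) \<and> (\<exists>y. x(arity h := y) \<in> R (Suc (arity h), pop_graph h))
        then Some (SOME y. x(arity h := y) \<in> R (Suc (arity h), pop_graph h)) else None,
      rel = R\<rparr>"

definition functional_rels ::
    "'a alter_ego \<Rightarrow> 'x topology \<Rightarrow> ('a relsym \<Rightarrow> (nat \<Rightarrow> 'x) set) \<Rightarrow> bool" where
  "functional_rels E T R \<longleftrightarrow>
     (\<forall>s\<in>syms E. R (sym_rel s) \<subseteq> tuples (sym_arity s) (topspace T)) \<and>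
     (\<forall>h\<in>pops E. \<forall>x\<in>tuples (arity h) (topspace T). \<forall>y y'.
        x(arity h := y) \<in> R (Suc (arity h), pop_graph h) \<longrightarrow>
        x(arity h := y') \<in> R (Suc (arity h), pop_graph h) \<longrightarrow> y = y')"

lemma space_rel_struct [simp]: "space (rel_struct T R) = T"
  by (simp add: rel_struct_def)

lemma pop_rel_struct:
  assumes R: "functional_rels E T R" and h: "h \<in> pops E"
  shows "pop (rel_struct T R) h x = Some y \<longleftrightarrow>
    x \<in> tuples (arity h) (topspace T) \<and> x(arity h := y) \<in> R (Suc (arity h), pop_graph h)"
proof -
  let ?P = "\<lambda>y. x(arity h := y) \<in> R (Suc (arity h), pop_graph h)"
  have "y = y'" if "x \<in> tuples (arity h) (topspace T)" "?P y" "?P y'" for y y'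
    using R h that unfolding functional_rels_def by blast
  then have "(SOME y. ?P y) = y \<longleftrightarrow> ?P y" if "x \<in> tuples (arity h) (topspace T)" "\<exists>y. ?P y"
    using that someI_ex[OF that(2)] by blast
  then show ?thesis by (auto simp: rel_struct_def)
qed

lemma interp_rel_struct:
  assumes R: "functional_rels E T R" and s: "s \<in> syms E"
  shows "interp (rel_struct T R) s = R (sym_rel s)"
proof (cases s)
  case (Inr \<rho>)
  then show ?thesis by (simp add: rel_struct_def)
next
  case (Inl h)
  have h: "h \<in> pops E" using s unfolding Inl syms_def by blast
  have sub: "R (Suc (arity h), pop_graph h) \<subseteq> tuples (Suc (arity h)) (topspace T)"
    using R s unfolding functional_rels_def Inl by force
  have "t \<in> interp (rel_struct T R) (Inl h)" if t: "t \<in> R (Suc (arity h), pop_graph h)" for t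
  proof -
    from subsetD[OF sub t] obtain x y where x: "x \<in> tuples (arity h) (topspace T)" and "t = x(arity h := y)"
      by (rule tuple_Suc_cases)
    with t have "pop (rel_struct T R) h x = Some y" using pop_rel_struct[OF R h] by blast
    with \<open>t = x(arity h := y)\<close> show ?thesis unfolding interp.simps by blast
  qed
  then show ?thesis unfolding Inl using pop_rel_struct[OF R h] by auto
qed

lemma wf_rel_struct:
  assumes R: "functional_rels E T R"
  shows "wf_struct E (rel_struct T R)"
  unfolding wf_struct_def
proof (intro conjI ballI subsetI)
  fix h x assume h: "h \<in> pops E"
  { assume "x \<in> dom (pop (rel_struct T R) h)"
    then show "x \<in> tuples (arity h) (points (rel_struct T R))"
      using pop_rel_struct[OF R h] unfolding space_rel_struct by blast }
next
  fix h y assume h: "h \<in> pops E" and "y \<in> ran (pop (rel_struct T R) h)"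
  then obtain x where "x(arity h := y) \<in> R (Suc (arity h), pop_graph h)"
    using pop_rel_struct[OF R h] unfolding ran_def by blast
  moreover have "Inl h \<in> syms E" using h unfolding syms_def by blast
  then have "R (Suc (arity h), pop_graph h) \<subseteq> tuples (Suc (arity h)) (topspace T)"
    using R unfolding functional_rels_def by force
  ultimately have "x(arity h := y) \<in> tuples (Suc (arity h)) (topspace T)" by blast
  from PiE_mem[OF this, of "arity h"] show "y \<in> points (rel_struct T R)" by simp
next
  fix \<rho> t assume "\<rho> \<in> rels E" and t: "t \<in> rel (rel_struct T R) \<rho>"
  then have "Inr \<rho> \<in> syms E" unfolding syms_def by blast
  with R have "R (sym_rel (Inr \<rho>)) \<subseteq> tuples (sym_arity (Inr \<rho>)) (topspace T)"
    unfolding functional_rels_def by blast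
  then show "t \<in> tuples (arity \<rho>) (points (rel_struct T R))"
    using t by (auto simp: rel_struct_def)
qed

lemma boolean_rel_struct:
  assumes T: "compact_space T" "Hausdorff_space T" "totally_disconnected T"
    and R: "functional_rels E T R"
    and cl: "\<And>s. s \<in> syms E \<Longrightarrow> closedin (tuple_space (sym_arity s) T) (R (sym_rel s))"
  shows "boolean_struct E (rel_struct T R)"
proof -
  let ?Y = "rel_struct T R"
  have "closedin (tuple_space (arity h) T) (dom (pop ?Y h)) \<and>
      continuous_map (subtopology (tuple_space (arity h) T) (dom (pop ?Y h))) T (\<lambda>x. the (pop ?Y h x))"
    if h: "h \<in> pops E" for h
  proof -
    have s: "Inl h \<in> syms E" using h unfolding syms_def by blast
    have "{x(arity h := the (pop ?Y h x)) |x. x \<in> dom (pop ?Y h)} = interp ?Y (Inl h)"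
      by force
    then have c: "closedin (tuple_space (Suc (arity h)) T) {x(arity h := the (pop ?Y h x)) |x. x \<in> dom (pop ?Y h)}"
      using cl[OF s] interp_rel_struct[OF R s] by simp
    have d: "dom (pop ?Y h) \<subseteq> tuples (arity h) (topspace T)"
      using wf_rel_struct[OF R] h unfolding wf_struct_def by simp
    show ?thesis
      by (intro conjI continuous_map_of_closed_graph(1)[OF T(1,2) c d]
          continuous_map_of_closed_graph(2)[OF T(1,2) c d])
  qed
  moreover have "closedin (tuple_space (arity \<rho>) T) (rel ?Y \<rho>)" if "\<rho> \<in> rels E" for \<rho>
  proof -
    have "Inr \<rho> \<in> syms E" using that unfolding syms_def by blast
    from cl[OF this] show ?thesis by (simp add: rel_struct_def)
  qed
  ultimately show ?thesis using T unfolding boolean_struct_def by simp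
qed

text \<open>Graphs on \<open>M\<close> are single-valued, so every morphism identifies two values at
  the same arguments, and separation makes them equal.\<close>

lemma functional_ext_rel:
  assumes E: "is_alter_ego \<Sigma> M E" and U: "separated_by M E X (mor E X (ego_struct M))"
    and E': "is_alter_ego \<Sigma> M E'"
  shows "functional_rels E' (space X) (ext_rel M E X)"
  unfolding functional_rels_def
proof (intro conjI ballI allI impI)
  show "ext_rel M E X (sym_rel s) \<subseteq> tuples (sym_arity s) (points X)" for s :: "'b sym"
    unfolding ext_rel_def by blast
  fix h x y y' assume h: "h \<in> pops E'" and x: "x \<in> tuples (arity h) (points X)"
    and y: "x(arity h := y) \<in> ext_rel M E X (Suc (arity h), pop_graph h)"
    and y': "x(arity h := y') \<in> ext_rel M E X (Suc (arity h), pop_graph h)"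
  have in_points: "z \<in> points X" if "x(arity h := z) \<in> ext_rel M E X (Suc (arity h), pop_graph h)" for z
  proof -
    have "x(arity h := z) \<in> tuples (Suc (arity h)) (points X)" using that unfolding ext_rel_def by simp
    from PiE_mem[OF this, of "arity h"] show ?thesis by simp
  qed
  have val: "snd h (compose {..<arity h} u x) = Some (u z)"
    if "x(arity h := z) \<in> ext_rel M E X (Suc (arity h), pop_graph h)" "u \<in> mor E X (ego_struct M)" for u z
  proof -
    have "(compose {..<arity h} u x)(arity h := u z) \<in> pop_graph h"
      using that unfolding ext_rel_def by (simp add: compose_tuple_upd)
    then show ?thesis
      using sym_rel_upd_iff[OF E' h compose_tuples[OF x morD(2)[OF that(2)]]] by simp
  qed
  show "y = y'"
    by (rule separated_byD(3)[OF U in_points[OF y] in_points[OF y']])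
       (use val[OF y] val[OF y'] in fastforce)
qed

text \<open>Relations are reflected by the very definition of \<open>ext_rel\<close>; for domains,
  \<open>represented_pop_value\<close> supplies the missing value.\<close>

lemma separated_by_ext_rel:
  assumes M: "is_algebra \<Sigma> M" and E: "is_alter_ego \<Sigma> M E" and sX: "separated M E X"
    and rep: "represented \<Sigma> M E X" and E': "is_alter_ego \<Sigma> M E'"
  shows "separated_by M E' (rel_struct (space X) (ext_rel M E X)) (mor E X (ego_struct M))"
proof (rule separated_byI)
  let ?U = "mor E X (ego_struct M)" and ?X = "rel_struct (space X) (ext_rel M E X)"
  have X: "wf_struct E X" and U: "separated_by M E X ?U"
    using sX boolean_struct_wf unfolding separated_def by blast+
  note R = functional_ext_rel[OF E U E']
  show "?U \<noteq> {}" by (rule separated_byD(1)[OF U])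
  show "u \<in> mor E' ?X (ego_struct M)" if u: "u \<in> ?U" for u
    unfolding mor_ego_iff[OF E' wf_rel_struct[OF R]]
  proof (intro conjI ballI)
    show "u \<in> points ?X \<rightarrow>\<^sub>E carrier M" using mor_egoD[OF u] by simp
    show "continuous_map (space ?X) (discrete_topology (carrier M)) u"
      using u unfolding mor_ego_iff[OF E X] by simp
    fix s t assume "s \<in> syms E'" and "t \<in> interp ?X s"
    then show "compose {..<sym_arity s} u t \<in> snd (sym_rel s)"
      using u interp_rel_struct[OF R] unfolding ext_rel_def by blast
  qed
  show "x = y" if "x \<in> points ?X" "y \<in> points ?X" "\<And>u. u \<in> ?U \<Longrightarrow> u x = u y" for x y
    using that by (intro separated_byD(3)[OF U]) simp_all
  fix h x assume h: "h \<in> pops E'" and "x \<in> tuples (arity h) (points ?X)"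
    and d: "\<And>u. u \<in> ?U \<Longrightarrow> compose {..<arity h} u x \<in> dom (snd h)"
  then have x: "x \<in> tuples (arity h) (points X)" by simp
  obtain y where "x(arity h := y) \<in> ext_rel M E X (Suc (arity h), pop_graph h)"
    using represented_pop_value[OF M E X rep E' h x separated_byD(1)[OF U] d] by blast
  with x have "pop ?X h x = Some y" using pop_rel_struct[OF R h] by blast
  then show "x \<in> dom (pop ?X h)" by blast
next
  fix \<rho> x assume "x \<in> tuples (arity \<rho>) (points (rel_struct (space X) (ext_rel M E X)))"
    and "\<And>u. u \<in> mor E X (ego_struct M) \<Longrightarrow> compose {..<arity \<rho>} u x \<in> snd \<rho>"
  then show "x \<in> rel (rel_struct (space X) (ext_rel M E X)) \<rho>"
    by (simp add: rel_struct_def ext_rel_def)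
qed

text \<open>The algebra \<open>E(X)\<close> is finite, so it is dualised by \<open>E'\<close>; a morphism into \<open>M\<close> for the
  signature of \<open>E'\<close> is an evaluation on \<open>D(E(X))\<close> and hence belongs to \<open>E(X)\<close>.\<close>

lemma mor_ext_rel_finite:
  assumes M: "is_algebra \<Sigma> M" and finM: "finite (carrier M)"
    and E: "is_alter_ego \<Sigma> M E" and sX: "separated M E X"
    and rep: "represented \<Sigma> M E X" and E': "is_alter_ego \<Sigma> M E'" and finX: "finite (points X)"
    and dual: "\<And>A :: ('f, 'x \<Rightarrow> 'a) algebra. is_algebra \<Sigma> A \<Longrightarrow> finite (carrier A) \<Longrightarrow>
      hom_separated \<Sigma> M A \<Longrightarrow> dualised_at \<Sigma> M E' A"
  shows "mor E' (rel_struct (space X) (ext_rel M E (X :: ('a, 'x) tstruct))) (ego_struct M)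
    = mor E X (ego_struct (M :: ('f, 'a) algebra))"
proof
  let ?U = "mor E X (ego_struct M)" and ?X = "rel_struct (space X) (ext_rel M E X)"
  note sby = separated_by_ext_rel[OF M E sX rep E']
  show "?U \<subseteq> mor E' ?X (ego_struct M)" using separated_byD(2)[OF sby] by blast
  have X: "wf_struct E X" and U: "separated_by M E X ?U"
    using sX boolean_struct_wf unfolding separated_def by blast+
  note R = functional_ext_rel[OF E U E']
  let ?A = "dual_E M E X"
  have A: "is_algebra \<Sigma> ?A"
    unfolding is_algebra_def carrier_dual_E opr_dual_E
    using separated_byD(1)[OF U] mor_opr_closed[OF M E X] by blast
  have finA: "finite (carrier ?A)"
  proof (rule finite_subset)
    show "carrier ?A \<subseteq> points X \<rightarrow>\<^sub>E carrier M" using mor_egoD by fastforce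
    show "finite (points X \<rightarrow>\<^sub>E carrier M)" using finX finM by (intro finite_PiE) simp_all
  qed
  have ev: "eval_struct M E X x u = u x" if "x \<in> points X" "u \<in> ?U" for x u
    using that by (simp add: eval_struct_def)
  have "hom_separated \<Sigma> M ?A"
    unfolding hom_separated_def carrier_dual_E
  proof (intro ballI impI)
    fix a b assume ab: "a \<in> ?U" "b \<in> ?U" and eq: "\<forall>z\<in>alg_hom \<Sigma> ?A M. z a = z b"
    show "a = b"
    proof (rule PiE_ext[OF mor_egoD[OF ab(1)] mor_egoD[OF ab(2)]])
      fix x assume x: "x \<in> points X"
      from eq eval_struct_hom[OF M E X x] have "eval_struct M E X x a = eval_struct M E X x b" by blast
      then show "a x = b x" using ev[OF x] ab by simp
    qed
  qed
  with A finA have dA: "dualised_at \<Sigma> M E' ?A" by (rule dual)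
  \<comment> \<open>\<open>g\<close> inverts \<open>eval_struct\<close>: it picks the point at which
    a homomorphism on E(X) is evaluation. A map on \<open>X\<close> is moved to D(E(X)) by composing
    it with \<open>g\<close>.\<close>
  obtain g where gX: "\<And>z. z \<in> alg_hom \<Sigma> ?A M \<Longrightarrow> g z \<in> points X"
    and g: "\<And>z u. z \<in> alg_hom \<Sigma> ?A M \<Longrightarrow> u \<in> ?U \<Longrightarrow> z u = u (g z)"
    using rep unfolding represented_def by metis
  show "mor E' ?X (ego_struct M) \<subseteq> ?U"
  proof
    fix u assume u: "u \<in> mor E' ?X (ego_struct M)"
    have uX: "u \<in> points X \<rightarrow>\<^sub>E carrier M" using mor_egoD[OF u] by simp
    let ?w = "\<lambda>z\<in>alg_hom \<Sigma> ?A M. u (g z)"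
    have "?w \<in> mor E' (dual_D \<Sigma> M ?A) (ego_struct M)"
      unfolding mor_dual_D_finite_iff[OF E' A finA]
    proof (intro conjI ballI)
      show "?w \<in> alg_hom \<Sigma> ?A M \<rightarrow>\<^sub>E carrier M"
        using PiE_mem[OF uX gX] by (simp add: restrict_PiE_iff)
      fix s t assume s: "s \<in> syms E'" and "t \<in> interp (dual_D \<Sigma> M ?A) s"
      then have t: "t \<in> tuples (sym_arity s) (alg_hom \<Sigma> ?A M)"
        and ta: "\<And>a. a \<in> ?U \<Longrightarrow> compose {..<sym_arity s} (\<lambda>z. z a) t \<in> snd (sym_rel s)"
        unfolding interp_dual_D[OF E' A s] carrier_dual_E by blast+
      have gt: "compose {..<sym_arity s} g t \<in> tuples (sym_arity s) (points X)"
        by (rule compose_tuples[OF t]) (use gX in blast)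
      have "compose {..<sym_arity s} a (compose {..<sym_arity s} g t) \<in> snd (sym_rel s)"
        if a: "a \<in> ?U" for a
      proof -
        have "compose {..<sym_arity s} a (compose {..<sym_arity s} g t) = compose {..<sym_arity s} (\<lambda>z. z a) t"
          unfolding compose_tuples_assoc by (rule compose_tuples_cong[OF t]) (simp add: g a)
        with ta[OF a] show ?thesis by simp
      qed
      with gt have "compose {..<sym_arity s} g t \<in> interp ?X s"
        unfolding interp_rel_struct[OF R s] ext_rel_def by blast
      then have "compose {..<sym_arity s} u (compose {..<sym_arity s} g t) \<in> snd (sym_rel s)"
        by (rule mor_ego_interp[OF E' wf_rel_struct[OF R] u s])
      moreover have "compose {..<sym_arity s} u (compose {..<sym_arity s} g t) = compose {..<sym_arity s} ?w t"
        unfolding compose_tuples_assoc by (rule compose_tuples_cong[OF t]) simp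
      ultimately show "compose {..<sym_arity s} ?w t \<in> snd (sym_rel s)" by simp
    qed
    then obtain a where a: "a \<in> ?U" and wa: "\<And>z. z \<in> alg_hom \<Sigma> ?A M \<Longrightarrow> ?w z = z a"
      using dA unfolding dualised_at_def carrier_dual_E by blast
    have "u = a"
    proof (rule PiE_ext[OF uX mor_egoD[OF a]])
      fix x assume x: "x \<in> points X"
      let ?z = "eval_struct M E X x"
      have z: "?z \<in> alg_hom \<Sigma> ?A M" by (rule eval_struct_hom[OF M E X x])
      have "g ?z = x"
      proof (rule separated_byD(3)[OF U gX[OF z] x])
        show "b (g ?z) = b x" if "b \<in> ?U" for b using g[OF z that] ev[OF x that] by simp
      qed
      then show "u x = a x" using wa[OF z] z ev[OF x a] by simp
    qed
    with a show "u \<in> ?U" by simp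
  qed
qed

section \<open>Restriction to substructures\<close>

lemma mor_restrict:
  assumes C: "closed_under_pops E Y C" and u: "u \<in> mor E Y Z"
  shows "restrict u C \<in> mor E (induced_on Y C) Z"
proof -
  have CY: "C \<subseteq> points Y" using C by (simp add: closed_under_pops_def)
  have cmp: "compose {..<n} (restrict u C) t = compose {..<n} u t" if "t \<in> tuples n C" for n t
    by (rule compose_tuples_cong[OF that]) simp
  show ?thesis
    unfolding mor_def mem_Collect_eq points_induced[OF CY]
  proof (intro conjI ballI allI impI)
    show "restrict u C \<in> C \<rightarrow>\<^sub>E points Z"
      using PiE_mem[OF morD(1)[OF u]] CY by (simp add: restrict_PiE_iff subset_iff)
    have "continuous_map (space (induced_on Y C)) (space Z) u"
      unfolding space_induced by (rule continuous_map_from_subtopology[OF morD(3)[OF u]])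
    then show "continuous_map (space (induced_on Y C)) (space Z) (restrict u C)"
      by (rule continuous_map_eq) simp
    fix h x y assume h: "h \<in> pops E" and "pop (induced_on Y C) h x = Some y"
    then have x: "x \<in> tuples (arity h) C" and y: "pop Y h x = Some y" by (simp_all add: pop_induced)
    have "y \<in> C" using C h x y unfolding closed_under_pops_def by blast
    then show "pop Z h (compose {..<arity h} (restrict u C) x) = Some (restrict u C y)"
      using morD(4)[OF u h y] cmp[OF x] by simp
  next
    fix \<rho> x assume \<rho>: "\<rho> \<in> rels E" and "x \<in> rel (induced_on Y C) \<rho>"
    then have x: "x \<in> tuples (arity \<rho>) C" and y: "x \<in> rel Y \<rho>" by (simp_all add: induced_on_def)
    then show "compose {..<arity \<rho>} (restrict u C) x \<in> rel Z \<rho>"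
      using morD(5)[OF u \<rho> y] cmp[OF x] by simp
  qed
qed

lemma induced_induced:
  assumes "C \<subseteq> D"
  shows "induced_on (induced_on Y D) C = induced_on Y C"
proof -
  have "tuples n D \<inter> tuples n C = tuples n C" for n
    using tuples_subset_in[OF _ assms] by blast
  moreover have "D \<inter> C = C" using assms by blast
  ultimately show ?thesis
    by (simp add: induced_on_def subtopology_subtopology Int_assoc)
qed

lemma closed_under_pops_induced:
  assumes "closed_under_pops E Y C" "C \<subseteq> D"
  shows "closed_under_pops E (induced_on Y D) C"
  using assms unfolding closed_under_pops_def by (simp add: pop_induced)

text \<open>Morphisms on the larger substructure restrict to morphisms on the smaller one, so
  enlarging the substructure imposes no new condition on \<open>t\<close>. This makes the union over
  all finite pieces a directed one.\<close>

lemma ext_rel_mono: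
  assumes C: "closed_under_pops E Y C" and D: "closed_under_pops E Y D" and CD: "C \<subseteq> D"
    and t: "t \<in> ext_rel M E (induced_on Y C) r"
  shows "t \<in> ext_rel M E (induced_on Y D) r"
proof -
  have CY: "C \<subseteq> points Y" "D \<subseteq> points Y" using C D by (simp_all add: closed_under_pops_def)
  have tC: "t \<in> tuples (arity r) C" using t unfolding ext_rel_def points_induced[OF CY(1)] by blast
  have "compose {..<arity r} u t \<in> snd r" if u: "u \<in> mor E (induced_on Y D) (ego_struct M)" for u
  proof -
    have "restrict u C \<in> mor E (induced_on Y C) (ego_struct M)"
      using mor_restrict[OF closed_under_pops_induced[OF C CD] u] unfolding induced_induced[OF CD] .
    then have "compose {..<arity r} (restrict u C) t \<in> snd r" using t unfolding ext_rel_def by blast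
    moreover have "compose {..<arity r} (restrict u C) t = compose {..<arity r} u t"
      by (rule compose_tuples_cong[OF tC]) simp
    ultimately show ?thesis by simp
  qed
  then show ?thesis using tuples_subset_in[OF tC CD] unfolding ext_rel_def points_induced[OF CY(2)] by blast
qed

section \<open>Transferring a full duality between alter egos\<close>

text \<open>\<open>E'\<close> is the standard alter ego of the hypothesis, \<open>E\<close> the one that fully dualises at the
  finite level.\<close>

locale duality_transfer =
  fixes universe :: "'u itself" and \<Sigma> :: "'f sig" and M :: "('f, 'a) algebra" and E E' :: "'a alter_ego"
  assumes inf: "infinite (UNIV :: 'u set)" and M: "is_algebra \<Sigma> M" and finM: "finite (carrier M)"
    and E': "is_alter_ego \<Sigma> M E'" and standard': "standard TYPE('u) M E'"
    and full': "fully_dualises TYPE('u) \<Sigma> M E'"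
    and E: "is_alter_ego \<Sigma> M E" and full: "fully_dualises_finite TYPE('u) \<Sigma> M E"
begin

lemma finite_dualised:
  assumes "is_algebra \<Sigma> A" "finite (carrier A)" "hom_separated \<Sigma> M A"
  shows "dualised_at \<Sigma> M E A" "dualised_at \<Sigma> M E' A"
proof -
  show "dualised_at \<Sigma> M E A" by (rule finite_dualised_at[OF inf full E assms])
  have "fully_dualises_finite TYPE('u) \<Sigma> M E'"
    using full' unfolding fully_dualises_def fully_dualises_finite_def by blast
  from finite_dualised_at[OF inf this E' assms] show "dualised_at \<Sigma> M E' A" .
qed

lemma rel_alg_dualised:
  assumes "compatible_rel \<Sigma> M r"
  shows "dualised_at \<Sigma> M E (rel_alg M r)" "dualised_at \<Sigma> M E' (rel_alg M r)"
  using finite_dualised[OF rel_alg_algebra[OF assms] finite_rel_alg[OF finM assms]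
      rel_alg_hom_separated[OF assms]] by simp_all

lemma represented_finite:
  fixes X :: "('a, 'u) tstruct"
  assumes "separated M E X" "finite (points X)"
  shows "represented \<Sigma> M E X"
  using full assms iso_imp_represented unfolding fully_dualises_finite_def IScP_iff_separated[OF E] by blast

lemma represented':
  fixes X :: "('a, 'u) tstruct"
  assumes "separated M E' X"
  shows "represented \<Sigma> M E' X"
  using full' assms iso_imp_represented unfolding fully_dualises_def IScP_iff_separated[OF E'] by blast

text \<open>\<open>A\<close> may be infinite, so the finite-level duality of \<open>E\<close> does
  not apply to it. It does apply to the algebra of a relation \<open>r\<close> from
  \<open>E'\<close>. A tuple of D(A) in this relation is the image of the projections under a map
  from D(r) to D(A); composed with \<open>w\<close>, this map satisfies the facts of
  \<open>finite_presentation\<close>, which puts the image of the tuple into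
  \<open>r\<close>.\<close>

lemma mor_dual_D_subset:
  assumes A: "is_algebra \<Sigma> A"
  shows "mor E (dual_D \<Sigma> M A) (ego_struct M) \<subseteq> mor E' (dual_D \<Sigma> M A) (ego_struct M)"
proof
  let ?D = "dual_D \<Sigma> M A" and ?H = "alg_hom \<Sigma> A M"
  fix w assume w: "w \<in> mor E ?D (ego_struct M)"
  have wM: "w \<in> ?H \<rightarrow>\<^sub>E carrier M" using mor_egoD[OF w] unfolding points_dual_D .
  have "compose {..<sym_arity s} w t \<in> snd (sym_rel s)"
    if s: "s \<in> syms E'" and "t \<in> interp ?D s" for s t
  proof -
    let ?r = "sym_rel s" and ?n = "sym_arity s"
    have t: "t \<in> tuples ?n ?H"
      and ta: "\<And>a. a \<in> carrier A \<Longrightarrow> compose {..<?n} (\<lambda>z. z a) t \<in> snd ?r"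
      using that(2) unfolding interp_dual_D[OF E' A s] by blast+
    note r = compatible_sym_rel[OF E' s]
    let ?K = "alg_hom \<Sigma> (rel_alg M ?r) M"
    \<comment> \<open>\<open>t\<close> gives a homomorphism from \<open>A\<close> to the algebra of
      \<open>r\<close>, sending \<open>a\<close> to the values at \<open>a\<close> of the entries of
      \<open>t\<close>. \<open>?G\<close> is its dual, composition with this homomorphism.\<close>
    let ?G = "\<lambda>q. \<lambda>a\<in>carrier A. q (compose {..<?n} (\<lambda>z. z a) t)"
    have G: "?G q \<in> ?H" if q: "q \<in> ?K" for q
      unfolding alg_hom_def mem_Collect_eq
    proof (intro conjI ballI)
      show "?G q \<in> carrier A \<rightarrow>\<^sub>E carrier M"
        using PiE_mem[OF alg_homD(1)[OF q]] ta by (simp add: Pi_iff)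
      fix f as assume f: "f \<in> \<Sigma>" and as: "as \<in> tuples (arity f) (carrier A)"
      let ?g = "\<lambda>j\<in>{..<arity f}. compose {..<?n} (\<lambda>z. z (as j)) t"
      have g: "?g \<in> tuples (arity f) (carrier (rel_alg M ?r))"
        using ta PiE_mem[OF as] by (simp add: restrict_PiE_iff)
      have "compose {..<?n} (\<lambda>z. z (opr A f as)) t = opr (rel_alg M ?r) f ?g"
      proof
        fix i
        show "compose {..<?n} (\<lambda>z. z (opr A f as)) t i = opr (rel_alg M ?r) f ?g i"
          using alg_homD(2)[OF PiE_mem[OF t, of i] f as]
          by (simp add: opr_rel_alg compose_def cong: restrict_cong)
      qed
      moreover have "compose {..<arity f} q ?g = compose {..<arity f} (?G q) as"
        using PiE_mem[OF as] by (simp add: compose_def fun_eq_iff)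
      ultimately show "?G q (opr A f as) = opr M f (compose {..<arity f} (?G q) as)"
        using alg_homD(2)[OF q f g] is_algebraD[OF A f as] by simp
    qed
    obtain I where I: "\<And>s q. (s, q) \<in> I \<Longrightarrow> s \<in> syms E \<and> q \<in> interp (dual_D \<Sigma> M (rel_alg M ?r)) s"
      and pres: "\<And>w. w \<in> ?K \<rightarrow> carrier M \<Longrightarrow>
        (\<And>s q. (s, q) \<in> I \<Longrightarrow> compose {..<sym_arity s} w q \<in> snd (sym_rel s)) \<Longrightarrow>
        compose {..<?n} w (projections ?r) \<in> snd ?r"
      using finite_presentation[OF E finM r rel_alg_dualised(1)[OF r]] by metis
    have "compose {..<?n} (\<lambda>q. w (?G q)) (projections ?r) \<in> snd ?r"
    proof (rule pres)
      show "(\<lambda>q. w (?G q)) \<in> ?K \<rightarrow> carrier M" using PiE_mem[OF wM G] by blast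
      fix s' p assume "(s', p) \<in> I"
      then have s': "s' \<in> syms E" and "p \<in> interp (dual_D \<Sigma> M (rel_alg M ?r)) s'" using I by blast+
      then have p: "p \<in> tuples (sym_arity s') ?K"
        and pa: "\<And>a. a \<in> snd ?r \<Longrightarrow> compose {..<sym_arity s'} (\<lambda>z. z a) p \<in> snd (sym_rel s')"
        unfolding interp_dual_D[OF E rel_alg_algebra[OF r] s'] carrier_rel_alg by blast+
      have Gp: "compose {..<sym_arity s'} ?G p \<in> tuples (sym_arity s') ?H"
        by (rule compose_tuples[OF p]) (use G in blast)
      have "compose {..<sym_arity s'} (\<lambda>z. z a) (compose {..<sym_arity s'} ?G p) \<in> snd (sym_rel s')"
        if a: "a \<in> carrier A" for a
      proof -
        have "compose {..<sym_arity s'} (\<lambda>z. z a) (compose {..<sym_arity s'} ?G p) =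
            compose {..<sym_arity s'} (\<lambda>z. z (compose {..<?n} (\<lambda>z. z a) t)) p"
          unfolding compose_tuples_assoc by (rule compose_tuples_cong[OF p]) (simp add: a)
        then show ?thesis using pa[OF ta[OF a]] by simp
      qed
      with Gp have "compose {..<sym_arity s'} ?G p \<in> interp ?D s'"
        unfolding interp_dual_D[OF E A s'] by blast
      from mor_ego_interp[OF E wf_struct_dual_D[OF E A] w s' this]
      show "compose {..<sym_arity s'} (\<lambda>q. w (?G q)) p \<in> snd (sym_rel s')"
        unfolding compose_tuples_assoc comp_def .
    qed
    moreover have "compose {..<?n} (\<lambda>q. w (?G q)) (projections ?r) = compose {..<?n} w t"
    proof
      fix i
      show "compose {..<?n} (\<lambda>q. w (?G q)) (projections ?r) i = compose {..<?n} w t i"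
      proof (cases "i < ?n")
        case True
        have "?G (projections ?r i) = t i"
        proof (rule extensionalityI)
          show "t i \<in> extensional (carrier A)"
            using alg_homD(1)[OF PiE_mem[OF t, of i]] True by (simp add: PiE_def)
          show "?G (projections ?r i) a = t i a" if "a \<in> carrier A" for a
            using that True ta[OF that] by (simp add: projections_def compose_def)
        qed simp
        then show ?thesis using True by (simp add: compose_def)
      qed (simp add: compose_def)
    qed
    ultimately show ?thesis by simp
  qed
  moreover have "continuous_map (space ?D) (discrete_topology (carrier M)) w"
    using w unfolding mor_ego_iff[OF E wf_struct_dual_D[OF E A]] by blast
  ultimately show "w \<in> mor E' ?D (ego_struct M)"
    using mor_egoD[OF w] unfolding mor_ego_iff[OF E' wf_struct_dual_D[OF E' A]] by blast
qed

text \<open>For the remaining inclusion, the duality of \<open>E'\<close> makes a morphism an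
  evaluation at an element of \<open>A\<close>, and evaluations are morphisms for every alter
  ego.\<close>

lemma mor_dual_D_eq:
  fixes A :: "('f, 'u) algebra"
  assumes "A \<in> ISP \<Sigma> M"
  shows "mor E (dual_D \<Sigma> M A) (ego_struct M) = mor E' (dual_D \<Sigma> M A) (ego_struct M)"
proof
  have A: "is_algebra \<Sigma> A" using assms by (simp add: ISP_def)
  show "mor E (dual_D \<Sigma> M A) (ego_struct M) \<subseteq> mor E' (dual_D \<Sigma> M A) (ego_struct M)"
    by (rule mor_dual_D_subset[OF A])
  have dual: "dualised_at \<Sigma> M E' A"
    using full' assms iso_imp_dualised_at unfolding fully_dualises_def by blast
  show "mor E' (dual_D \<Sigma> M A) (ego_struct M) \<subseteq> mor E (dual_D \<Sigma> M A) (ego_struct M)"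
  proof
    fix w assume w: "w \<in> mor E' (dual_D \<Sigma> M A) (ego_struct M)"
    then obtain a where a: "a \<in> carrier A" and wa: "\<And>z. z \<in> alg_hom \<Sigma> A M \<Longrightarrow> w z = z a"
      using dual unfolding dualised_at_def by blast
    have "w \<in> extensional (alg_hom \<Sigma> A M)"
      using mor_egoD[OF w] unfolding points_dual_D by (simp add: PiE_def)
    then have "w = (\<lambda>z\<in>alg_hom \<Sigma> A M. z a)"
      by (rule extensionalityI) (simp_all add: wa)
    then show "w \<in> mor E (dual_D \<Sigma> M A) (ego_struct M)" using eval_mor[OF E A a] by simp
  qed
qed

end

text \<open>A model \<open>Y\<close> of the theory of \<open>E\<close> is a directed union of finite structures that embed into powers
  of \<open>M\<close>. On each of them the symbols of \<open>E'\<close> have an intrinsic meaning, given by the morphisms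
  into \<open>M\<close>, and these meanings fit together.\<close>

locale duality_transfer_model = duality_transfer universe \<Sigma> M E E'
  for universe :: "'u itself" and \<Sigma> :: "'f sig" and M :: "('f, 'a) algebra" and E E' :: "'a alter_ego" +
  fixes Y :: "('a, 'u) tstruct"
  assumes bY: "boolean_struct E Y" and model: "\<forall>\<sigma>\<in>Th_uH M E. uh_true Y \<sigma>"
begin

section \<open>The enriched model, assembled from its finite separated pieces\<close>

definition subs :: "'u set set" where
  "subs = {C. finite C \<and> closed_under_pops E Y C \<and> separated M E (induced_on Y C)}"

definition local_rel :: "'a relsym \<Rightarrow> (nat \<Rightarrow> 'u) set" where
  "local_rel r = (\<Union>C\<in>subs. ext_rel M E (induced_on Y C) r)"

definition transferred :: "('a, 'u) tstruct" where
  "transferred = rel_struct (space Y) local_rel"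

definition transferred_sub :: "'u set \<Rightarrow> ('a, 'u) tstruct" where
  "transferred_sub C = rel_struct (space (induced_on Y C)) (ext_rel M E (induced_on Y C))"

lemma wY: "wf_struct E Y"
  by (rule boolean_struct_wf[OF bY])

lemma subsD:
  assumes "C \<in> subs"
  shows "finite C" "closed_under_pops E Y C" "separated M E (induced_on Y C)" "C \<subseteq> points Y"
    "points (induced_on Y C) = C" "represented \<Sigma> M E (induced_on Y C)"
    "separated_by M E (induced_on Y C) (mor E (induced_on Y C) (ego_struct M))"
proof -
  show 1: "finite C" "closed_under_pops E Y C" "separated M E (induced_on Y C)"
    using assms by (simp_all add: subs_def)
  show 2: "C \<subseteq> points Y" using 1(2) by (simp add: closed_under_pops_def)
  show 3: "points (induced_on Y C) = C" by (rule points_induced[OF 2])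
  show "represented \<Sigma> M E (induced_on Y C)" using 1 3 by (intro represented_finite) simp_all
  show "separated_by M E (induced_on Y C) (mor E (induced_on Y C) (ego_struct M))"
    using 1(3) unfolding separated_def by blast
qed

lemma subs_cofinal:
  assumes "finite F" "F \<subseteq> points Y"
  obtains C where "C \<in> subs" "F \<subseteq> C"
  by (rule uh_model_locally_separated[OF E finM bY model assms]) (rule that, simp_all add: subs_def)

lemma ext_rel_subs:
  "C \<in> subs \<Longrightarrow> t \<in> ext_rel M E (induced_on Y C) r \<Longrightarrow> t \<in> tuples (arity r) C"
  unfolding ext_rel_def using subsD(5) by blast

lemma local_relI: "C \<in> subs \<Longrightarrow> t \<in> ext_rel M E (induced_on Y C) r \<Longrightarrow> t \<in> local_rel r"
  unfolding local_rel_def by blast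

lemma local_rel_tuples: "local_rel r \<subseteq> tuples (arity r) (points Y)"
  unfolding local_rel_def using ext_rel_subs tuples_subset_in[OF _ subsD(4)] by blast

lemma ext_rel_subs_mono:
  "C \<in> subs \<Longrightarrow> D \<in> subs \<Longrightarrow> C \<subseteq> D \<Longrightarrow> t \<in> ext_rel M E (induced_on Y C) r \<Longrightarrow>
    t \<in> ext_rel M E (induced_on Y D) r"
  by (rule ext_rel_mono[OF subsD(2) subsD(2)])

lemma local_relE:
  assumes "t \<in> local_rel r"
  obtains C where "C \<in> subs" "t \<in> ext_rel M E (induced_on Y C) r"
  using assms unfolding local_rel_def by blast

lemma local_rel_mor:
  assumes t: "t \<in> local_rel r" and u: "u \<in> mor E Y (ego_struct M)"
  shows "compose {..<arity r} u t \<in> snd r"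
proof -
  obtain C where C: "C \<in> subs" and tC: "t \<in> ext_rel M E (induced_on Y C) r" using t by (rule local_relE)
  have "compose {..<arity r} (restrict u C) t \<in> snd r"
    using mor_restrict[OF subsD(2)[OF C] u] tC unfolding ext_rel_def by blast
  moreover have "compose {..<arity r} (restrict u C) t = compose {..<arity r} u t"
    by (rule compose_tuples_cong[OF ext_rel_subs[OF C tC]]) simp
  ultimately show ?thesis by simp
qed

lemma functional_sub:
  assumes "C \<in> subs"
  shows "functional_rels E' (space (induced_on Y C)) (ext_rel M E (induced_on Y C))"
  by (rule functional_ext_rel[OF E subsD(7)[OF assms] E'])

text \<open>Two values for the same arguments are witnessed in two finite pieces; a common larger
  piece contains both, and there the relation is functional.\<close>

lemma functional_local_rel: "functional_rels E' (space Y) local_rel"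
  unfolding functional_rels_def
proof (intro conjI ballI allI impI)
  show "local_rel (sym_rel s) \<subseteq> tuples (sym_arity s) (points Y)" for s by (rule local_rel_tuples)
  fix h x y y' assume h: "h \<in> pops E'" and x: "x \<in> tuples (arity h) (points Y)"
    and y: "x(arity h := y) \<in> local_rel (Suc (arity h), pop_graph h)"
    and y': "x(arity h := y') \<in> local_rel (Suc (arity h), pop_graph h)"
  from y obtain C where C: "C \<in> subs"
    and yC: "x(arity h := y) \<in> ext_rel M E (induced_on Y C) (Suc (arity h), pop_graph h)" by (rule local_relE)
  from y' obtain C' where C': "C' \<in> subs"
    and yC': "x(arity h := y') \<in> ext_rel M E (induced_on Y C') (Suc (arity h), pop_graph h)" by (rule local_relE)
  have "finite (C \<union> C')" "C \<union> C' \<subseteq> points Y" using subsD(1,4)[OF C] subsD(1,4)[OF C'] by simp_all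
  then obtain D where D: "D \<in> subs" and CD: "C \<union> C' \<subseteq> D" by (rule subs_cofinal)
  have yD: "x(arity h := y) \<in> ext_rel M E (induced_on Y D) (Suc (arity h), pop_graph h)"
    by (rule ext_rel_subs_mono[OF C D _ yC]) (use CD in blast)
  have yD': "x(arity h := y') \<in> ext_rel M E (induced_on Y D) (Suc (arity h), pop_graph h)"
    by (rule ext_rel_subs_mono[OF C' D _ yC']) (use CD in blast)
  have "x(arity h := y) \<in> tuples (Suc (arity h)) D" using ext_rel_subs[OF D yD] by simp
  then obtain x1 y1 where x1: "x1 \<in> tuples (arity h) D" "x(arity h := y) = x1(arity h := y1)"
    by (rule tuple_Suc_cases)
  then have "x \<in> tuples (arity h) D" using tuple_upd_eq_iff[OF x x1(1)] by metis
  then show "y = y'"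
    using functional_sub[OF D] h yD yD' unfolding functional_rels_def subsD(5)[OF D] by blast
qed

text \<open>\<open>K\<close> is the set of maps from the finite set of points of D(r) to
  \<open>Y\<close> that satisfy the finitely many facts of \<open>finite_presentation\<close>. It is
  closed in a compact power of \<open>Y\<close>, and \<open>local_rel r\<close> is its continuous
  image under evaluation at the projections. One inclusion is \<open>point_map\<close>; for the
  other, the range of a map in \<open>K\<close> is finite, lies in some piece \<open>C\<close>, and
  every morphism on \<open>C\<close> turns the map into one covered by \<open>pres\<close>.\<close>

lemma closedin_local_rel:
  assumes r: "compatible_rel \<Sigma> M r"
  shows "closedin (tuple_space (arity r) (space Y)) (local_rel r)"
proof -
  let ?H = "alg_hom \<Sigma> (rel_alg M r) M" and ?D = "dual_D \<Sigma> M (rel_alg M r)"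
  let ?P = "product_topology (\<lambda>_. space Y) ?H"
  let ?ev = "\<lambda>w. compose {..<arity r} w (projections r)"
  have T: "compact_space (space Y)" "Hausdorff_space (space Y)"
    using bY by (simp_all add: boolean_struct_def)
  have finH: "finite ?H" by (rule finite_alg_hom[OF finite_rel_alg[OF finM r] finM])
  obtain I where I: "\<And>s q. (s, q) \<in> I \<Longrightarrow> s \<in> syms E \<and> q \<in> interp ?D s"
    and pres: "\<And>w. w \<in> ?H \<rightarrow> carrier M \<Longrightarrow>
      (\<And>s q. (s, q) \<in> I \<Longrightarrow> compose {..<sym_arity s} w q \<in> snd (sym_rel s)) \<Longrightarrow> ?ev w \<in> snd r"
    using finite_presentation[OF E finM r rel_alg_dualised(1)[OF r]] by metis
  have qH: "q \<in> tuples (sym_arity s) ?H" if "(s, q) \<in> I" for s q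
    using I[OF that] interp_dual_D[OF E rel_alg_algebra[OF r]] by blast
  define K where "K = {w \<in> ?H \<rightarrow>\<^sub>E points Y. \<forall>(s, q)\<in>I. compose {..<sym_arity s} w q \<in> interp Y s}"
  define K1 where "K1 p = {w \<in> topspace ?P. compose {..<sym_arity (fst p)} w (snd p) \<in> interp Y (fst p)}" for p
  have "closedin ?P (K1 p)" if p: "p \<in> I" for p
    unfolding K1_def
  proof (rule closedin_continuous_map_preimage)
    have "(fst p, snd p) \<in> I" using p by simp
    note i = I[OF this] qH[OF this]
    show "closedin (tuple_space (sym_arity (fst p)) (space Y)) (interp Y (fst p))"
      by (rule closedin_interp[OF bY]) (use i in blast)
    show "continuous_map ?P (tuple_space (sym_arity (fst p)) (space Y))
        (\<lambda>w. compose {..<sym_arity (fst p)} w (snd p))"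
      by (rule continuous_map_compose_tuple) (use PiE_mem[OF i(2)] in blast)
  qed
  \<comment> \<open>Inserting the whole space keeps the intersection correct when \<open>I\<close>
    is empty.\<close>
  then have "closedin ?P (\<Inter>(insert (topspace ?P) (K1 ` I)))"
    using closedin_topspace[of ?P] by (intro closedin_Inter) blast+
  moreover have "K = \<Inter>(insert (topspace ?P) (K1 ` I))"
    unfolding K_def K1_def case_prod_beta topspace_product_topology by blast
  ultimately have "closedin ?P K" by simp
  moreover have "continuous_map ?P (tuple_space (arity r) (space Y)) ?ev"
    by (rule continuous_map_compose_tuple) (use PiE_mem[OF projections_hom[OF r]] in blast)
  ultimately have "closedin (tuple_space (arity r) (space Y)) (?ev ` K)"
    using closedin_image_compact_Hausdorff compact_Hausdorff_tuple_space[OF T] by blast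
  moreover have "?ev ` K = local_rel r"
  proof (intro set_eqI iffI)
    fix t assume "t \<in> local_rel r"
    then obtain C where C: "C \<in> subs" and tC: "t \<in> ext_rel M E (induced_on Y C) r" by (rule local_relE)
    obtain g where g: "g \<in> ?H \<rightarrow> points (induced_on Y C)"
      and gi: "\<And>s q. s \<in> syms E \<Longrightarrow> q \<in> interp ?D s \<Longrightarrow> compose {..<sym_arity s} g q \<in> interp (induced_on Y C) s"
      and gt: "?ev g = t"
      using point_map[OF M E subsD(3)[OF C] subsD(6)[OF C] r tC] by metis
    have eq: "compose {..<n} (restrict g ?H) q = compose {..<n} g q" if "q \<in> tuples n ?H" for n q
      by (rule compose_tuples_cong[OF that]) simp
    have "restrict g ?H \<in> K"
      unfolding K_def mem_Collect_eq
    proof (intro conjI ballI)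
      show "restrict g ?H \<in> ?H \<rightarrow>\<^sub>E points Y"
        using g subsD(4,5)[OF C] by (auto simp: restrict_PiE_iff)
      fix p assume "p \<in> I"
      then obtain s q where p: "p = (s, q)" "(s, q) \<in> I" by (cases p) simp
      have "compose {..<sym_arity s} g q \<in> interp (induced_on Y C) s" using gi I[OF p(2)] by blast
      then have "compose {..<sym_arity s} g q \<in> interp Y s"
        using interp_induced[OF wY subsD(2)[OF C]] I[OF p(2)] by blast
      then show "case p of (s, q) \<Rightarrow> compose {..<sym_arity s} (restrict g ?H) q \<in> interp Y s"
        unfolding p(1) by (simp add: eq[OF qH[OF p(2)]])
    qed
    moreover have "?ev (restrict g ?H) = t" using eq[OF projections_hom[OF r]] gt by simp
    ultimately show "t \<in> ?ev ` K" by blast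
  next
    fix t assume "t \<in> ?ev ` K"
    then obtain w where w: "w \<in> ?H \<rightarrow>\<^sub>E points Y" and wI: "\<forall>(s, q)\<in>I. compose {..<sym_arity s} w q \<in> interp Y s"
      and t: "t = ?ev w" unfolding K_def by blast
    have "finite (w ` ?H)" "w ` ?H \<subseteq> points Y" using finH w by auto
    then obtain C where C: "C \<in> subs" and wC: "w ` ?H \<subseteq> C" by (rule subs_cofinal)
    have wC': "w \<in> ?H \<rightarrow> C" using wC by blast
    have "compose {..<arity r} u t \<in> snd r" if u: "u \<in> mor E (induced_on Y C) (ego_struct M)" for u
    proof -
      have uM: "u \<in> C \<rightarrow>\<^sub>E carrier M" using mor_egoD[OF u] unfolding subsD(5)[OF C] .
      have "?ev (u \<circ> w) \<in> snd r"
      proof (rule pres)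
        show "u \<circ> w \<in> ?H \<rightarrow> carrier M" using PiE_mem[OF uM] wC by auto
        fix s q assume sq: "(s, q) \<in> I"
        have s: "s \<in> syms E" using I[OF sq] by blast
        have "compose {..<sym_arity s} w q \<in> tuples (sym_arity s) C"
          by (rule compose_tuples[OF qH[OF sq] wC'])
        moreover have "compose {..<sym_arity s} w q \<in> interp Y s" using wI sq by blast
        ultimately have "compose {..<sym_arity s} w q \<in> interp (induced_on Y C) s"
          unfolding interp_induced[OF wY subsD(2)[OF C] s] by blast
        from mor_ego_interp[OF E wf_struct_induced[OF wY subsD(2)[OF C]] u s this]
        show "compose {..<sym_arity s} (u \<circ> w) q \<in> snd (sym_rel s)" unfolding compose_tuples_assoc .
      qed
      then show ?thesis unfolding t compose_tuples_assoc .
    qed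
    moreover have "t \<in> tuples (arity r) C"
      unfolding t by (rule compose_tuples[OF projections_hom[OF r] wC'])
    ultimately have "t \<in> ext_rel M E (induced_on Y C) r"
      unfolding ext_rel_def subsD(5)[OF C] by blast
    with C show "t \<in> local_rel r" by (rule local_relI)
  qed
  ultimately show ?thesis by simp
qed

lemma boolean_transferred: "boolean_struct E' transferred"
  unfolding transferred_def
  using bY closedin_local_rel[OF compatible_sym_rel[OF E']]
  by (intro boolean_rel_struct functional_local_rel) (simp_all add: boolean_struct_def)

lemma interp_transferred: "s \<in> syms E' \<Longrightarrow> interp transferred s = local_rel (sym_rel s)"
  unfolding transferred_def by (rule interp_rel_struct[OF functional_local_rel])

lemma space_transferred [simp]: "space transferred = space Y"
  by (simp add: transferred_def)

lemma wf_transferred: "wf_struct E' transferred"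
  by (rule boolean_struct_wf[OF boolean_transferred])

lemma interp_transferred_sub:
  "C \<in> subs \<Longrightarrow> s \<in> syms E' \<Longrightarrow> interp (transferred_sub C) s = ext_rel M E (induced_on Y C) (sym_rel s)"
  unfolding transferred_sub_def by (rule interp_rel_struct[OF functional_sub])

lemma points_transferred_sub: "C \<in> subs \<Longrightarrow> points (transferred_sub C) = C"
  using subsD(5) by (simp add: transferred_sub_def)

lemma wf_transferred_sub: "C \<in> subs \<Longrightarrow> wf_struct E' (transferred_sub C)"
  unfolding transferred_sub_def by (rule wf_rel_struct[OF functional_sub])

lemma space_transferred_sub: "C \<in> subs \<Longrightarrow> space (transferred_sub C) = discrete_topology C"
  using space_induced_finite[OF bY subsD(1,4)] by (simp add: transferred_sub_def)

lemma separated_transferred_sub: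
  assumes C: "C \<in> subs"
  shows "separated M E' (transferred_sub C)"
proof (rule separatedI)
  show "boolean_struct E' (transferred_sub C)"
    by (rule boolean_struct_discrete[OF wf_transferred_sub[OF C] subsD(1)[OF C] space_transferred_sub[OF C]])
  show "separated_by M E' (transferred_sub C) (mor E (induced_on Y C) (ego_struct M))"
    unfolding transferred_sub_def by (rule separated_by_ext_rel[OF M E subsD(3)[OF C] subsD(6)[OF C] E'])
qed

lemma mor_transferred_sub:
  assumes C: "C \<in> subs"
  shows "mor E' (transferred_sub C) (ego_struct M) = mor E (induced_on Y C) (ego_struct M)"
  unfolding transferred_sub_def
proof (rule mor_ext_rel_finite[OF M finM E subsD(3)[OF C] subsD(6)[OF C] E'])
  show "finite (points (induced_on Y C))" using subsD(1,5)[OF C] by simp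
qed (rule finite_dualised(2))

lemma inclusion_mor:
  assumes C: "C \<in> subs"
  shows "(\<lambda>x\<in>C. x) \<in> mor E' (transferred_sub C) transferred"
  unfolding mor_iff[OF wf_transferred_sub[OF C] wf_transferred] points_transferred_sub[OF C]
proof (intro conjI ballI)
  show "(\<lambda>x\<in>C. x) \<in> C \<rightarrow>\<^sub>E points transferred"
    using subsD(4)[OF C] by (simp add: restrict_PiE_iff subset_iff)
  show "continuous_map (space (transferred_sub C)) (space transferred) (\<lambda>x\<in>C. x)"
    using subsD(4)[OF C] by (auto simp: space_transferred_sub[OF C])
  fix s t assume s: "s \<in> syms E'" and t: "t \<in> interp (transferred_sub C) s"
  then have t': "t \<in> ext_rel M E (induced_on Y C) (sym_rel s)" unfolding interp_transferred_sub[OF C s] by blast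
  have "compose {..<sym_arity s} (\<lambda>x\<in>C. x) t = t"
    by (rule compose_tuples_id[OF ext_rel_subs[OF C t']]) simp
  then show "compose {..<sym_arity s} (\<lambda>x\<in>C. x) t \<in> interp transferred s"
    unfolding interp_transferred[OF s] using local_relI[OF C t'] by simp
qed

section \<open>Facts that hold on all sufficiently large finite pieces\<close>

definition ev :: "('u set \<Rightarrow> bool) \<Rightarrow> bool" where
  "ev P \<longleftrightarrow> (\<exists>F. finite F \<and> F \<subseteq> points Y \<and> (\<forall>C\<in>subs. F \<subseteq> C \<longrightarrow> P C))"

lemma ev_ball:
  assumes "finite S" "\<And>x. x \<in> S \<Longrightarrow> ev (P x)"
  shows "ev (\<lambda>C. \<forall>x\<in>S. P x C)"
proof -
  have "\<forall>x\<in>S. \<exists>F. finite F \<and> F \<subseteq> points Y \<and> (\<forall>C\<in>subs. F \<subseteq> C \<longrightarrow> P x C)"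
    using assms(2) unfolding ev_def by blast
  then obtain F where F: "\<And>x. x \<in> S \<Longrightarrow> finite (F x)" "\<And>x. x \<in> S \<Longrightarrow> F x \<subseteq> points Y"
      "\<And>x C. x \<in> S \<Longrightarrow> C \<in> subs \<Longrightarrow> F x \<subseteq> C \<Longrightarrow> P x C" by metis
  show ?thesis
    unfolding ev_def
  proof (intro exI[of _ "\<Union>(F ` S)"] conjI ballI impI)
    show "finite (\<Union>(F ` S))" using assms(1) F(1) by blast
    show "\<Union>(F ` S) \<subseteq> points Y" using F(2) by blast
    show "P x C" if "C \<in> subs" "\<Union>(F ` S) \<subseteq> C" "x \<in> S" for C x
      using that by (intro F(3)) blast+
  qed
qed

lemma ev_conj:
  assumes "ev P" "ev Q"
  shows "ev (\<lambda>C. P C \<and> Q C)"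
proof -
  obtain F where F: "finite F" "F \<subseteq> points Y" "\<And>C. C \<in> subs \<Longrightarrow> F \<subseteq> C \<Longrightarrow> P C"
    using assms(1) unfolding ev_def by auto
  obtain G where G: "finite G" "G \<subseteq> points Y" "\<And>C. C \<in> subs \<Longrightarrow> G \<subseteq> C \<Longrightarrow> Q C"
    using assms(2) unfolding ev_def by auto
  show ?thesis unfolding ev_def
    by (rule exI[of _ "F \<union> G"]) (use F G in simp)
qed

lemma ev_mono:
  assumes "ev P" "\<And>C. C \<in> subs \<Longrightarrow> P C \<Longrightarrow> Q C"
  shows "ev Q"
  using assms unfolding ev_def by meson

lemma ev_superset: "finite F \<Longrightarrow> F \<subseteq> points Y \<Longrightarrow> ev (\<lambda>C. F \<subseteq> C)"
  unfolding ev_def by blast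

text \<open>Cofinality of \<open>subs\<close> turns a property of all large pieces into an instance.
  With \<open>ev_ball\<close> and \<open>ev_conj\<close>, finitely many facts about
  \<open>transferred\<close> can thus be seen together in one finite piece.\<close>

lemma ev_obtain:
  assumes "ev P"
  obtains C where "C \<in> subs" "P C"
proof -
  obtain F where F: "finite F" "F \<subseteq> points Y" and P: "\<And>C. C \<in> subs \<Longrightarrow> F \<subseteq> C \<Longrightarrow> P C"
    using assms unfolding ev_def by auto
  from F obtain C where "C \<in> subs" "F \<subseteq> C" by (rule subs_cofinal)
  with P that show thesis by blast
qed

lemma ev_local_rel:
  assumes "t \<in> local_rel r"
  shows "ev (\<lambda>C. t \<in> ext_rel M E (induced_on Y C) r)"
proof -
  obtain C where C: "C \<in> subs" "t \<in> ext_rel M E (induced_on Y C) r" using assms by (rule local_relE)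
  show ?thesis
    by (rule ev_mono[OF ev_superset[OF subsD(1,4)[OF C(1)]]]) (rule ext_rel_subs_mono[OF C(1) _ _ C(2)])
qed

lemma ev_pop:
  assumes h: "h \<in> pops E'" and y: "pop transferred h x = Some y"
  shows "ev (\<lambda>C. pop (transferred_sub C) h x = Some y)"
proof -
  have s: "Inl h \<in> syms E'" using h unfolding syms_def by blast
  have x: "x \<in> tuples (arity h) (points transferred)" by (rule wf_struct_popD(1)[OF wf_transferred h y])
  have "x(arity h := y) \<in> local_rel (sym_rel (Inl h))"
    using y interp_pop_iff[OF wf_transferred h x] unfolding interp_transferred[OF s] by blast
  then show ?thesis
  proof (rule ev_mono[OF ev_local_rel])
    fix C assume C: "C \<in> subs" "x(arity h := y) \<in> ext_rel M E (induced_on Y C) (sym_rel (Inl h))"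
    then show "pop (transferred_sub C) h x = Some y"
      using interp_pop_iff[OF wf_transferred_sub[OF C(1)] h x]
      unfolding interp_transferred_sub[OF C(1) s] by blast
  qed
qed

lemma ev_those:
  assumes "\<And>t y. t \<in> set ts \<Longrightarrow> term_val transferred v t = Some y \<Longrightarrow>
      ev (\<lambda>C. term_val (transferred_sub C) v t = Some y)"
    and xs: "those (map (term_val transferred v) ts) = Some xs"
  shows "ev (\<lambda>C. those (map (term_val (transferred_sub C) v) ts) = Some xs)"
proof -
  have len: "length xs = length ts" by (rule those_length[OF xs])
  have "term_val transferred v (ts ! i) = Some (xs ! i)" if "i < length ts" for i
    using xs that unfolding those_map_eq_Some_iff list_all2_conv_all_nth by blast
  then have "ev (\<lambda>C. \<forall>i\<in>{..<length ts}. term_val (transferred_sub C) v (ts ! i) = Some (xs ! i))"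
    by (intro ev_ball assms(1)) simp_all
  then show ?thesis
    by (rule ev_mono) (simp add: those_map_eq_Some_iff list_all2_conv_all_nth len)
qed

lemma ev_term_val:
  "wf_trm E' k t \<Longrightarrow> term_val transferred v t = Some y \<Longrightarrow>
    ev (\<lambda>C. term_val (transferred_sub C) v t = Some y)"
proof (induction t arbitrary: y)
  case (Var i)
  then show ?case by (intro ev_mono[OF ev_superset[of "{}"]]) simp_all
next
  case (App h ts)
  then have h: "h \<in> pops E'" and wf: "\<And>t. t \<in> set ts \<Longrightarrow> wf_trm E' k t" by (simp_all add: list_all_iff)
  from App.prems(2) obtain xs where xs: "those (map (term_val transferred v) ts) = Some xs"
    and y: "pop transferred h (tuple_of xs) = Some y" by (auto simp: bind_eq_Some_conv)
  have "ev (\<lambda>C. those (map (term_val (transferred_sub C) v) ts) = Some xs)"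
    by (rule ev_those[OF _ xs]) (rule App.IH[OF _ wf])
  from ev_conj[OF this ev_pop[OF h y]] show ?case by (rule ev_mono) simp
qed

lemma ev_atom_true:
  assumes wf: "wf_atom E' k \<alpha>" and tr: "atom_true transferred v \<alpha>"
  shows "ev (\<lambda>C. atom_true (transferred_sub C) v \<alpha>)"
proof (cases \<alpha>)
  case (Eq s t)
  then obtain y where "term_val transferred v s = Some y" "term_val transferred v t = Some y"
    using tr by auto
  with wf have "ev (\<lambda>C. term_val (transferred_sub C) v s = Some y \<and> term_val (transferred_sub C) v t = Some y)"
    unfolding Eq by (intro ev_conj ev_term_val[where k = k]) simp_all
  then show ?thesis unfolding Eq by (rule ev_mono) simp
next
  case (Rel \<rho> ts)
  then obtain xs where xs: "those (map (term_val transferred v) ts) = Some xs"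
    and x: "tuple_of xs \<in> rel transferred \<rho>" using tr by auto
  have \<rho>: "\<rho> \<in> rels E'" and w: "\<And>t. t \<in> set ts \<Longrightarrow> wf_trm E' k t"
    using wf unfolding Rel by (simp_all add: list_all_iff)
  have s: "Inr \<rho> \<in> syms E'" using \<rho> unfolding syms_def by blast
  have "tuple_of xs \<in> local_rel \<rho>" using x interp_transferred[OF s] by simp
  then have "ev (\<lambda>C. tuple_of xs \<in> ext_rel M E (induced_on Y C) \<rho>)" by (rule ev_local_rel)
  then have "ev (\<lambda>C. tuple_of xs \<in> rel (transferred_sub C) \<rho>)"
    by (rule ev_mono) (use interp_transferred_sub[OF _ s] in simp)
  moreover have "ev (\<lambda>C. those (map (term_val (transferred_sub C) v) ts) = Some xs)"
    by (rule ev_those[OF _ xs]) (rule ev_term_val[OF w])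
  ultimately have "ev (\<lambda>C. tuple_of xs \<in> rel (transferred_sub C) \<rho> \<and>
      those (map (term_val (transferred_sub C) v) ts) = Some xs)" by (rule ev_conj)
  then show ?thesis unfolding Rel by (rule ev_mono) simp
qed

text \<open>The premises are finitely many atoms at finitely many points, so they hold in one
  \<open>transferred_sub C\<close>. That structure is separated and hence satisfies the sentence;
  the conclusion returns to \<open>transferred\<close> along the inclusion morphism.\<close>

lemma transferred_model:
  assumes \<sigma>: "\<sigma> \<in> Th_uH M E'"
  shows "uh_true transferred \<sigma>"
  unfolding uh_true_def
proof (intro ballI impI)
  let ?k = "uh_vars \<sigma>"
  fix v assume v: "v \<in> tuples ?k (points transferred)"
    and pr: "\<forall>\<alpha>\<in>set (uh_premises \<sigma>). atom_true transferred v \<alpha>"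
  have wf: "\<forall>\<alpha>\<in>set (uh_premises \<sigma>). wf_atom E' ?k \<alpha>"
      "\<forall>\<gamma>. uh_conclusion \<sigma> = Some \<gamma> \<longrightarrow> wf_atom E' ?k \<gamma>"
    using \<sigma> by (simp_all add: Th_uH_def uh_sentences_def)
  have 1: "ev (\<lambda>C. \<forall>\<alpha>\<in>set (uh_premises \<sigma>). atom_true (transferred_sub C) v \<alpha>)"
    using wf(1) pr by (intro ev_ball ev_atom_true[where k = ?k]) simp_all
  have 2: "ev (\<lambda>C. v ` {..<?k} \<subseteq> C)"
  proof (rule ev_superset)
    show "v ` {..<?k} \<subseteq> points Y" using PiE_mem[OF v] unfolding space_transferred by (rule image_subsetI)
  qed simp
  obtain C where C: "C \<in> subs" and pC: "\<forall>\<alpha>\<in>set (uh_premises \<sigma>). atom_true (transferred_sub C) v \<alpha>"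
    and vC: "v ` {..<?k} \<subseteq> C" by (rule ev_obtain[OF ev_conj[OF 1 2]]) blast
  have vk: "v \<in> tuples ?k (points (transferred_sub C))"
    using tuples_subset_in[OF tuples_finite_image[OF v] vC] points_transferred_sub[OF C] by simp
  have "uh_true (transferred_sub C) \<sigma>"
    by (rule separated_uh_true[OF E' separated_transferred_sub[OF C] \<sigma>])
  with vk pC have concl: "case uh_conclusion \<sigma> of None \<Rightarrow> False | Some \<gamma> \<Rightarrow> atom_true (transferred_sub C) v \<gamma>"
    unfolding uh_true_def by blast
  show "case uh_conclusion \<sigma> of None \<Rightarrow> False | Some \<gamma> \<Rightarrow> atom_true transferred v \<gamma>"
  proof (cases "uh_conclusion \<sigma>")
    case None
    with concl show ?thesis by simp
  next
    case (Some \<gamma>)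
    have "atom_true transferred v \<gamma>"
    proof (rule atom_true_mor[where k = ?k and v = v, OF inclusion_mor[OF C]])
      show "v i = (\<lambda>x\<in>C. x) (v i)" if "i < ?k" for i
        using vC that by (simp add: image_subset_iff)
    qed (use Some wf(2) concl in simp_all)
    with Some show ?thesis by simp
  qed
qed

section \<open>Exploiting \<open>E'\<close> on the enriched model and returning to
  \<open>E\<close>\<close>

lemma separated_transferred: "separated M E' transferred"
  \<comment> \<open>The only use of standardness: a Boolean model of the theory of \<open>E'\<close>
    lies in \<open>IScP\<close>, which provides enough morphisms into \<open>M\<close>.\<close>
  using standard' boolean_transferred transferred_model
  unfolding standard_def set_eq_iff mem_Collect_eq IScP_iff_separated[OF E'] by blast

lemma represented_transferred: "represented \<Sigma> M E' transferred"
  by (rule represented'[OF separated_transferred])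

text \<open>Every tuple in a symbol of either alter ego lies in a finite piece, so being a morphism
  can be tested on the restrictions to the pieces, where \<open>mor_transferred_sub\<close> says
  that both signatures have the same morphisms. Continuity refers to the same space on both
  sides.\<close>

lemma mor_transferred: "mor E' transferred (ego_struct M) = mor E Y (ego_struct M)"
proof (intro set_eqI iffI)
  fix u assume u: "u \<in> mor E Y (ego_struct M)"
  then show "u \<in> mor E' transferred (ego_struct M)"
    unfolding mor_ego_iff[OF E' wf_transferred] mor_ego_iff[OF E wY]
    using local_rel_mor[OF _ u] interp_transferred by simp
next
  fix u assume u: "u \<in> mor E' transferred (ego_struct M)"
  have sub: "restrict u C \<in> mor E (induced_on Y C) (ego_struct M)" if C: "C \<in> subs" for C
    unfolding mor_transferred_sub[OF C, symmetric]
      mor_ego_iff[OF E' wf_transferred_sub[OF C]] points_transferred_sub[OF C]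
  proof (intro conjI ballI)
    show "restrict u C \<in> C \<rightarrow>\<^sub>E carrier M"
      using PiE_mem[OF mor_egoD[OF u]] subsD(4)[OF C] by (simp add: restrict_PiE_iff subset_iff)
    then show "continuous_map (space (transferred_sub C)) (discrete_topology (carrier M)) (restrict u C)"
      by (auto simp: space_transferred_sub[OF C])
    fix s t assume s: "s \<in> syms E'" and t: "t \<in> interp (transferred_sub C) s"
    then have t': "t \<in> ext_rel M E (induced_on Y C) (sym_rel s)" unfolding interp_transferred_sub[OF C s] by blast
    have "t \<in> interp transferred s" unfolding interp_transferred[OF s] by (rule local_relI[OF C t'])
    from mor_ego_interp[OF E' wf_transferred u s this]
    have "compose {..<sym_arity s} u t \<in> snd (sym_rel s)" .
    moreover have "compose {..<sym_arity s} (restrict u C) t = compose {..<sym_arity s} u t"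
      by (rule compose_tuples_cong[OF ext_rel_subs[OF C t']]) simp
    ultimately show "compose {..<sym_arity s} (restrict u C) t \<in> snd (sym_rel s)" by simp
  qed
  show "u \<in> mor E Y (ego_struct M)"
    unfolding mor_ego_iff[OF E wY]
  proof (intro conjI ballI)
    show "u \<in> points Y \<rightarrow>\<^sub>E carrier M" using mor_egoD[OF u] by simp
    show "continuous_map (space Y) (discrete_topology (carrier M)) u"
      using u unfolding mor_ego_iff[OF E' wf_transferred] by simp
    fix s t assume s: "s \<in> syms E" and t: "t \<in> interp Y s"
    have tY: "t \<in> tuples (sym_arity s) (points Y)" using interp_subset_tuples[OF wY s] t by blast
    have "finite (t ` {..<sym_arity s})" "t ` {..<sym_arity s} \<subseteq> points Y"
      by simp (rule image_subsetI, rule PiE_mem[OF tY])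
    then obtain C where C: "C \<in> subs" and tC: "t ` {..<sym_arity s} \<subseteq> C" by (rule subs_cofinal)
    have tC: "t \<in> tuples (sym_arity s) C" by (rule tuples_subset_in[OF tuples_finite_image[OF tY] tC])
    have "t \<in> interp (induced_on Y C) s"
      using t tC unfolding interp_induced[OF wY subsD(2)[OF C] s] by blast
    from mor_ego_interp[OF E wf_struct_induced[OF wY subsD(2)[OF C]] sub[OF C] s this]
    have "compose {..<sym_arity s} (restrict u C) t \<in> snd (sym_rel s)" .
    moreover have "compose {..<sym_arity s} (restrict u C) t = compose {..<sym_arity s} u t"
      by (rule compose_tuples_cong[OF tC]) simp
    ultimately show "compose {..<sym_arity s} u t \<in> snd (sym_rel s)" by simp
  qed
qed

lemma represented_model: "represented \<Sigma> M E Y"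
  using represented_transferred
  unfolding represented_def dual_E_def mor_transferred space_transferred .

text \<open>The hypothesis concerns morphisms on \<open>Y\<close>, while separation of a piece
  \<open>C\<close> needs all morphisms on \<open>C\<close>, which are not known to extend to
  \<open>Y\<close>. The gap is bridged by facts instead of morphisms: \<open>point_map\<close> for
  \<open>transferred\<close> gives \<open>g\<close> from D(r), and the finitely many facts about
  \<open>g\<close> that \<open>finite_presentation\<close> asks for in the language of
  \<open>E'\<close> hold in some \<open>C\<close>. Every morphism on this \<open>C\<close> respects
  them and so sends \<open>t\<close> into \<open>r\<close>.\<close>

lemma interp_detected:
  assumes s: "s \<in> syms E" and t: "t \<in> tuples (sym_arity s) (points Y)"
    and tu: "\<And>u. u \<in> mor E Y (ego_struct M) \<Longrightarrow> compose {..<sym_arity s} u t \<in> snd (sym_rel s)"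
  shows "t \<in> interp Y s"
proof -
  let ?r = "sym_rel s" and ?n = "sym_arity s"
  let ?H = "alg_hom \<Sigma> (rel_alg M ?r) M" and ?D = "dual_D \<Sigma> M (rel_alg M ?r)"
  note r = compatible_sym_rel[OF E s]
  have "t \<in> ext_rel M E' transferred ?r"
    using t tu unfolding ext_rel_def mor_transferred by simp
  then obtain g where g: "g \<in> ?H \<rightarrow> points transferred"
    and gi: "\<And>s q. s \<in> syms E' \<Longrightarrow> q \<in> interp ?D s \<Longrightarrow> compose {..<sym_arity s} g q \<in> interp transferred s"
    and gt: "compose {..<?n} g (projections ?r) = t"
    using point_map[OF M E' separated_transferred represented_transferred r] by metis
  obtain I where finI: "finite I" and I: "\<And>s q. (s, q) \<in> I \<Longrightarrow> s \<in> syms E' \<and> q \<in> interp ?D s"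
    and pres: "\<And>w. w \<in> ?H \<rightarrow> carrier M \<Longrightarrow>
      (\<And>s q. (s, q) \<in> I \<Longrightarrow> compose {..<sym_arity s} w q \<in> snd (sym_rel s)) \<Longrightarrow>
      compose {..<?n} w (projections ?r) \<in> snd ?r"
    using finite_presentation[OF E' finM r rel_alg_dualised(2)[OF r]] by metis
  have 1: "ev (\<lambda>C. \<forall>p\<in>I. compose {..<sym_arity (fst p)} g (snd p) \<in> ext_rel M E (induced_on Y C) (sym_rel (fst p)))"
  proof (rule ev_ball[OF finI ev_local_rel])
    fix p assume "p \<in> I"
    then have "fst p \<in> syms E'" "snd p \<in> interp ?D (fst p)" using I[of "fst p" "snd p"] by simp_all
    then show "compose {..<sym_arity (fst p)} g (snd p) \<in> local_rel (sym_rel (fst p))"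
      using gi interp_transferred by blast
  qed
  have finH: "finite ?H" by (rule finite_alg_hom[OF finite_rel_alg[OF finM r] finM])
  have 2: "ev (\<lambda>C. g ` ?H \<subseteq> C)" using finH g by (intro ev_superset) auto
  obtain C where C: "C \<in> subs" and gC: "g ` ?H \<subseteq> C" and
    IC: "\<And>p. p \<in> I \<Longrightarrow> compose {..<sym_arity (fst p)} g (snd p) \<in> ext_rel M E (induced_on Y C) (sym_rel (fst p))"
    by (rule ev_obtain[OF ev_conj[OF 1 2]]) blast
  have gC': "g \<in> ?H \<rightarrow> C" using gC by blast
  have tC: "t \<in> tuples ?n C" using compose_tuples[OF projections_hom[OF r] gC'] gt by simp
  have "t \<in> interp (induced_on Y C) s"
  proof (rule separated_by_interp[OF E wf_struct_induced[OF wY subsD(2)[OF C]] subsD(7)[OF C] s])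
    show "t \<in> tuples ?n (points (induced_on Y C))" using tC unfolding subsD(5)[OF C] .
    fix u assume u: "u \<in> mor E (induced_on Y C) (ego_struct M)"
    have uM: "u \<in> C \<rightarrow>\<^sub>E carrier M" using mor_egoD[OF u] unfolding subsD(5)[OF C] .
    have "compose {..<?n} (u \<circ> g) (projections ?r) \<in> snd ?r"
    proof (rule pres)
      show "u \<circ> g \<in> ?H \<rightarrow> carrier M" using PiE_mem[OF uM] gC by auto
      fix s' q assume "(s', q) \<in> I"
      from IC[OF this] u have "compose {..<sym_arity s'} u (compose {..<sym_arity s'} g q) \<in> snd (sym_rel s')"
        unfolding ext_rel_def fst_conv snd_conv by blast
      then show "compose {..<sym_arity s'} (u \<circ> g) q \<in> snd (sym_rel s')" unfolding compose_tuples_assoc .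
    qed
    then show "compose {..<?n} u t \<in> snd ?r"
      unfolding compose_tuples_assoc[symmetric] gt .
  qed
  then show ?thesis unfolding interp_induced[OF wY subsD(2)[OF C] s] by blast
qed

lemma separated_model: "separated M E Y"
proof (rule separatedI[OF bY])
  let ?U = "mor E Y (ego_struct M)"
  have U': "separated_by M E' transferred ?U"
    using separated_transferred unfolding separated_def mor_transferred by blast
  show "separated_by M E Y ?U"
  proof (rule separated_byI)
    show "?U \<noteq> {}" by (rule separated_byD(1)[OF U'])
    show "x = y" if "x \<in> points Y" "y \<in> points Y" "\<And>u. u \<in> ?U \<Longrightarrow> u x = u y" for x y
      by (rule separated_byD(3)[OF U']) (simp_all add: that)
    fix h x assume h: "h \<in> pops E" and x: "x \<in> tuples (arity h) (points Y)"
      and d: "\<And>u. u \<in> ?U \<Longrightarrow> compose {..<arity h} u x \<in> dom (snd h)"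
    have s: "Inl h \<in> syms E" using h unfolding syms_def by blast
    have x': "x \<in> tuples (arity h) (points transferred)" using x by simp
    \<comment> \<open>Morphisms that send \<open>x\<close> into the domain of \<open>h\<close> do
      not yet give a value in \<open>Y\<close>. It is found in \<open>transferred\<close>, where
      representation is available, and the completed tuple is then subject to
      \<open>interp_detected\<close>.\<close>
    obtain y where y: "y \<in> points transferred"
      and xy: "x(arity h := y) \<in> ext_rel M E' transferred (Suc (arity h), pop_graph h)"
      by (rule represented_pop_value[OF M E' wf_transferred represented_transferred E h x'])
        (use separated_byD(1)[OF U'] d in \<open>simp_all add: mor_transferred\<close>)
    have "x(arity h := y) \<in> interp Y (Inl h)"
    proof (rule interp_detected[OF s])
      show "x(arity h := y) \<in> tuples (sym_arity (Inl h)) (points Y)"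
        using tuple_upd_in[OF x] y by simp
      show "compose {..<sym_arity (Inl h)} u (x(arity h := y)) \<in> snd (sym_rel (Inl h))" if "u \<in> ?U" for u
        using xy that unfolding ext_rel_def mor_transferred by simp
    qed
    then show "x \<in> dom (pop Y h)" using interp_pop_iff[OF wY h x] by blast
  next
    fix \<rho> x assume "\<rho> \<in> rels E" and x: "x \<in> tuples (arity \<rho>) (points Y)"
      and d: "\<And>u. u \<in> ?U \<Longrightarrow> compose {..<arity \<rho>} u x \<in> snd \<rho>"
    then have s: "Inr \<rho> \<in> syms E" unfolding syms_def by blast
    from interp_detected[OF s] x d show "x \<in> rel Y \<rho>" by simp
  qed
qed

end

theorem theorem8p3:
  fixes \<Sigma> :: "'f sig" and M :: "('f, 'a) algebra" and E :: "'a alter_ego"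
  assumes "infinite (UNIV :: 'u set)"
    and "is_algebra \<Sigma> M" and "finite (carrier M)"
    and "\<exists>E'. is_alter_ego \<Sigma> M E' \<and> standard TYPE('u) M E' \<and> fully_dualises TYPE('u) \<Sigma> M E'"
    and "is_alter_ego \<Sigma> M E" and "fully_dualises_finite TYPE('u) \<Sigma> M E"
  shows "standard TYPE('u) M E \<and> fully_dualises TYPE('u) \<Sigma> M E"
proof -
  obtain E' where E': "is_alter_ego \<Sigma> M E'" "standard TYPE('u) M E'" "fully_dualises TYPE('u) \<Sigma> M E'"
    using assms(4) by blast
  interpret duality_transfer "TYPE('u)" \<Sigma> M E E'
    by (rule duality_transfer.intro) (use assms E' in simp_all)
  have model: "separated M E Y \<and> represented \<Sigma> M E Y"
    if "boolean_struct E Y" "\<forall>\<sigma>\<in>Th_uH M E. uh_true Y \<sigma>" for Y :: "('a, 'u) tstruct"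
  proof -
    interpret duality_transfer_model "TYPE('u)" \<Sigma> M E E' Y
      by unfold_locales (use that in simp_all)
    show ?thesis using separated_model represented_model by blast
  qed
  have sound: "boolean_struct E Y \<and> (\<forall>\<sigma>\<in>Th_uH M E. uh_true Y \<sigma>)" if "separated M E Y"
    for Y :: "('a, 'u) tstruct"
    using that separated_uh_true[OF assms(5) that] unfolding separated_def by blast
  have "standard TYPE('u) M E"
    unfolding standard_def set_eq_iff mem_Collect_eq IScP_iff_separated[OF assms(5)]
    using model sound by blast
  \<comment> \<open>\<open>dual_D\<close> does not refer to an alter ego, and \<open>dual_E\<close>
    does so only through the morphisms. As these coincide on D(A) for \<open>E\<close> and
    \<open>E'\<close>, the isomorphism provided by \<open>E'\<close> is literally the one
    required.\<close>
  moreover have "alg_iso \<Sigma> (eval_alg \<Sigma> M A) A (dual_E M E (dual_D \<Sigma> M A))"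
    if "A \<in> ISP \<Sigma> M" for A :: "('f, 'u) algebra"
    using full' that unfolding fully_dualises_def dual_E_def mor_dual_D_eq[OF that] by blast
  moreover have "struct_iso E (eval_struct M E X) X (dual_D \<Sigma> M (dual_E M E X))"
    if "X \<in> IScP M E" for X :: "('a, 'u) tstruct"
    using that model sound represented_imp_iso[OF assms(2,5)]
    unfolding IScP_iff_separated[OF assms(5)] by blast
  ultimately show ?thesis unfolding fully_dualises_def by blast
qed

end
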